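(* Let $(K^{(t)},\Sigma^{(t)})_{t\ge0}$ be generated from an initial $(K^{(0)},\Sigma^{(0)})\in\Omega$ by the iterative policy optimization (IPO) recursion $$K^{(t+1)}=K^{(t)}-\left(R+\gamma B^\top P_{K^{(t)}}B\right)^{-1}E_{K^{(t)}},\qquad \Sigma^{(t+1)}=\frac{\tau}{2}\left(R+\gamma B^\top P_{K^{(t)}}B\right)^{-1}.$$ Then for $\varepsilon>0$ and $$N\ge\frac{\|S_{K^*,\Sigma^*}\|}{\mu}\log\frac{C(K^{(0)},\Sigma^{(0)})-C(K^*,\Sigma^* )}{\varepsilon}$$ one has $C(K^{(N)},\Sigma^{(N)})-C(K^*,\Sigma^* )\le\varepsilon$.
   Context: Notation: $\|\cdot\|$ is the spectral norm; $\sigma_{\min}$ is the smallest singular value; $\mathbb{S}^d_+$, $\mathbb{S}^d_{++}$ are the symmetric positive semidefinite, resp. positive definite, $d\times d$ real matrices. Data: $\gamma\in(0,1)$, $\tau>0$, $A\in\mathbb{R}^{n\times n}$, $B\in\mathbb{R}^{n\times k}$, $Q\in\mathbb{S}^n_+$, $R\in\mathbb{S}^k_{++}$. States evolve by $x_{t+1}=Ax_t+Bu_t+w_t$, $x_0\sim\mathcal{D}$, with $(w_t)$ zero-mean i.i.d. noise with finite second moments, $W=\mathbb{E}[w_tw_t^\top]$. A stationary randomized Markov policy $\pi$ gives for each state $x$ a probability density $\pi(\cdot|x)$ on $\mathbb{R}^k$, $u_t\sim\pi(\cdot|x_t)$, with value $J_\pi(x)=\mathbb{E}_\pi\big[\sum_{t\ge0}\gamma^t(x_t^\top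 Qx_t+u_t^\top Ru_t+\tau\log\pi(u_t|x_t))\,\big|\,x_0=x\big]$. It is assumed that $\mathbb{E}_{\mathcal{D}}[x_0x_0^\top]$ exists and $\mu:=\sigma_{\min}(\mathbb{E}_{\mathcal{D}}[x_0x_0^\top])>0$. The parameter domain is $\Omega=\{(K,\Sigma):K\in\mathbb{R}^{k\times n},\ \Sigma\in\mathbb{S}^k_+\}$. For $(K,\Sigma)\in\Omega$: $\pi_{K,\Sigma}(\cdot|x)=\mathcal{N}(-Kx,\Sigma)$, $C(K,\Sigma)=\mathbb{E}_{x\sim\mathcal{D}}[J_{\pi_{K,\Sigma}}(x)]$, $S_{K,\Sigma}=\mathbb{E}_{\pi_{K,\Sigma}}[\sum_{i\ge0}\gamma^ix_ix_i^\top]$; $P_K\in\mathbb{S}^n_+$ is the matrix satisfying $P_K=Q+K^\top RK+\gamma(A-BK)^\top P_K(A-BK)$, and $E_K:=-\gamma B^\top P_K(A-BK)+RK$. Optimal parameters: the policy minimizing $J_\pi$ is $\mathcal{N}(-K^*x,\Sigma^* )$ with $K^*=\gamma(R+\gamma B^\top PB)^{-1}B^\top PA$, $\Sigma^*=\frac{\tau}{2}(R+\gamma B^\top PB)^{-1}$, where $P\in\mathbb{S}^n_+$ satisfies $P=Q+K^{*\top}RK^*+\gamma(A-BK^* )^\top P(A-BK^* )$. Standing assumption: $\|A-BK^*\|\le\rho$ for some $\rho\in(0,1/\sqrt\gamma)$. *)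

theory Defs
  imports "HOL-Probability.Probability"
begin

section \<open>Matrices\<close>

definition sym_psd :: "(real^'d^'d) set" where
  "sym_psd = {M. transpose M = M \<and> (\<forall>x. 0 \<le> x \<bullet> (M *v x))}"

definition sym_pd :: "(real^'d^'d) set" where
  "sym_pd = {M. transpose M = M \<and> (\<forall>x. x \<noteq> 0 \<longrightarrow> 0 < x \<bullet> (M *v x))}"

definition spectral_norm :: "real^'n^'m \<Rightarrow> real" where
  "spectral_norm M = onorm ((*v) M)"

definition singular_values :: "real^'n^'n \<Rightarrow> real set" where
  "singular_values M =
     {sqrt l | l. \<exists>v. v \<noteq> 0 \<and> (transpose M ** M) *v v = l *\<^sub>R v}"

definition sigma_min :: "real^'n^'n \<Rightarrow> real" where
  "sigma_min M = Min (singular_values M)"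

definition outer :: "real^'n \<Rightarrow> real^'n^'n" where
  "outer x = (\<chi> i j. x $ i * x $ j)"


section \<open>Expectations and logarithms in the extended reals\<close>

text \<open>A cost may be infinite, so it is an extended real:
  \<^term>\<open>ereal_expectation\<close> is the expectation of the positive part minus that of the negative
  part, and \<^term>\<open>\<infinity> - \<infinity> = (\<infinity> :: ereal)\<close> when neither is finite.\<close>

definition ereal_expectation :: "'a measure \<Rightarrow> ('a \<Rightarrow> ereal) \<Rightarrow> ereal" where
  "ereal_expectation M f =
     enn2ereal (\<integral>\<^sup>+ z. e2ennreal (f z) \<partial>M) - enn2ereal (\<integral>\<^sup>+ z. e2ennreal (- f z) \<partial>M)"

definition ereal_log :: "ereal \<Rightarrow> ereal" where
  "ereal_log x = (if x \<le> 0 then -\<infinity> else if x = \<infinity> then \<infinity> else ereal (ln (real_of_ereal x)))"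


section \<open>The controlled process\<close>

text \<open>A stationary randomized Markov policy is given by its densities: \<open>pol x u\<close> is the density
  of the action \<open>u\<close> in state \<open>x\<close>, with respect to Lebesgue measure.\<close>

type_synonym ('n, 'k) policy = "real^'n \<Rightarrow> real^'k \<Rightarrow> real"

definition draw_action ::
  "('n::finite, 'k::finite) policy \<Rightarrow> real^'n \<Rightarrow> ((real^'n) \<times> (real^'k)) measure" where
  "draw_action pol x =
     distr (density lborel (\<lambda>u. ennreal (pol x u))) borel (\<lambda>u. (x, u))"

text \<open>The law of \<open>(x\<^sub>t, u\<^sub>t)\<close> given the earlier state-action pairs \<open>h\<close>. The noise \<open>w\<^sub>t\<close> is drawn
  from \<open>\<nu>\<close> afresh at each step, independently of the past; \<open>init\<close> is the law of \<open>x\<^sub>0\<close>.\<close>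

primrec step_kernel ::
  "real^'n^'n \<Rightarrow> real^'k^'n \<Rightarrow> (real^'n) measure \<Rightarrow> ('n::finite, 'k::finite) policy
   \<Rightarrow> (real^'n) measure \<Rightarrow> nat \<Rightarrow> (nat \<Rightarrow> (real^'n) \<times> (real^'k))
   \<Rightarrow> ((real^'n) \<times> (real^'k)) measure" where
  "step_kernel A B \<nu> pol init 0 h = init \<bind> draw_action pol"
| "step_kernel A B \<nu> pol init (Suc t) h =
     distr \<nu> borel (\<lambda>w. A *v fst (h t) + B *v snd (h t) + w) \<bind> draw_action pol"

text \<open>The law of the whole trajectory \<open>t \<mapsto> (x\<^sub>t, u\<^sub>t)\<close>, obtained from the one-step kernels by the
  Ionescu-Tulcea theorem.\<close>

definition trajectory ::
  "real^'n^'n \<Rightarrow> real^'k^'n \<Rightarrow> (real^'n) measure \<Rightarrow> ('n::finite, 'k::finite) policy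
   \<Rightarrow> (real^'n) measure \<Rightarrow> (nat \<Rightarrow> (real^'n) \<times> (real^'k)) measure" where
  "trajectory A B \<nu> pol init =
     projective_family.lim UNIV
       (Ionescu_Tulcea.CI (step_kernel A B \<nu> pol init) (\<lambda>_. borel)) (\<lambda>_. borel)"

definition stage_cost ::
  "real \<Rightarrow> real^'n^'n \<Rightarrow> real^'k^'k \<Rightarrow> ('n::finite, 'k::finite) policy
   \<Rightarrow> real^'n \<Rightarrow> real^'k \<Rightarrow> real" where
  "stage_cost \<tau> Q R pol x u = x \<bullet> (Q *v x) + u \<bullet> (R *v u) + \<tau> * ln (pol x u)"

definition J_value ::
  "real \<Rightarrow> real \<Rightarrow> real^'n^'n \<Rightarrow> real^'k^'n \<Rightarrow> real^'n^'n \<Rightarrow> real^'k^'k \<Rightarrow> (real^'n) measure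
   \<Rightarrow> ('n::finite, 'k::finite) policy \<Rightarrow> real^'n \<Rightarrow> ereal" where
  "J_value \<gamma> \<tau> A B Q R \<nu> pol x =
     ereal_expectation (trajectory A B \<nu> pol (return borel x))
       (\<lambda>z. \<Sum>t. ereal (\<gamma> ^ t * stage_cost \<tau> Q R pol (fst (z t)) (snd (z t))))"


section \<open>Gaussian policies\<close>

definition omega :: "((real^'n^'k) \<times> (real^'k^'k)) set" where
  "omega = UNIV \<times> sym_psd"

definition gaussian_density :: "real^'k \<Rightarrow> real^'k^'k \<Rightarrow> real^'k \<Rightarrow> real" where
  "gaussian_density m \<Sigma> u =
     exp (- ((u - m) \<bullet> (matrix_inv \<Sigma> *v (u - m))) / 2) / sqrt ((2 * pi) ^ CARD('k) * det \<Sigma>)"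

definition gaussian_policy ::
  "real^'n^'k \<Rightarrow> real^'k^'k \<Rightarrow> ('n::finite, 'k::finite) policy" where
  "gaussian_policy K \<Sigma> x = gaussian_density (- (K *v x)) \<Sigma>"

text \<open>For singular \<open>\<Sigma>\<close> the distribution \<open>N(-Kx, \<Sigma>)\<close> has no density and its negative entropy is
  \<open>+\<infinity>\<close>, so the cost is \<open>+\<infinity>\<close>.\<close>

definition C_cost ::
  "real \<Rightarrow> real \<Rightarrow> real^'n^'n \<Rightarrow> real^'k^'n \<Rightarrow> real^'n^'n \<Rightarrow> real^'k^'k \<Rightarrow> (real^'n) measure
   \<Rightarrow> (real^'n) measure \<Rightarrow> real^'n^'k \<Rightarrow> real^'k^'k \<Rightarrow> ereal" where
  "C_cost \<gamma> \<tau> A B Q R \<nu> D K \<Sigma> =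
     (if \<Sigma> \<in> sym_pd
      then ereal_expectation D (J_value \<gamma> \<tau> A B Q R \<nu> (gaussian_policy K \<Sigma>))
      else \<infinity>)"

text \<open>Meaningful for positive definite \<open>\<Sigma>\<close>, where \<^const>\<open>gaussian_policy\<close> is a density, as is the
  case for the optimal parameters.\<close>

definition S_mat ::
  "real \<Rightarrow> real^'n^'n \<Rightarrow> real^'k^'n \<Rightarrow> (real^'n) measure
   \<Rightarrow> (real^'n) measure \<Rightarrow> real^'n^'k \<Rightarrow> real^'k^'k \<Rightarrow> real^'n^'n" where
  "S_mat \<gamma> A B \<nu> D K \<Sigma> =
     (LINT z | trajectory A B \<nu> (gaussian_policy K \<Sigma>) D.
        (\<Sum>i. \<gamma> ^ i *\<^sub>R outer (fst (z i))))"

definition lyapunov_solution ::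
  "real \<Rightarrow> real^'n^'n \<Rightarrow> real^'k^'n \<Rightarrow> real^'n^'n \<Rightarrow> real^'k^'k \<Rightarrow> real^'n^'k \<Rightarrow> real^'n^'n \<Rightarrow> bool"
  where
  "lyapunov_solution \<gamma> A B Q R K P \<longleftrightarrow>
     P \<in> sym_psd \<and>
     P = Q + transpose K ** R ** K + \<gamma> *\<^sub>R (transpose (A - B ** K) ** P ** (A - B ** K))"

text \<open>A solution need not exist for every \<open>K\<close>, in which case the cost of \<open>K\<close> is \<open>+\<infinity>\<close>.\<close>

definition P_mat ::
  "real \<Rightarrow> real^'n^'n \<Rightarrow> real^'k^'n \<Rightarrow> real^'n^'n \<Rightarrow> real^'k^'k \<Rightarrow> real^'n^'k \<Rightarrow> real^'n^'n" where
  "P_mat \<gamma> A B Q R K = (THE P. lyapunov_solution \<gamma> A B Q R K P)"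

definition E_mat ::
  "real \<Rightarrow> real^'n^'n \<Rightarrow> real^'k^'n \<Rightarrow> real^'n^'n \<Rightarrow> real^'k^'k \<Rightarrow> real^'n^'k \<Rightarrow> real^'n^'k" where
  "E_mat \<gamma> A B Q R K =
     - (\<gamma> *\<^sub>R (transpose B ** P_mat \<gamma> A B Q R K ** (A - B ** K))) + R ** K"

definition gain_inv ::
  "real \<Rightarrow> real^'k^'n \<Rightarrow> real^'k^'k \<Rightarrow> real^'n^'n \<Rightarrow> real^'k^'k" where
  "gain_inv \<gamma> B R P = matrix_inv (R + \<gamma> *\<^sub>R (transpose B ** P ** B))"

end

(* Write M(K) = Q + K^T R K for the running cost, C(K) = A - B K for the closed loop, G(K) for the
   Schur term E_K^T (R + gamma B^T P_K B)^{-1} E_K and f_P(Sigma) for the free energy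
   tr((R + gamma B^T P B) Sigma) - (tau/2) ln det Sigma.  The cost of (K, Sigma) is
   tr(P_K X) + f_{P_K}(Sigma) / (1 - gamma) + const, with X = E[x_0 x_0^T] + gamma/(1-gamma) W.

   Completing the square in the Bellman equation shows that one IPO step decreases the cost by at
   least delta/(1 - gamma) + mu tr G(K), where delta is the free-energy gap of Sigma (Gibbs'
   inequality), while the same identity along the optimal closed loop bounds the suboptimality by
   delta/(1 - gamma) + |S*| tr G(K).  Hence the suboptimality contracts by 1 - mu/|S*| per step.

   An infinite initial cost makes the hypothesis on N unsatisfiable; a finite one forces the
   Lyapunov equation of K^(0) to be solvable, since E[x_0 x_0^T] >= mu I, and one IPO step preserves
   solvability.  Solutions are unique because a nonzero difference would produce a mode of modulus
   1/sqrt(gamma) that no running cost detects, and which K* could not damp either. *)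
theory Submission
  imports Defs "HOL-Computational_Algebra.Fundamental_Theorem_Algebra"
begin

section \<open>Positive semidefinite matrices\<close>

text \<open>With \<open>Q\<close> only semidefinite, stability of \<open>A - B ** K\<close> cannot
  be read off the running cost, so \<open>P_K\<close> is treated without spectral radii: it is the
  sum of an increasing series of psd matrices, bounded by any supersolution of its equation. This
  serves both the IPO step, where the old \<open>P_K\<close> is a supersolution for the new gain,
  and uniqueness, where a solution is a supersolution of its own equation.

  Cost matrices are pulled back along the closed loop (\<open>C^T H C\<close>), covariances are
  pushed forward (\<open>C X C^T\<close>), and the trace pairs the two. The constants |S*| and mu
  arise by testing psd inequalities against covariances: S* solves the Lyapunov equation dual to
  that of \<open>P\<close>, and E[x_0 x_0^T] is the part of the driving covariance that is bounded
  below.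

  The obstacle on the probabilistic side is that costs may be infinite while the log-density has no
  sign. The cost of a path is split into a series of nonnegative quadratic terms, handled by Tonelli
  whether finite or not, and the log-density part, whose series is integrable; no
  \<open>\<infinity> - \<infinity>\<close> arises. Decompositions of matrices come from bases
  orthonormal for a given form.\<close>

lemma inner_transpose_matrix: "x \<bullet> (transpose A *v y) = (A *v x) \<bullet> (y::real^'m)"
  for A :: "real^'n^'m"
  by (metis dot_lmul_matrix inner_commute transpose_matrix_vector)

lemmas mv_simps = matrix_vector_mul_assoc[symmetric] matrix_vector_mult_add_rdistrib
  matrix_vector_mult_diff_rdistrib matrix_vector_right_distrib matrix_vector_mult_diff_distrib
  scaleR_matrix_vector_assoc[symmetric] matrix_vector_mult_scaleR inner_transpose_matrix
  inner_add_left inner_add_right inner_diff_left inner_diff_right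

lemma sym_psdD: "M \<in> sym_psd \<Longrightarrow> transpose M = M" "M \<in> sym_psd \<Longrightarrow> 0 \<le> x \<bullet> (M *v x)"
  by (auto simp: sym_psd_def)

lemma sym_pd_psd: "M \<in> sym_pd \<Longrightarrow> M \<in> sym_psd"
  by (auto simp: sym_psd_def sym_pd_def) (metis inner_zero_left less_eq_real_def)

lemma sym_inner: "transpose M = M \<Longrightarrow> x \<bullet> (M *v y) = y \<bullet> (M *v x)" for M :: "real^'n^'n"
  by (metis inner_commute inner_transpose_matrix)

lemma transpose_add: "transpose (A + B) = transpose A + transpose B"
  by (simp add: transpose_def vec_eq_iff)

lemma transpose_diff: "transpose (A - B) = transpose A - transpose (B::'a::ab_group_add^'n^'m)"
  by (simp add: transpose_def vec_eq_iff)

text \<open>Polarization at \<open>x + y\<close> recovers the bilinear form.\<close>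

lemma symmetric_eq_iff_quadratic:
  fixes M N :: "real^'n^'n"
  assumes "transpose M = M" "transpose N = N" "\<And>x. x \<bullet> (M *v x) = x \<bullet> (N *v x)"
  shows "M = N"
proof -
  have "x \<bullet> (M *v y) = x \<bullet> (N *v y)" for x y
    using assms(3)[of "x + y"] assms(3)[of x] assms(3)[of y]
      sym_inner[OF assms(1), of x y] sym_inner[OF assms(2), of x y]
    by (simp add: mv_simps)
  then have "M *v y = N *v y" for y
    by (metis inner_eq_zero_iff inner_diff_right right_minus_eq)
  then show ?thesis by (simp add: matrix_eq)
qed

text \<open>If \<open>M *v x\<close> were nonzero, a small step from \<open>x\<close> against it
  would lower the form at first order, below its minimum zero.\<close>

lemma psd_kernel:
  assumes "M \<in> sym_psd" "x \<bullet> (M *v x) = 0" shows "M *v x = (0::real^'n)"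
proof (rule ccontr)
  assume n: "M *v x \<noteq> 0"
  define y where "y = M *v x"
  define c where "c = y \<bullet> (M *v y)"
  have c: "0 \<le> c" "0 < y \<bullet> y" using sym_psdD(2)[OF assms(1)] n by (auto simp: c_def y_def)
  have "0 \<le> (x - t *\<^sub>R y) \<bullet> (M *v (x - t *\<^sub>R y))" for t
    using sym_psdD(2)[OF assms(1)] .
  moreover have "(x - t *\<^sub>R y) \<bullet> (M *v (x - t *\<^sub>R y)) = t^2 * c - 2 * t * (y \<bullet> y)" for t
    using assms(2) sym_inner[OF sym_psdD(1)[OF assms(1)], of x y]
    by (simp add: mv_simps c_def power2_eq_square algebra_simps y_def)
  ultimately have *: "2 * t * (y \<bullet> y) \<le> t^2 * c" for t
    by (metis diff_ge_0_iff_ge)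
  show False
  proof (cases "c = 0")
    case True then show False using *[of 1] c by simp
  next
    case False
    \<comment> \<open>This \<open>t\<close> minimizes
      \<open>t^2 * c - 2 * t * (y \<bullet> y)\<close>.\<close>
    then have "2 * (y \<bullet> y / c) * (y \<bullet> y) \<le> (y \<bullet> y / c)^2 * c" using *[of "y \<bullet> y / c"] by simp
    moreover have "(y \<bullet> y / c)^2 * c = (y \<bullet> y / c) * (y \<bullet> y)"
      using False by (simp add: power2_eq_square)
    moreover have "0 < (y \<bullet> y / c) * (y \<bullet> y)" using c False by simp
    ultimately show False by linarith
  qed
qed

lemma psd_add: "M \<in> sym_psd \<Longrightarrow> N \<in> sym_psd \<Longrightarrow> M + N \<in> sym_psd"
  by (auto simp: sym_psd_def transpose_add mv_simps)

lemma psd_scaleR: "M \<in> sym_psd \<Longrightarrow> 0 \<le> c \<Longrightarrow> c *\<^sub>R M \<in> sym_psd"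
  by (auto simp: sym_psd_def transpose_scalar mv_simps)

lemma pd_add_psd: "M \<in> sym_pd \<Longrightarrow> N \<in> sym_psd \<Longrightarrow> M + N \<in> sym_pd"
  by (auto simp: sym_psd_def sym_pd_def transpose_add mv_simps add_pos_nonneg)

lemma pd_scaleR: "M \<in> sym_pd \<Longrightarrow> 0 < c \<Longrightarrow> c *\<^sub>R M \<in> sym_pd"
  by (auto simp: sym_pd_def transpose_scalar mv_simps)

lemma mat_1_pd: "mat 1 \<in> (sym_pd :: (real^'n^'n) set)"
  by (auto simp: sym_pd_def)

lemma psd_congruence: "M \<in> sym_psd \<Longrightarrow> transpose F ** M ** F \<in> sym_psd"
  for F :: "real^'n^'m"
  by (auto simp: sym_psd_def matrix_transpose_mul mv_simps matrix_mul_assoc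
      simp del: transpose_matrix_vector)

lemma entry_eq_inner: "M $ i $ j = axis i 1 \<bullet> (M *v axis j 1)" for M :: "real^'n^'m"
  by (simp add: matrix_vector_mult_basis column_def inner_axis' del: vec_lambda_eta)

section \<open>Factorization and inversion of positive definite matrices\<close>

lemma pd_orthonormal_set:
  fixes N :: "real^'n^'n"
  assumes N: "N \<in> sym_pd" and "m \<le> CARD('n)"
  shows "\<exists>S. finite S \<and> card S = m \<and> (\<forall>x\<in>S. x \<bullet> (N *v x) = 1) \<and>
    (\<forall>x\<in>S. \<forall>y\<in>S. x \<noteq> y \<longrightarrow> x \<bullet> (N *v y) = 0)"
  using assms(2)
proof (induction m)
  case 0 then show ?case by (intro exI[of _ "{}"]) auto
next
  case (Suc m)
  then obtain S where S: "finite S" "card S = m" "\<forall>x\<in>S. x \<bullet> (N *v x) = 1"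
    "\<forall>x\<in>S. \<forall>y\<in>S. x \<noteq> y \<longrightarrow> x \<bullet> (N *v y) = 0" by auto
  \<comment> \<open>Euclidean orthogonality to \<open>N *v y\<close> is orthogonality to
    \<open>y\<close> for the form \<open>N\<close>. Fewer vectors than dimensions leave room for one
    more, which then only needs normalizing.\<close>
  have "dim ((*v) N ` S) \<le> card ((*v) N ` S)" using S by (intro dim_le_card') auto
  also have "\<dots> \<le> m" using S card_image_le by metis
  finally have "dim ((*v) N ` S) < DIM(real^'n)" using Suc.prems by simp
  then obtain x where x: "x \<noteq> 0" "\<And>y. y \<in> S \<Longrightarrow> orthogonal x (N *v y)"
    using orthogonal_to_subspace_exists[of "(*v) N ` S"] by (metis imageI span_base)
  define q where "q = x \<bullet> (N *v x)"
  have q: "q > 0" using N x by (auto simp: sym_pd_def q_def)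
  define z where "z = (1 / sqrt q) *\<^sub>R x"
  have z1: "z \<bullet> (N *v z) = 1" using q by (simp add: z_def mv_simps q_def[symmetric])
  have z0: "z \<bullet> (N *v y) = 0" "y \<bullet> (N *v z) = 0" if "y \<in> S" for y
    using x(2)[OF that] sym_inner[of N y z] N by (auto simp: z_def orthogonal_def sym_pd_def)
  then have "z \<notin> S" using z1 by auto
  then show ?case using S z1 z0 by (intro exI[of _ "insert z S"]) auto
qed

text \<open>The columns of \<open>L\<close> are a basis orthonormal for the form \<open>N\<close>.
  Then \<open>L ** transpose L\<close> is the inverse of \<open>N\<close>, so \<open>L\<close> plays
  the part of an inverse square root.\<close>

lemma pd_factor:
  fixes N :: "real^'n^'n"
  assumes N: "N \<in> sym_pd"
  shows "\<exists>L :: real^'n^'n. transpose L ** N ** L = mat 1"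
proof -
  obtain S where S: "finite S" "card S = CARD('n)" "\<forall>x\<in>S. x \<bullet> (N *v x) = 1"
    "\<forall>x\<in>S. \<forall>y\<in>S. x \<noteq> y \<longrightarrow> x \<bullet> (N *v y) = 0" using pd_orthonormal_set[OF N order_refl] by auto
  then obtain h where h: "bij_betw h (UNIV::'n set) S"
    using finite_same_card_bij[of "UNIV::'n set" S] by auto
  define L :: "real^'n^'n" where "L = (\<chi> i j. h j $ i)"
  have c: "L *v axis j 1 = h j" for j
    by (simp add: L_def matrix_vector_mult_basis column_def vec_eq_iff)
  have "(transpose L ** N ** L) $ i $ j = (mat 1 :: real^'n^'n) $ i $ j" for i j
  proof -
    have "(transpose L ** N ** L) $ i $ j = axis i 1 \<bullet> ((transpose L ** N ** L) *v axis j 1)"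
      by (rule entry_eq_inner)
    also have "\<dots> = h i \<bullet> (N *v h j)" by (simp add: mv_simps c del: transpose_matrix_vector)
    also have "\<dots> = (if i = j then 1 else 0)"
    proof -
      have "h i \<in> S" "h j \<in> S" "h i = h j \<longleftrightarrow> i = j" using h by (auto simp: bij_betw_def inj_on_def)
      then show ?thesis using S by auto
    qed
    finally show ?thesis by (simp add: mat_def)
  qed
  then show ?thesis by (auto simp: vec_eq_iff)
qed

lemma matrix_inv_eqI: "A ** B = mat 1 \<Longrightarrow> matrix_inv A = B" for A B :: "real^'n^'n"
proof -
  assume AB: "A ** B = mat 1"
  then have "B ** A = mat 1" by (rule iffD1[OF matrix_left_right_inverse])
  with AB have "\<exists>A'. A ** A' = mat 1 \<and> A' ** A = mat 1" by auto
  from someI_ex[OF this] have "matrix_inv A ** A = mat 1" unfolding matrix_inv_def by auto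
  then show ?thesis by (metis AB matrix_mul_assoc matrix_mul_lid matrix_mul_rid)
qed

lemma pd_inverse_factor:
  fixes N :: "real^'n^'n"
  assumes N: "N \<in> sym_pd"
  obtains L :: "real^'n^'n" where "transpose L ** N ** L = mat 1" "matrix_inv N = L ** transpose L"
    "N ** (L ** transpose L) = mat 1" "(L ** transpose L) ** N = mat 1"
proof -
  obtain L :: "real^'n^'n" where L: "transpose L ** N ** L = mat 1" using pd_factor[OF N] by auto
  then have "L ** (transpose L ** N) = mat 1"
    by (rule iffD1[OF matrix_left_right_inverse])
  then have 1: "(L ** transpose L) ** N = mat 1" by (simp add: matrix_mul_assoc)
  then have 2: "N ** (L ** transpose L) = mat 1" by (rule iffD1[OF matrix_left_right_inverse])
  show thesis using that[OF L matrix_inv_eqI[OF 2] 2 1] .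
qed

lemma pd_inverse:
  fixes N :: "real^'n^'n"
  assumes N: "N \<in> sym_pd"
  shows "N ** matrix_inv N = mat 1" "matrix_inv N ** N = mat 1" "matrix_inv N \<in> sym_pd"
    "matrix_inv (matrix_inv N) = N"
proof -
  obtain L :: "real^'n^'n" where L: "transpose L ** N ** L = mat 1" "matrix_inv N = L ** transpose L"
    "N ** (L ** transpose L) = mat 1" "(L ** transpose L) ** N = mat 1"
    using pd_inverse_factor[OF N] .
  show 1: "N ** matrix_inv N = mat 1" and 2: "matrix_inv N ** N = mat 1" using L by simp_all
  have "0 < x \<bullet> (matrix_inv N *v x)" if "x \<noteq> 0" for x
  proof -
    have "x \<bullet> (matrix_inv N *v x) = (transpose L *v x) \<bullet> (transpose L *v x)"
      using inner_transpose_matrix[of x "transpose L"] by (simp add: L(2) mv_simps)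
    moreover have "transpose L *v x \<noteq> 0"
    proof
      assume "transpose L *v x = 0"
      then have "(N ** (L ** transpose L)) *v x = 0" by (simp add: matrix_vector_mul_assoc[symmetric])
      then show False using that L(3) by simp
    qed
    ultimately show ?thesis by simp
  qed
  moreover have "transpose (matrix_inv N) = matrix_inv N"
    by (simp add: L(2) matrix_transpose_mul)
  ultimately show "matrix_inv N \<in> sym_pd" by (auto simp: sym_pd_def)
  show "matrix_inv (matrix_inv N) = N" using matrix_inv_eqI[OF 2] .
qed

text \<open>The factor of the inverse of \<open>matrix_inv N\<close> is a factor of \<open>N\<close>
  itself.\<close>

lemma pd_factorization:
  fixes N :: "real^'n^'n"
  assumes "N \<in> sym_pd"
  obtains L :: "real^'n^'n" where "N = L ** transpose L"
proof -
  obtain L :: "real^'n^'n" where "matrix_inv (matrix_inv N) = L ** transpose L"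
    using pd_inverse_factor[OF pd_inverse(3)[OF assms]] .
  then show thesis using that pd_inverse(4)[OF assms] by simp
qed

section \<open>Trace inequalities for semidefinite matrices\<close>

lemma trace_scaleR: "trace (c *\<^sub>R A) = c * trace (A::real^'n^'n)"
  by (simp add: trace_def sum_distrib_left)

lemma trace_congruence: "trace (transpose L ** Y ** L) = (\<Sum>i\<in>UNIV. column i L \<bullet> (Y *v column i L))"
  for L :: "real^'m^'n"
proof -
  have c: "L *v axis i 1 = column i L" for i by (rule matrix_vector_mult_basis)
  have "(transpose L ** Y ** L) $ i $ i = column i L \<bullet> (Y *v column i L)" for i
  proof -
    have "(transpose L ** Y ** L) $ i $ i = axis i 1 \<bullet> ((transpose L ** Y ** L) *v axis i 1)"
      by (rule entry_eq_inner)
    then show ?thesis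
      by (simp add: mv_simps c del: transpose_matrix_vector matrix_vector_mult_basis)
  qed
  then show ?thesis by (simp add: trace_def)
qed

lemma trace_psd_nonneg: "Y \<in> sym_psd \<Longrightarrow> 0 \<le> trace Y" for Y :: "real^'n^'n"
  using trace_congruence[of "mat 1 :: real^'n^'n" Y]
  by (simp add: sym_psd_def sum_nonneg)

lemma matrix_matrix_mult_add_rdistrib: "(A + B) ** C = A ** C + B ** C" for A :: "'a::semiring_1^'n^'m"
  by (simp add: matrix_matrix_mult_def vec_eq_iff distrib_right sum.distrib)

text \<open>For \<open>G = L L^T\<close> the trace is that of \<open>L^T Y L\<close>, a sum of
  values of the form \<open>Y\<close>. Such a factor is at hand for positive definite matrices, so
  \<open>G\<close> is perturbed by a small multiple of the identity.\<close>

lemma trace_mul_psd_nonneg: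
  fixes G Y :: "real^'n^'n"
  assumes "G \<in> sym_psd" "Y \<in> sym_psd" shows "0 \<le> trace (G ** Y)"
proof (rule field_le_epsilon)
  fix e :: real assume e: "0 < e"
  \<comment> \<open>The perturbation changes the trace by \<open>d * trace Y\<close>, which this
    choice keeps below \<open>e\<close>; the 1 guards against trace zero.\<close>
  define d where "d = e / (trace Y + 1)"
  have tY: "0 \<le> trace Y" using trace_psd_nonneg assms by auto
  have d: "0 < d" "d * trace Y \<le> e" using e tY by (auto simp: d_def divide_simps mult_left_mono)
  have Gd: "G + d *\<^sub>R mat 1 \<in> sym_pd"
    using pd_add_psd[OF pd_scaleR[OF mat_1_pd d(1)] assms(1)] by (simp add: add.commute)
  obtain L :: "real^'n^'n" where L: "G + d *\<^sub>R mat 1 = L ** transpose L"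
    using pd_factorization[OF Gd] .
  have "0 \<le> trace (transpose L ** Y ** L)"
    unfolding trace_congruence using assms by (intro sum_nonneg) (auto simp: sym_psd_def)
  also have "\<dots> = trace ((L ** transpose L) ** Y)"
    by (metis matrix_mul_assoc trace_mul_sym)
  also have "\<dots> = trace (G ** Y) + d * trace Y"
    unfolding L[symmetric] by (simp add: matrix_matrix_mult_add_rdistrib trace_add scalar_matrix_assoc[symmetric] trace_scaleR)
  finally show "0 \<le> trace (G ** Y) + e" using d by linarith
qed

lemma trace_mono_psd:
  fixes G H Y :: "real^'n^'n"
  assumes "H - G \<in> sym_psd" "Y \<in> sym_psd" shows "trace (G ** Y) \<le> trace (H ** Y)"
proof -
  have "(H - G) ** Y = H ** Y - G ** Y" 
    by (simp add: matrix_matrix_mult_def vec_eq_iff algebra_simps sum_subtractf)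
  then show ?thesis using trace_mul_psd_nonneg[OF assms] by (simp add: trace_sub)
qed

text \<open>Evaluate the form at sums and differences of two basis vectors. The bound makes the
  trace control the norm, so that series of psd matrices converge as soon as their traces
  do.\<close>

lemma psd_entry_le_trace:
  fixes G :: "real^'n^'n"
  assumes "G \<in> sym_psd" shows "\<bar>G $ i $ j\<bar> \<le> trace G"
proof -
  note e = entry_eq_inner[of G]
  have d: "0 \<le> G $ i $ i" for i using assms by (simp add: e sym_psd_def)
  have le: "G $ i $ i \<le> trace G" for i
    unfolding trace_def using d by (intro member_le_sum) auto
  have "0 \<le> (axis i 1 + axis j 1) \<bullet> (G *v (axis i 1 + axis j 1))"
    "0 \<le> (axis i 1 - axis j 1) \<bullet> (G *v (axis i 1 - axis j 1))"
    using assms unfolding sym_psd_def by blast+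
  moreover have "G $ i $ j = G $ j $ i" using sym_inner[OF sym_psdD(1)[OF assms]] e by metis
  ultimately have "2 * \<bar>G $ i $ j\<bar> \<le> G $ i $ i + G $ j $ j"
    by (simp add: mv_simps e[symmetric])
  then show ?thesis using le[of i] le[of j] by linarith
qed

section \<open>Discounted Lyapunov series\<close>

text \<open>The pullback of the quadratic form \<open>H\<close> along \<open>C\<close>; the power
  \<open>congr C ^^ t\<close> evaluates \<open>H\<close> after \<open>t\<close> steps of
  \<open>C\<close>.\<close>

definition congr :: "real^'n^'n \<Rightarrow> real^'n^'n \<Rightarrow> real^'n^'n" where
  "congr C H = transpose C ** H ** C"

lemma congr_quadratic: "x \<bullet> (congr C H *v y) = (C *v x) \<bullet> (H *v (C *v y))"
  by (simp add: congr_def mv_simps del: transpose_matrix_vector)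

lemma transpose_congr: "transpose (congr C H) = congr C (transpose H)"
  by (simp add: congr_def matrix_transpose_mul matrix_mul_assoc)

lemma congr_psd: "H \<in> sym_psd \<Longrightarrow> congr C H \<in> sym_psd"
  unfolding congr_def by (rule psd_congruence)

lemma congr_add: "congr C (G + H) = congr C G + congr C H"
  by (simp add: congr_def matrix_add_ldistrib matrix_matrix_mult_add_rdistrib)

lemma congr_scaleR: "congr C (c *\<^sub>R H) = c *\<^sub>R congr C H"
  by (simp add: congr_def matrix_scalar_ac scalar_matrix_assoc[symmetric])

lemma linear_congr: "linear (congr C)"
  by (rule linearI) (simp_all add: congr_add congr_scaleR)

lemma congr_pow_psd: "H \<in> sym_psd \<Longrightarrow> (congr C ^^ t) H \<in> sym_psd"
  by (induction t) (auto simp: congr_psd)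

text \<open>Duality between pulling a cost back and pushing a covariance forward, by cyclicity of
  the trace.\<close>

lemma trace_congr_mul: "trace (congr C H ** X) = trace (H ** (C ** X ** transpose C))"
proof -
  have "trace (congr C H ** X) = trace (transpose C ** (H ** C ** X))"
    by (simp add: congr_def matrix_mul_assoc)
  also have "\<dots> = trace (H ** C ** X ** transpose C)" by (rule trace_mul_sym)
  finally show ?thesis by (simp add: matrix_mul_assoc)
qed

lemma bounded_linear_quadratic: "bounded_linear (\<lambda>M::real^'n^'m. x \<bullet> (M *v y))"
  unfolding linear_conv_bounded_linear[symmetric]
  by (rule linearI) (simp_all add: mv_simps)

lemma bounded_linear_trace_mul: "bounded_linear (\<lambda>M::real^'n^'n. trace (M ** Y))"
  unfolding linear_conv_bounded_linear[symmetric]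
  by (rule linearI) (simp_all add: matrix_matrix_mult_add_rdistrib trace_add scalar_matrix_assoc[symmetric] trace_scaleR)

lemma bounded_linear_trace_mul_right: "bounded_linear (\<lambda>M::real^'n^'n. trace (Y ** M))"
  using bounded_linear_trace_mul[of Y] by (simp add: trace_mul_sym[of Y])

lemma bounded_linear_transpose: "bounded_linear (transpose :: real^'n^'m \<Rightarrow> real^'m^'n)"
  unfolding linear_conv_bounded_linear[symmetric]
  by (rule linearI) (simp_all add: transpose_add transpose_scalar)

lemma psd_norm_le_trace:
  fixes G :: "real^'n^'n"
  assumes "G \<in> sym_psd" shows "norm G \<le> real CARD('n) * (real CARD('n) * trace G)"
proof -
  have "norm G \<le> (\<Sum>i\<in>UNIV. norm (G $ i))" by (simp add: norm_vec_def L2_set_le_sum)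
  also have "\<dots> \<le> (\<Sum>i\<in>(UNIV::'n set). \<Sum>j\<in>(UNIV::'n set). trace G)"
    by (intro sum_mono order_trans[OF norm_le_l1_cart] psd_entry_le_trace assms)
  finally show ?thesis by simp
qed

lemma psd_sums:
  fixes a :: "nat \<Rightarrow> real^'n^'n"
  assumes "\<And>t. a t \<in> sym_psd" "a sums P" shows "P \<in> sym_psd"
proof -
  have q: "(\<lambda>t. x \<bullet> (a t *v x)) sums (x \<bullet> (P *v x))" for x
    using bounded_linear.sums[OF bounded_linear_quadratic assms(2)] .
  have "0 \<le> x \<bullet> (P *v x)" for x
    by (rule sums_le[OF _ sums_zero q]) (rule sym_psdD(2)[OF assms(1)])
  moreover have "(\<lambda>t. transpose (a t)) sums transpose P"
    using bounded_linear.sums[OF bounded_linear_transpose assms(2)] .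
  then have "transpose P = P" using assms by (auto simp: sym_psdD(1) intro: sums_unique2)
  ultimately show ?thesis by (auto simp: sym_psd_def)
qed

text \<open>Terms of the discounted cost-to-go of the noiseless system
  \<open>x \<mapsto> C x\<close> with stage cost \<open>H\<close>.\<close>

definition disc_series :: "real \<Rightarrow> real^'n^'n \<Rightarrow> real^'n^'n \<Rightarrow> nat \<Rightarrow> real^'n^'n" where
  "disc_series \<gamma> C H t = \<gamma> ^ t *\<^sub>R (congr C ^^ t) H"

lemma disc_series_psd: "H \<in> sym_psd \<Longrightarrow> 0 \<le> \<gamma> \<Longrightarrow> disc_series \<gamma> C H t \<in> sym_psd"
  by (simp add: disc_series_def psd_scaleR congr_pow_psd)

lemma disc_series_Suc: "disc_series \<gamma> C H (Suc t) = \<gamma> *\<^sub>R congr C (disc_series \<gamma> C H t)"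
  by (simp add: disc_series_def congr_scaleR)

lemma disc_series_lyapunov:
  assumes "disc_series \<gamma> C H sums P" shows "P = H + \<gamma> *\<^sub>R congr C P"
proof -
  have "(\<lambda>t. \<gamma> *\<^sub>R congr C (disc_series \<gamma> C H t)) sums (\<gamma> *\<^sub>R congr C P)"
    using linear_congr[of C] by (intro sums_scaleR_right bounded_linear.sums[OF _ assms])
      (simp add: linear_conv_bounded_linear)
  then have "disc_series \<gamma> C H sums (\<gamma> *\<^sub>R congr C P + disc_series \<gamma> C H 0)"
    by (subst (asm) disc_series_Suc[symmetric]) (simp add: sums_Suc_iff)
  with assms have "P = \<gamma> *\<^sub>R congr C P + disc_series \<gamma> C H 0" by (rule sums_unique2)
  then show ?thesis by (simp add: disc_series_def add.commute)
qed

lemma summable_disc_series: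
  fixes C H :: "real^'n^'n"
  assumes H: "H \<in> sym_psd" and g: "0 \<le> \<gamma>"
    and s: "summable (\<lambda>t. trace (disc_series \<gamma> C H t))"
  shows "summable (disc_series \<gamma> C H)"
proof (rule summable_comparison_test)
  show "summable (\<lambda>t. real CARD('n) * (real CARD('n) * trace (disc_series \<gamma> C H t)))"
    by (intro summable_mult s)
qed (auto intro!: psd_norm_le_trace disc_series_psd H g)

text \<open>The partial sums \<open>F\<close> obey the recursion
  \<open>F' = H + \<gamma> C^T F C\<close>, so \<open>P' - F'\<close> is the slack of
  \<open>P'\<close> plus the discounted pullback of \<open>P' - F\<close>; both are psd.\<close>

lemma supersolution_bound:
  fixes C H P' :: "real^'n^'n"
  assumes H: "H \<in> sym_psd" and g: "0 \<le> \<gamma>" and P': "P' \<in> sym_psd"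
    and le: "P' - (H + \<gamma> *\<^sub>R congr C P') \<in> sym_psd"
  shows "P' - (\<Sum>t<T. disc_series \<gamma> C H t) \<in> sym_psd"
proof (induction T)
  case 0 then show ?case using P' by simp
next
  case (Suc T)
  define F where "F = (\<Sum>t<T. disc_series \<gamma> C H t)"
  have "(\<Sum>t<Suc T. disc_series \<gamma> C H t) = H + \<gamma> *\<^sub>R congr C F"
    by (simp only: sum.lessThan_Suc_shift disc_series_Suc F_def linear_sum[OF linear_congr] scaleR_sum_right)
      (simp add: disc_series_def)
  moreover have "congr C P' = congr C F + congr C (P' - F)"
    by (simp only: congr_add[symmetric]) simp
  ultimately have "P' - (\<Sum>t<Suc T. disc_series \<gamma> C H t)
      = (P' - (H + \<gamma> *\<^sub>R congr C P')) + \<gamma> *\<^sub>R congr C (P' - F)"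
    by (simp add: scaleR_add_right)
  then show ?case using psd_add[OF le psd_scaleR[OF congr_psd[OF Suc.IH, of C] g]] by (simp only: F_def)
qed

text \<open>Monotone convergence in the psd order, with the supersolution as ceiling: traces of the
  partial sums stay below \<open>trace P'\<close>. The sum is a solution by a shift of the series,
  and lies below every supersolution.\<close>

lemma supersolution_disc_series:
  fixes C H P' :: "real^'n^'n"
  assumes H: "H \<in> sym_psd" and g: "0 \<le> \<gamma>" and P': "P' \<in> sym_psd"
    and le: "P' - (H + \<gamma> *\<^sub>R congr C P') \<in> sym_psd"
  obtains P where "disc_series \<gamma> C H sums P" "P \<in> sym_psd" "P' - P \<in> sym_psd"
proof -
  have "summable (\<lambda>t. trace (disc_series \<gamma> C H t))"
  proof (rule summableI_nonneg_bounded)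
    show "0 \<le> trace (disc_series \<gamma> C H t)" for t
      by (intro trace_psd_nonneg disc_series_psd H g)
    show "(\<Sum>t<T. trace (disc_series \<gamma> C H t)) \<le> trace P'" for T
    proof -
      have "(\<Sum>t<T. trace (disc_series \<gamma> C H t)) = trace (\<Sum>t<T. disc_series \<gamma> C H t)"
        unfolding trace_def sum_component by (rule sum.swap)
      then show ?thesis using trace_psd_nonneg[OF supersolution_bound[OF assms, of T]]
        by (simp add: trace_sub)
    qed
  qed
  then have s: "disc_series \<gamma> C H sums (\<Sum>t. disc_series \<gamma> C H t)"
    using summable_disc_series[OF H g] by (simp add: summable_sums)
  let ?P = "\<Sum>t. disc_series \<gamma> C H t"
  have P: "?P \<in> sym_psd" using psd_sums[OF _ s] disc_series_psd[OF H g] by blast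
  have "x \<bullet> (?P *v x) \<le> x \<bullet> (P' *v x)" for x
  proof -
    have q: "(\<lambda>t. x \<bullet> (disc_series \<gamma> C H t *v x)) sums (x \<bullet> (?P *v x))"
      using bounded_linear.sums[OF bounded_linear_quadratic s] .
    show ?thesis unfolding sums_unique[OF q]
    proof (rule suminf_le_const[OF sums_summable[OF q]])
      fix T
      have "(\<Sum>t<T. x \<bullet> (disc_series \<gamma> C H t *v x)) = x \<bullet> ((\<Sum>t<T. disc_series \<gamma> C H t) *v x)"
        by (rule linear_sum[OF bounded_linear.linear[OF bounded_linear_quadratic], symmetric])
      then show "(\<Sum>t<T. x \<bullet> (disc_series \<gamma> C H t *v x)) \<le> x \<bullet> (P' *v x)"
        using sym_psdD(2)[OF supersolution_bound[OF assms, of T], of x] by (simp add: mv_simps)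
    qed
  qed
  then have "P' - ?P \<in> sym_psd"
    using P P' by (auto simp: sym_psd_def transpose_diff mv_simps)
  with s P that show thesis by blast
qed

section \<open>Unimodular eigenvectors\<close>

definition cmat :: "real^'n^'m \<Rightarrow> complex^'n^'m" where
  "cmat C = (\<chi> i j. of_real (C $ i $ j))"

definition re_vec :: "complex^'n \<Rightarrow> real^'n" where "re_vec w = (\<chi> i. Re (w $ i))"
definition im_vec :: "complex^'n \<Rightarrow> real^'n" where "im_vec w = (\<chi> i. Im (w $ i))"

lemma re_cmat: "re_vec (cmat C *v w) = C *v re_vec w"
  and im_cmat: "im_vec (cmat C *v w) = C *v im_vec w"
  by (simp_all add: re_vec_def im_vec_def cmat_def matrix_vector_mult_def vec_eq_iff)

lemma re_scale: "re_vec (l *s w) = Re l *\<^sub>R re_vec w - Im l *\<^sub>R im_vec w"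
  and im_scale: "im_vec (l *s w) = Im l *\<^sub>R re_vec w + Re l *\<^sub>R im_vec w"
  by (simp_all add: re_vec_def im_vec_def vec_eq_iff)

lemma cvec_eq_iff: "v = w \<longleftrightarrow> re_vec v = re_vec w \<and> im_vec v = im_vec w"
  by (auto simp: re_vec_def im_vec_def vec_eq_iff complex_eq_iff)

lemma re_im_zero [simp]: "re_vec 0 = 0" "im_vec 0 = 0"
  by (simp_all add: re_vec_def im_vec_def vec_eq_iff)

lemma transpose_cmat: "transpose (cmat C) = cmat (transpose C)"
  by (simp add: cmat_def transpose_def vec_eq_iff)

section \<open>Krylov vectors and eigenvectors modulo a kernel\<close>

text \<open>The vector \<open>p(C) w\<close>.\<close>

definition krylov :: "'a::field^'n^'n \<Rightarrow> 'a poly \<Rightarrow> 'a^'n \<Rightarrow> 'a^'n" where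
  "krylov C p w = (\<Sum>i\<le>degree p. coeff p i *s ((*v) C ^^ i) w)"

lemma krylov_lessThan:
  assumes "degree p < N" shows "krylov C p w = (\<Sum>i<N. coeff p i *s ((*v) C ^^ i) w)"
  unfolding krylov_def using assms
  by (intro sum.mono_neutral_left) (auto simp: coeff_eq_0)

lemma krylov_linear_factor:
  "krylov C ([:- l, 1:] * r) w = C *v krylov C r w - l *s krylov C r w"
proof -
  define p where "p = [:- l, 1:] * r"
  define N where "N = Suc (degree r)"
  have dp: "degree p < Suc N"
    unfolding p_def N_def using degree_mult_le[of "[:-l, 1:]" r] by simp
  have cp: "coeff p i = (case i of 0 \<Rightarrow> 0 | Suc j \<Rightarrow> coeff r j) - l * coeff r i" for i
    by (simp add: p_def coeff_pCons)
  have "krylov C p w = (\<Sum>i<Suc N. (case i of 0 \<Rightarrow> 0 | Suc j \<Rightarrow> coeff r j) *s ((*v) C ^^ i) w)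
      - (\<Sum>i<Suc N. (l * coeff r i) *s ((*v) C ^^ i) w)"
    unfolding krylov_lessThan[OF dp] cp
    by (simp add: vector_sub_rdistrib sum_subtractf)
  also have "(\<Sum>i<Suc N. (case i of 0 \<Rightarrow> 0 | Suc j \<Rightarrow> coeff r j) *s ((*v) C ^^ i) w)
      = (\<Sum>i<N. coeff r i *s (C *v ((*v) C ^^ i) w))"
    by (simp add: sum.lessThan_Suc_shift del: sum.lessThan_Suc)
  also have "\<dots> = C *v krylov C r w"
    by (subst krylov_lessThan[of r N])
      (simp_all add: N_def vec.linear_sum[OF matrix_vector_mul_linear_gen]
        vec.linear_scale[OF matrix_vector_mul_linear_gen] del: sum.lessThan_Suc)
  also have "(\<Sum>i<Suc N. (l * coeff r i) *s ((*v) C ^^ i) w) = l *s krylov C r w"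
    by (subst krylov_lessThan[of r "Suc N"])
      (simp_all add: N_def vec.scale_sum_right del: sum.lessThan_Suc)
  finally show ?thesis by (simp add: p_def)
qed

text \<open>In dimension n, the n + 1 vectors \<open>w, C w, ..., C^n w\<close> are dependent, and
  the coefficients of a relation form the polynomial.\<close>

lemma krylov_annihilator:
  fixes C :: "'a::field^'n^'n"
  shows "\<exists>p. p \<noteq> 0 \<and> krylov C p w = 0"
proof -
  let ?f = "\<lambda>i. ((*v) C ^^ i) w"
  show ?thesis
  proof (cases "inj_on ?f {..CARD('n)}")
    \<comment> \<open>A repeated iterate would shrink the set and spoil the dimension count, but it
      gives the annihilator \<open>X^j - X^i\<close> at once.\<close>
    case False
    then obtain i j where ij: "i < j" "?f i = ?f j" unfolding inj_on_def by (metis linorder_neqE_nat)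
    define p where "p = monom 1 j - (monom 1 i :: 'a poly)"
    have d: "degree p < Suc j"
      unfolding p_def using ij degree_diff_le_max[of "monom (1::'a) j" "monom 1 i"] by (simp add: degree_monom_eq)
    have "coeff p j = 1" using ij by (simp add: p_def)
    then have "p \<noteq> 0" by auto
    moreover have "krylov C p w = (\<Sum>k<Suc j. (if k = j then ?f k else 0) - (if k = i then ?f k else 0))"
      unfolding krylov_lessThan[OF d] by (intro sum.cong) (auto simp: p_def)
    then have "krylov C p w = 0" using ij by (simp add: sum_subtractf)
    ultimately show ?thesis by blast
  next
    case True
    let ?B = "?f ` {..CARD('n)}"
    have "card ?B = Suc CARD('n)" using card_image[OF True] by simp
    then have "vec.dependent ?B"
      using vec.independent_card_le_dim[of ?B UNIV] by (auto simp: vec.dim_UNIV card_cart_basis)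
    then obtain u where u: "(\<Sum>v\<in>?B. u v *s v) = 0" "\<exists>v\<in>?B. u v \<noteq> 0"
      unfolding vec.dependent_finite[OF finite_imageI[OF finite_atMost]] by blast
    define p where "p = (\<Sum>i\<le>CARD('n). monom (u (?f i)) i)"
    have cp: "coeff p i = (if i \<le> CARD('n) then u (?f i) else 0)" for i
      by (simp add: p_def coeff_sum)
    have "degree p \<le> CARD('n)" by (intro degree_le) (simp add: cp)
    then have d: "degree p < Suc CARD('n)" by simp
    have "krylov C p w = (\<Sum>i\<le>CARD('n). u (?f i) *s ?f i)"
      unfolding krylov_lessThan[OF d] lessThan_Suc_atMost by (intro sum.cong) (auto simp: cp)
    also have "\<dots> = 0" using u(1) by (subst (asm) sum.reindex[OF True]) simp
    finally have "krylov C p w = 0" .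
    moreover from u(2) obtain i where "i \<le> CARD('n)" "u (?f i) \<noteq> 0" by auto
    then have "coeff p i \<noteq> 0" by (simp add: cp)
    then have "p \<noteq> 0" by auto
    ultimately show ?thesis by blast
  qed
qed

lemma matrix_vector_mult_smult: "A *v (c *s x) = c *s (A *v x)" for A :: "'a::field^'n^'m"
  by (rule vec.linear_scale[OF matrix_vector_mul_linear_gen])

text \<open>Take a nonzero polynomial \<open>p\<close> of least degree with \<open>Z p(C) w = 0\<close> and strip one linear factor.\<close>

lemma eigenvector_modulo_kernel:
  fixes C Z :: "complex^'n^'n"
  assumes "Z *v w \<noteq> 0"
  obtains l g where "Z *v g \<noteq> 0" "Z *v (C *v g) = l *s (Z *v g)"
proof -
  define S where "S = {p. p \<noteq> 0 \<and> Z *v krylov C p w = 0}"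
  have "S \<noteq> {}" using krylov_annihilator[of C w] by (auto simp: S_def)
  then obtain p where p: "p \<in> S" and min: "\<And>q. q \<in> S \<Longrightarrow> degree p \<le> degree q"
    using ex_has_least_nat[of "\<lambda>p. p \<in> S" _ degree] by blast
  have "degree p \<noteq> 0"
  proof
    assume "degree p = 0"
    then have "krylov C p w = coeff p 0 *s w" "coeff p 0 \<noteq> 0"
      using p by (auto simp: krylov_def S_def elim: degree_eq_zeroE)
    then show False using p assms by (auto simp: S_def matrix_vector_mult_smult)
  qed
  then obtain l where "poly p l = 0"
    using fundamental_theorem_of_algebra[of p] by (auto simp: constant_degree)
  then obtain r where r: "p = [:- l, 1:] * r" using poly_eq_0_iff_dvd by (metis dvdE)
  then have r0: "r \<noteq> 0" using p by (auto simp: S_def)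
  then have "degree p = Suc (degree r)" unfolding r by (subst degree_mult_eq) auto
  then have "Z *v krylov C r w \<noteq> 0" using min[of r] r0 by (auto simp: S_def)
  moreover have "Z *v (C *v krylov C r w) = l *s (Z *v krylov C r w)"
    using p by (simp add: S_def r krylov_linear_factor matrix_vector_mult_diff_distrib matrix_vector_mult_smult
        del: mult_pCons_left)
  ultimately show thesis using that by blast
qed

text \<open>A matrix and its transpose are singular together, since their determinants agree; apply
  this to \<open>C - m I\<close>.\<close>

lemma eigenvector_of_transpose:
  fixes C :: "'a::field^'n^'n"
  assumes "w \<noteq> 0" "transpose C *v w = m *s w"
  obtains v where "v \<noteq> 0" "C *v v = m *s v"
proof -
  define M where "M = C - mat m"
  have mv: "(A - mat m) *v x = A *v x - m *s x" for A :: "'a^'n^'n" and x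
  proof -
    have "mat m *v x = m *s x"
      by (simp add: matrix_vector_mult_def vec_eq_iff mat_def if_distrib if_distribR cong: if_cong)
    then show ?thesis by (simp add: matrix_vector_mult_diff_rdistrib)
  qed
  have tM: "transpose M = transpose C - mat m"
    by (simp add: M_def transpose_diff)
  have "\<not> (\<exists>B. B ** transpose M = mat 1)"
    unfolding matrix_left_invertible_ker using assms by (auto simp: tM mv)
  then have "\<not> invertible (transpose M)" by (auto simp: invertible_def)
  then have "\<not> invertible M" by (simp add: invertible_det_nz det_transpose)
  then have "\<not> (\<exists>B. B ** M = mat 1)" by (simp add: invertible_left_inverse)
  then obtain v where "v \<noteq> 0" "M *v v = 0" unfolding matrix_left_invertible_ker by auto
  then show thesis using that by (simp add: M_def mv)
qed

text \<open>\<open>C\<close> preserves the form \<open>Z\<close>, hence acts isometrically modulo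
  the kernel of \<open>Z\<close>, where an eigenvalue \<open>l\<close> must have modulus one. The
  vectors \<open>a\<close> and \<open>b\<close> are the real and imaginary parts of an eigenvector
  of \<open>C\<close> itself, with eigenvalue \<open>1 / l = \<alpha> + i \<beta>\<close>.\<close>

lemma unimodular_eigenpair:
  fixes C Z :: "real^'n^'n"
  assumes Z: "Z \<in> sym_psd" "Z \<noteq> 0" and inv: "transpose C ** Z ** C = Z"
  obtains a b :: "real^'n" and \<alpha> \<beta> :: real
  where "a \<noteq> 0 \<or> b \<noteq> 0" "\<alpha>\<^sup>2 + \<beta>\<^sup>2 = 1"
    "C *v a = \<alpha> *\<^sub>R a - \<beta> *\<^sub>R b" "C *v b = \<beta> *\<^sub>R a + \<alpha> *\<^sub>R b"
proof -
  obtain x where x: "Z *v x \<noteq> 0" using Z(2) by (metis matrix_eq matrix_vector_mult_0)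
  define w :: "complex^'n" where "w = (\<chi> i. of_real (x $ i))"
  have "re_vec w = x" by (simp add: w_def re_vec_def vec_eq_iff)
  then have "cmat Z *v w \<noteq> 0" using x by (metis re_cmat re_im_zero(1))
  then obtain l g where g: "cmat Z *v g \<noteq> 0" "cmat Z *v (cmat C *v g) = l *s (cmat Z *v g)"
    by (rule eigenvector_modulo_kernel)
  define a b where "a = re_vec g" and "b = im_vec g"
  have Za: "Z *v (C *v a) = Z *v (Re l *\<^sub>R a - Im l *\<^sub>R b)"
    using arg_cong[OF g(2), of re_vec] 
    by (simp add: re_cmat re_scale im_cmat a_def b_def mv_simps)
  have Zb: "Z *v (C *v b) = Z *v (Im l *\<^sub>R a + Re l *\<^sub>R b)"
    using arg_cong[OF g(2), of im_vec] 
    by (simp add: im_cmat im_scale re_cmat a_def b_def mv_simps)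
  have sZ: "x \<bullet> (Z *v y) = y \<bullet> (Z *v x)" for x y using sym_inner[OF sym_psdD(1)[OF Z(1)]] .
  have q: "u \<bullet> (Z *v u) = v \<bullet> (Z *v v)" if "Z *v u = Z *v v" for u v
    using sZ[of u v] that by metis
  have inv': "(C *v y) \<bullet> (Z *v (C *v y)) = y \<bullet> (Z *v y)" for y
    using arg_cong[OF inv, of "\<lambda>M. y \<bullet> (M *v y)"] by (simp add: mv_simps del: transpose_matrix_vector)
  \<comment> \<open>The Hermitian form \<open>g^* Z g\<close>; invariance of \<open>Z\<close> turns
    into \<open>h = |l|^2 h\<close>.\<close>
  define h where "h = a \<bullet> (Z *v a) + b \<bullet> (Z *v b)"
  have "h = (C *v a) \<bullet> (Z *v (C *v a)) + (C *v b) \<bullet> (Z *v (C *v b))"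
    by (simp add: h_def inv')
  also have "\<dots> = ((Re l)\<^sup>2 + (Im l)\<^sup>2) * h"
    unfolding q[OF Za] q[OF Zb] h_def using sZ[of a b]
    by (simp add: mv_simps algebra_simps power2_eq_square)
  finally have hl: "h = ((Re l)\<^sup>2 + (Im l)\<^sup>2) * h" .
  have "h \<noteq> 0"
  proof
    assume "h = 0"
    then have "a \<bullet> (Z *v a) = 0" "b \<bullet> (Z *v b) = 0"
      using sym_psdD(2)[OF Z(1), of a] sym_psdD(2)[OF Z(1), of b] by (auto simp: h_def)
    then have "Z *v a = 0" "Z *v b = 0" using psd_kernel[OF Z(1)] by auto
    then show False using g(1) by (simp add: cvec_eq_iff re_cmat im_cmat a_def b_def)
  qed
  with hl have l1: "(Re l)\<^sup>2 + (Im l)\<^sup>2 = 1" by simp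
  then have l0: "l \<noteq> 0" by auto
  \<comment> \<open>While \<open>g\<close> is an eigenvector only modulo the kernel of
    \<open>Z\<close>, the vector \<open>Z g\<close> is a genuine eigenvector of the transpose, with
    eigenvalue \<open>1 / l\<close>. Passing back from the transpose then gives a genuine
    eigenvector of \<open>C\<close>.\<close>
  have "cmat (transpose C) *v (cmat Z *v (cmat C *v g)) = cmat Z *v g"
  proof -
    have "transpose C *v (Z *v (C *v y)) = Z *v y" for y
      using arg_cong[OF inv, of "\<lambda>M. M *v y"] by (simp add: mv_simps del: transpose_matrix_vector)
    then show ?thesis by (simp add: cvec_eq_iff re_cmat im_cmat del: transpose_matrix_vector)
  qed
  then have "l *s (transpose (cmat C) *v (cmat Z *v g)) = cmat Z *v g"
    by (simp only: g(2) matrix_vector_mult_smult transpose_cmat)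
  then have "transpose (cmat C) *v (cmat Z *v g) = (1 / l) *s (cmat Z *v g)"
    using l0 by (metis divide_self_if times_divide_eq_left mult_1 vector_smult_assoc vector_smult_lid)
  then obtain v where v: "v \<noteq> 0" "cmat C *v v = (1 / l) *s v"
    using eigenvector_of_transpose[OF g(1)] by blast
  have "(cmod (1 / l))\<^sup>2 = 1" using l1 by (simp add: norm_divide cmod_power2 power_divide)
  then have "(Re (1 / l))\<^sup>2 + (Im (1 / l))\<^sup>2 = 1" by (simp only: cmod_power2)
  moreover have "re_vec v \<noteq> 0 \<or> im_vec v \<noteq> 0" using v(1) by (simp add: cvec_eq_iff)
  moreover have "C *v re_vec v = Re (1 / l) *\<^sub>R re_vec v - Im (1 / l) *\<^sub>R im_vec v"
    "C *v im_vec v = Im (1 / l) *\<^sub>R re_vec v + Re (1 / l) *\<^sub>R im_vec v"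
    using arg_cong[OF v(2), of re_vec] arg_cong[OF v(2), of im_vec]
    by (simp_all only: re_cmat im_cmat re_scale im_scale)
  ultimately show thesis using that by blast
qed

section \<open>The linear-quadratic regulator\<close>

lemma matrix_inv_cancel_left:
  "N \<in> sym_pd \<Longrightarrow> N *v (matrix_inv N *v x) = x" for N :: "real^'n^'n"
  by (simp add: matrix_vector_mul_assoc pd_inverse)

text \<open>The left side is concave in \<open>d\<close> and attains its maximum, the right side, at
  \<open>d = N^{-1} e\<close>.\<close>

lemma completed_square_le:
  fixes N :: "real^'n^'n"
  assumes N: "N \<in> sym_pd"
  shows "2 * (d \<bullet> e) - d \<bullet> (N *v d) \<le> e \<bullet> (matrix_inv N *v e)"
proof -
  let ?f = "matrix_inv N *v e"
  have "0 \<le> (d - ?f) \<bullet> (N *v (d - ?f))" using sym_psdD(2)[OF sym_pd_psd[OF N]] .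
  moreover have "?f \<bullet> (N *v d) = d \<bullet> (N *v ?f)"
    using sym_inner[OF sym_psdD(1)[OF sym_pd_psd[OF N]]] .
  ultimately show ?thesis
    by (simp add: mv_simps matrix_inv_cancel_left[OF N] inner_commute[of ?f e])
qed

section \<open>One-step Bellman identities for an arbitrary gain\<close>

locale lqr =
  fixes \<gamma> :: real and A Q :: "real^'n^'n" and B :: "real^'k^'n" and R :: "real^'k^'k"
  assumes gamma: "0 < \<gamma>" "\<gamma> < 1" and Q: "Q \<in> sym_psd" and R: "R \<in> sym_pd"
begin

definition cl :: "real^'n^'k \<Rightarrow> real^'n^'n" where "cl K = A - B ** K"

definition run_cost :: "real^'n^'k \<Rightarrow> real^'n^'n" where
  "run_cost K = Q + transpose K ** R ** K"

text \<open>The quadratic coefficient in the action \<open>u\<close> of the one-step cost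
  \<open>u^T R u + \<gamma> (A x + B u)^T P (A x + B u)\<close>.\<close>

definition curv :: "real^'n^'n \<Rightarrow> real^'k^'k" where
  "curv P = R + \<gamma> *\<^sub>R (transpose B ** P ** B)"

text \<open>This is \<open>E_mat\<close> with the Lyapunov solution as an explicit argument, which
  keeps the definite description in \<open>P_mat\<close> out of the algebra until uniqueness is
  known.\<close>

definition grad :: "real^'n^'k \<Rightarrow> real^'n^'n \<Rightarrow> real^'n^'k" where
  "grad K P = - (\<gamma> *\<^sub>R (transpose B ** P ** cl K)) + R ** K"

definition gap :: "real^'n^'k \<Rightarrow> real^'n^'n \<Rightarrow> real^'n^'n" where
  "gap K P = transpose (grad K P) ** matrix_inv (curv P) ** grad K P"

definition improve :: "real^'n^'k \<Rightarrow> real^'n^'n \<Rightarrow> real^'n^'k" where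
  "improve K P = K - matrix_inv (curv P) ** grad K P"

abbreviation lyap :: "real^'n^'k \<Rightarrow> real^'n^'n \<Rightarrow> bool" where
  "lyap \<equiv> lyapunov_solution \<gamma> A B Q R"

lemma lyap_iff: "lyap K P \<longleftrightarrow> P \<in> sym_psd \<and> P = run_cost K + \<gamma> *\<^sub>R congr (cl K) P"
  by (simp add: lyapunov_solution_def run_cost_def cl_def congr_def)

lemma lyap_psd: "lyap K P \<Longrightarrow> P \<in> sym_psd" by (simp add: lyap_iff)

lemma run_cost_psd: "run_cost K \<in> sym_psd"
  unfolding run_cost_def by (intro psd_add Q psd_congruence sym_pd_psd R)

lemma run_cost_quadratic: "x \<bullet> (run_cost K *v x) = x \<bullet> (Q *v x) + (K *v x) \<bullet> (R *v (K *v x))"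
  by (simp add: run_cost_def mv_simps del: transpose_matrix_vector)

lemma curv_pd: "P \<in> sym_psd \<Longrightarrow> curv P \<in> sym_pd"
  unfolding curv_def using gamma by (auto intro!: pd_add_psd[OF R psd_scaleR[OF psd_congruence]])

lemma curv_quadratic: "d \<bullet> (curv P *v d) = d \<bullet> (R *v d) + \<gamma> * ((B *v d) \<bullet> (P *v (B *v d)))"
  by (simp add: curv_def mv_simps del: transpose_matrix_vector)

lemma gap_quadratic: "x \<bullet> (gap K P *v x) = (grad K P *v x) \<bullet> (matrix_inv (curv P) *v (grad K P *v x))"
  by (simp add: gap_def mv_simps del: transpose_matrix_vector)

lemma gap_psd: "P \<in> sym_psd \<Longrightarrow> gap K P \<in> sym_psd"
  unfolding gap_def by (rule psd_congruence[OF sym_pd_psd[OF pd_inverse(3)[OF curv_pd]]])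

text \<open>Taking one step with \<open>K'\<close> and paying \<open>P\<close> afterwards perturbs
  the action \<open>- K x\<close> by \<open>d\<close>. The cost is quadratic in \<open>d\<close>:
  its value at \<open>d = 0\<close> is the Lyapunov equation of \<open>K\<close>, its linear
  coefficient comes from \<open>grad\<close> and its quadratic one from \<open>curv\<close>.\<close>

lemma bellman_step:
  fixes K K' :: "real^'n^'k" and x :: "real^'n"
  assumes "lyap K P"
  defines "d \<equiv> (K - K') *v x"
  shows "x \<bullet> ((run_cost K' + \<gamma> *\<^sub>R congr (cl K') P) *v x)
    = x \<bullet> (P *v x) - 2 * (d \<bullet> (grad K P *v x)) + d \<bullet> (curv P *v d)"
proof -
  let ?y = "cl K *v x"
  have K': "K' *v x = K *v x - d" by (simp add: d_def mv_simps)
  have y': "cl K' *v x = ?y + B *v d" by (simp add: d_def cl_def mv_simps)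
  have sR: "(K *v x) \<bullet> (R *v d) = d \<bullet> (R *v (K *v x))"
    using sym_inner[OF sym_psdD(1)[OF sym_pd_psd[OF R]]] .
  have sP: "?y \<bullet> (P *v (B *v d)) = (B *v d) \<bullet> (P *v ?y)"
    using sym_inner[OF sym_psdD(1)[OF lyap_psd[OF assms(1)]]] .
  have g: "d \<bullet> (grad K P *v x) = d \<bullet> (R *v (K *v x)) - \<gamma> * ((B *v d) \<bullet> (P *v ?y))"
  proof -
    have "grad K P = R ** K - \<gamma> *\<^sub>R (transpose B ** P ** cl K)" by (simp add: grad_def)
    then show ?thesis by (simp add: mv_simps del: transpose_matrix_vector)
  qed
  have "x \<bullet> (P *v x) = x \<bullet> ((run_cost K + \<gamma> *\<^sub>R congr (cl K) P) *v x)"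
    using assms(1) by (simp add: lyap_iff)
  then have P: "x \<bullet> (P *v x) = x \<bullet> (Q *v x) + (K *v x) \<bullet> (R *v (K *v x)) + \<gamma> * (?y \<bullet> (P *v ?y))"
    by (simp add: matrix_vector_mult_add_rdistrib scaleR_matrix_vector_assoc[symmetric]
        inner_add_right run_cost_quadratic congr_quadratic)
  have "x \<bullet> ((run_cost K' + \<gamma> *\<^sub>R congr (cl K') P) *v x)
      = x \<bullet> (Q *v x) + (K *v x - d) \<bullet> (R *v (K *v x - d)) + \<gamma> * ((?y + B *v d) \<bullet> (P *v (?y + B *v d)))"
    by (simp add: matrix_vector_mult_add_rdistrib scaleR_matrix_vector_assoc[symmetric]
        inner_add_right run_cost_quadratic congr_quadratic K' y')
  then show ?thesis
    by (simp add: P g curv_quadratic mv_simps sR sP algebra_simps)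
qed

text \<open>The improved gain minimizes the quadratic of \<open>bellman_step\<close> at every state
  at once, and the minimum is lower by the gap. Hence \<open>P\<close> is a supersolution for the
  improved gain, with \<open>gap K P\<close> as slack.\<close>

lemma bellman_improve:
  assumes "lyap K P"
  shows "run_cost (improve K P) + \<gamma> *\<^sub>R congr (cl (improve K P)) P = P - gap K P"
proof (rule symmetric_eq_iff_quadratic)
  note P = lyap_psd[OF assms]
  show "transpose (run_cost (improve K P) + \<gamma> *\<^sub>R congr (cl (improve K P)) P)
      = run_cost (improve K P) + \<gamma> *\<^sub>R congr (cl (improve K P)) P"
    using P gamma by (intro sym_psdD(1) psd_add run_cost_psd psd_scaleR congr_psd) auto
  show "transpose (P - gap K P) = P - gap K P"
    by (simp add: transpose_diff sym_psdD(1)[OF P] sym_psdD(1)[OF gap_psd[OF P]])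
  fix x
  have "(K - improve K P) *v x = matrix_inv (curv P) *v (grad K P *v x)"
    by (simp add: improve_def matrix_vector_mul_assoc)
  then show "x \<bullet> ((run_cost (improve K P) + \<gamma> *\<^sub>R congr (cl (improve K P)) P) *v x)
      = x \<bullet> ((P - gap K P) *v x)"
    unfolding bellman_step[OF assms]
    by (simp add: matrix_inv_cancel_left[OF curv_pd[OF P]] mv_simps gap_quadratic inner_commute)
qed

end

section \<open>Comparison with the optimal gain, and uniqueness\<close>

locale lqr_opt = lqr \<gamma> A Q B R
  for \<gamma> :: real and A Q :: "real^'n^'n" and B :: "real^'k^'n" and R :: "real^'k^'k" +
  fixes Kstar :: "real^'n^'k" and P :: "real^'n^'n" and \<rho> :: real
  assumes lyap_star: "lyap Kstar P"
    and Kstar: "Kstar = \<gamma> *\<^sub>R (gain_inv \<gamma> B R P ** transpose B ** P ** A)"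
    and rho: "0 < \<rho>" "\<rho> < 1 / sqrt \<gamma>" "spectral_norm (A - B ** Kstar) \<le> \<rho>"
begin

text \<open>The formula for \<open>Kstar\<close> is the normal equation
  \<open>curv P ** Kstar = \<gamma> B^T P A\<close>, which is stationarity of the one-step
  cost.\<close>

lemma grad_star: "grad Kstar P = 0"
proof -
  note c = curv_pd[OF lyap_psd[OF lyap_star]]
  have "curv P ** Kstar = \<gamma> *\<^sub>R ((curv P ** matrix_inv (curv P)) ** (transpose B ** P ** A))"
    unfolding Kstar gain_inv_def curv_def[symmetric]
    by (simp add: matrix_scalar_ac matrix_mul_assoc scalar_matrix_assoc)
  then have "curv P ** Kstar = \<gamma> *\<^sub>R (transpose B ** P ** A)"
    by (simp add: pd_inverse(1)[OF c])
  moreover have "curv P ** Kstar = R ** Kstar + \<gamma> *\<^sub>R (transpose B ** P ** (B ** Kstar))"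
    by (simp add: curv_def matrix_matrix_mult_add_rdistrib scalar_matrix_assoc[symmetric] matrix_mul_assoc)
  moreover have "transpose B ** P ** A = transpose B ** P ** cl Kstar + transpose B ** P ** (B ** Kstar)"
    by (simp only: matrix_add_ldistrib[symmetric]) (simp add: cl_def)
  ultimately show ?thesis by (simp add: grad_def scaleR_add_right)
qed

lemma bellman_star:
  "x \<bullet> ((run_cost K + \<gamma> *\<^sub>R congr (cl K) P) *v x)
    = x \<bullet> (P *v x) + ((Kstar - K) *v x) \<bullet> (curv P *v ((Kstar - K) *v x))"
  by (simp add: bellman_step[OF lyap_star] grad_star)

lemma rho_sq: "\<gamma> * \<rho>\<^sup>2 < 1"
proof -
  have "sqrt \<gamma> * \<rho> < 1" using rho gamma by (simp add: field_simps)
  then have "(sqrt \<gamma> * \<rho>)\<^sup>2 < 1" using rho gamma by (simp add: power_less_one_iff)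
  then show ?thesis using gamma by (simp add: power_mult_distrib)
qed

lemma norm_cl_star: "norm (cl Kstar *v x) \<le> \<rho> * norm x"
proof -
  have "norm (cl Kstar *v x) \<le> onorm ((*v) (cl Kstar)) * norm x"
    by (rule onorm) (rule matrix_vector_mul_bounded_linear)
  also have "\<dots> \<le> \<rho> * norm x" using rho by (intro mult_right_mono) (auto simp: spectral_norm_def cl_def)
  finally show ?thesis .
qed

text \<open>A nonzero difference of two solutions is preserved by the closed loop, hence lives on
  unimodular modes of \<open>\<surd>\<gamma> (A - B K)\<close>. Along such a mode the running cost vanishes, so by the
  completed square \<open>K\<close> agrees with \<open>Kstar\<close> there, contradicting the stability of \<open>Kstar\<close>.\<close>

lemma invariant_form_zero:
  assumes Pk: "lyap K Pk" and Z: "Z \<in> sym_psd" and inv: "Z = \<gamma> *\<^sub>R congr (cl K) Z"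
  shows "Z = 0"
proof (rule ccontr)
  assume "Z \<noteq> 0"
  define s where "s = sqrt \<gamma>"
  have s: "s > 0" "s * s = \<gamma>" using gamma by (simp_all add: s_def)
  define C where "C = s *\<^sub>R cl K"
  have "transpose C ** Z ** C = Z"
    by (subst (2) inv) (simp add: C_def congr_def transpose_scalar matrix_scalar_ac
        scalar_matrix_assoc[symmetric] s(2))
  then obtain a b :: "real^'n" and \<alpha> \<beta> where ab: "a \<noteq> 0 \<or> b \<noteq> 0" "\<alpha>\<^sup>2 + \<beta>\<^sup>2 = 1"
    "C *v a = \<alpha> *\<^sub>R a - \<beta> *\<^sub>R b" "C *v b = \<beta> *\<^sub>R a + \<alpha> *\<^sub>R b"
    using unimodular_eigenpair[OF Z \<open>Z \<noteq> 0\<close>] by blast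
  \<comment> \<open>For \<open>v = a + i b\<close> the sum is the Hermitian form
    \<open>v^* H v\<close>, and \<open>C\<close> multiplies \<open>v\<close> by a number of modulus
    one. In the Lyapunov and Bellman identities summed over \<open>a\<close> and \<open>b\<close>,
    the terms in \<open>Pk\<close> and \<open>P\<close> therefore cancel.\<close>
  have rot: "(C *v a) \<bullet> (H *v (C *v a)) + (C *v b) \<bullet> (H *v (C *v b)) = a \<bullet> (H *v a) + b \<bullet> (H *v b)"
    if "H \<in> sym_psd" for H
  proof -
    have "b \<bullet> (H *v a) = a \<bullet> (H *v b)" using sym_inner[OF sym_psdD(1)[OF that]] .
    then have "(C *v a) \<bullet> (H *v (C *v a)) + (C *v b) \<bullet> (H *v (C *v b))
        = (\<alpha>\<^sup>2 + \<beta>\<^sup>2) * (a \<bullet> (H *v a) + b \<bullet> (H *v b))"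
      by (simp add: ab(3,4) mv_simps algebra_simps power2_eq_square)
    then show ?thesis by (simp add: ab(2))
  qed
  have sc: "x \<bullet> ((H + \<gamma> *\<^sub>R congr (cl K) G) *v x) = x \<bullet> (H *v x) + (C *v x) \<bullet> (G *v (C *v x))" for H G x
    by (simp add: matrix_vector_mult_add_rdistrib scaleR_matrix_vector_assoc[symmetric]
        inner_add_right congr_quadratic C_def mv_simps s(2)[symmetric])
  have "x \<bullet> (Pk *v x) = x \<bullet> (run_cost K *v x) + (C *v x) \<bullet> (Pk *v (C *v x))" for x
    using Pk sc[of x "run_cost K" Pk] by (simp add: lyap_iff)
  from this[of a] this[of b] rot[OF lyap_psd[OF Pk]]
  have z: "a \<bullet> (run_cost K *v a) + b \<bullet> (run_cost K *v b) = 0" by simp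
  define e where "e = (\<lambda>x. (Kstar - K) *v x)"
  have "x \<bullet> (run_cost K *v x) + (C *v x) \<bullet> (P *v (C *v x)) = x \<bullet> (P *v x) + e x \<bullet> (curv P *v e x)" for x
    using bellman_star[of x K] sc[of x "run_cost K" P] by (simp add: e_def)
  from this[of a] this[of b] rot[OF lyap_psd[OF lyap_star]] z
  have "e a \<bullet> (curv P *v e a) + e b \<bullet> (curv P *v e b) = 0" by simp
  moreover have "0 \<le> e x \<bullet> (curv P *v e x)" "e x \<noteq> 0 \<Longrightarrow> 0 < e x \<bullet> (curv P *v e x)" for x
    using curv_pd[OF lyap_psd[OF lyap_star]] sym_psdD(2)[OF sym_pd_psd] by (auto simp: sym_pd_def)
  ultimately have "e a = 0" "e b = 0" by (metis add_nonneg_eq_0_iff less_irrefl)+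
  then have "cl K *v a = cl Kstar *v a" "cl K *v b = cl Kstar *v b"
    by (simp_all add: e_def cl_def mv_simps)
  then have "norm (C *v x) \<le> s * (\<rho> * norm x)" if "x = a \<or> x = b" for x
    using that norm_cl_star[of x] s by (auto simp: C_def mv_simps)
  then have "(norm (C *v x))\<^sup>2 \<le> \<gamma> * \<rho>\<^sup>2 * (norm x)\<^sup>2" if "x = a \<or> x = b" for x
    using power_mono[of "norm (C *v x)" "s * (\<rho> * norm x)" 2] that
    by (simp add: power_mult_distrib s(2)[symmetric] power2_eq_square mult.assoc mult.left_commute)
  from this[of a] this[of b] rot[OF sym_pd_psd[OF mat_1_pd]]
  have "(norm a)\<^sup>2 + (norm b)\<^sup>2 \<le> \<gamma> * \<rho>\<^sup>2 * ((norm a)\<^sup>2 + (norm b)\<^sup>2)"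
    by (simp add: power2_norm_eq_inner distrib_left)
  moreover have "(norm a)\<^sup>2 + (norm b)\<^sup>2 > 0" using ab(1) by (simp add: sum_power2_gt_zero_iff)
  ultimately show False using rho_sq by (simp add: mult_less_cancel_right1)
qed

lemma supersolution_lyap:
  assumes "P' \<in> sym_psd" "P' - (run_cost K + \<gamma> *\<^sub>R congr (cl K) P') \<in> sym_psd"
  obtains Pk where "lyap K Pk" "disc_series \<gamma> (cl K) (run_cost K) sums Pk" "P' - Pk \<in> sym_psd"
proof -
  obtain Pk where Pk: "disc_series \<gamma> (cl K) (run_cost K) sums Pk" "Pk \<in> sym_psd" "P' - Pk \<in> sym_psd"
    using supersolution_disc_series[OF run_cost_psd _ assms] gamma by auto
  then have "lyap K Pk" using disc_series_lyapunov[OF Pk(1)] by (simp add: lyap_iff)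
  then show thesis using that Pk by blast
qed

text \<open>As a supersolution of its own equation, \<open>Pk\<close> dominates the sum of the
  series. The difference is psd and invariant under the discounted closed loop, hence zero. All
  solutions are thus the sum of one series.\<close>

lemma lyap_disc_series:
  assumes "lyap K Pk" shows "disc_series \<gamma> (cl K) (run_cost K) sums Pk"
proof -
  have 0: "(0 :: real^'n^'n) \<in> sym_psd" by (simp add: sym_psd_def transpose_def vec_eq_iff)
  have "Pk - (run_cost K + \<gamma> *\<^sub>R congr (cl K) Pk) = 0" using assms by (simp add: lyap_iff)
  then obtain P0 where P0: "lyap K P0" "disc_series \<gamma> (cl K) (run_cost K) sums P0" "Pk - P0 \<in> sym_psd"
    using supersolution_lyap[OF lyap_psd[OF assms], of K] 0 by metis
  have "Pk - P0 = \<gamma> *\<^sub>R congr (cl K) Pk - \<gamma> *\<^sub>R congr (cl K) P0"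
    using assms P0(1) unfolding lyap_iff by (metis add_diff_cancel_left)
  also have "\<dots> = \<gamma> *\<^sub>R congr (cl K) (Pk - P0)"
    by (simp add: linear_diff[OF linear_congr] scaleR_diff_right)
  finally have "Pk - P0 = 0" using invariant_form_zero[OF assms P0(3)] by blast
  then show ?thesis using P0(2) by simp
qed

lemma lyap_unique: "lyap K P1 \<Longrightarrow> lyap K P2 \<Longrightarrow> P1 = P2"
  using lyap_disc_series sums_unique2 by blast

text \<open>From here on the definite description can be replaced by any solution in hand.\<close>

lemma P_mat_eq: "lyap K Pk \<Longrightarrow> P_mat \<gamma> A B Q R K = Pk"
  unfolding P_mat_def using lyap_unique by blast

text \<open>Since \<open>Pk\<close> is a supersolution for the improved gain, a solution
  \<open>P'\<close> exists below it. Feeding \<open>Pk - P'\<close> psd back into the two equations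
  sharpens the comparison by the whole gap.\<close>

lemma lyap_improve:
  assumes "lyap K Pk"
  obtains P' where "lyap (improve K Pk) P'" "Pk - gap K Pk - P' \<in> sym_psd"
proof -
  let ?K = "improve K Pk"
  note P = lyap_psd[OF assms]
  have "Pk - (run_cost ?K + \<gamma> *\<^sub>R congr (cl ?K) Pk) \<in> sym_psd"
    using gap_psd[OF P] by (simp add: bellman_improve[OF assms])
  then obtain P' where P': "lyap ?K P'" "Pk - P' \<in> sym_psd"
    using supersolution_lyap[OF P] by blast
  have "Pk - gap K Pk - P' = \<gamma> *\<^sub>R congr (cl ?K) (Pk - P')"
  proof -
    have "P' = run_cost ?K + \<gamma> *\<^sub>R congr (cl ?K) P'" using P' by (simp add: lyap_iff)
    then have "Pk - gap K Pk - P' = (run_cost ?K + \<gamma> *\<^sub>R congr (cl ?K) Pk) - (run_cost ?K + \<gamma> *\<^sub>R congr (cl ?K) P')"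
      by (simp only: bellman_improve[OF assms])
    also have "\<dots> = \<gamma> *\<^sub>R congr (cl ?K) (Pk - P')"
      by (simp add: linear_diff[OF linear_congr] scaleR_diff_right)
    finally show ?thesis .
  qed
  moreover have "\<gamma> *\<^sub>R congr (cl ?K) (Pk - P') \<in> sym_psd"
    using gamma by (intro psd_scaleR congr_psd P'(2)) auto
  ultimately show thesis using that P'(1) by simp
qed

text \<open>One step with \<open>Kstar\<close> followed by \<open>Pk\<close> costs at least
  \<open>Pk - gap K Pk\<close>, by the completed square; subtract the Lyapunov equation of
  \<open>Kstar\<close>. The inequality concerns a single step of the optimal loop, so that it can be
  tested against the solution of the dual equation.\<close>

lemma lyap_diff_star:
  assumes "lyap K Pk"
  shows "gap K Pk + \<gamma> *\<^sub>R congr (cl Kstar) (Pk - P) - (Pk - P) \<in> sym_psd"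
proof -
  note Pk = lyap_psd[OF assms] and Ps = lyap_psd[OF lyap_star]
  let ?C = "cl Kstar"
  have "x \<bullet> ((Pk - P) *v x) \<le> x \<bullet> ((gap K Pk + \<gamma> *\<^sub>R congr ?C (Pk - P)) *v x)" for x
  proof -
    let ?d = "(K - Kstar) *v x" and ?e = "grad K Pk *v x"
    have "2 * (?d \<bullet> ?e) - ?d \<bullet> (curv Pk *v ?d) \<le> x \<bullet> (gap K Pk *v x)"
      unfolding gap_quadratic by (rule completed_square_le[OF curv_pd[OF Pk]])
    moreover have "x \<bullet> (run_cost Kstar *v x) + \<gamma> * (x \<bullet> (congr ?C Pk *v x))
        = x \<bullet> (Pk *v x) - 2 * (?d \<bullet> ?e) + ?d \<bullet> (curv Pk *v ?d)"
      using bellman_step[OF assms, of x Kstar] by (simp add: mv_simps)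
    moreover have "x \<bullet> (P *v x) = x \<bullet> (run_cost Kstar *v x) + \<gamma> * (x \<bullet> (congr ?C P *v x))"
      using arg_cong[OF conjunct2[OF lyap_star[unfolded lyap_iff]], of "\<lambda>M. x \<bullet> (M *v x)"]
      by (simp add: mv_simps)
    ultimately show ?thesis
      by (simp add: mv_simps linear_diff[OF linear_congr] algebra_simps)
  qed
  moreover have "transpose (gap K Pk + \<gamma> *\<^sub>R congr ?C (Pk - P) - (Pk - P)) = gap K Pk + \<gamma> *\<^sub>R congr ?C (Pk - P) - (Pk - P)"
    using Pk Ps gap_psd[OF Pk, of K]
    by (simp add: transpose_diff transpose_add transpose_scalar transpose_congr sym_psdD(1))
  ultimately show ?thesis by (simp add: sym_psd_def mv_simps)
qed

end

section \<open>Multivariate Gaussian measures\<close>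

lemma bounded_linear_axis: "bounded_linear (axis i :: 'a::euclidean_space \<Rightarrow> 'a^'n)"
  unfolding linear_conv_bounded_linear[symmetric]
  by (rule linearI) (auto simp: axis_def vec_eq_iff)

lemma sum_axis: "(\<Sum>i\<in>UNIV. axis i (v $ i)) = (v :: 'a::comm_monoid_add^'n)"
  by (simp add: vec_eq_iff axis_def if_distrib cong: if_cong)

lemma integrable_vecI:
  fixes f :: "'a \<Rightarrow> 'b::euclidean_space^'n"
  assumes "\<And>i. integrable M (\<lambda>x. f x $ i)" shows "integrable M f"
proof -
  have "integrable M (\<lambda>x. \<Sum>i\<in>UNIV. axis i (f x $ i))"
    by (intro Bochner_Integration.integrable_sum integrable_bounded_linear[OF bounded_linear_axis] assms)
  then show ?thesis by (simp add: sum_axis)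
qed

lemma integral_vec_nth:
  fixes f :: "'a \<Rightarrow> 'b::euclidean_space^'n"
  shows "integrable M f \<Longrightarrow> (\<integral>x. f x \<partial>M) $ i = (\<integral>x. f x $ i \<partial>M)"
  by (rule integral_bounded_linear[OF bounded_linear_vec_nth, symmetric])

section \<open>Product integrals and linear images of Lebesgue measure\<close>

lemma lborel_integral_prod_Basis:
  fixes g :: "'a::euclidean_space \<Rightarrow> real \<Rightarrow> real"
  assumes g: "\<And>b. b \<in> Basis \<Longrightarrow> integrable lborel (g b)"
  shows "integrable lborel (\<lambda>x::'a. \<Prod>b\<in>Basis. g b (x \<bullet> b))"
    and "(\<integral>x. (\<Prod>b\<in>Basis. g b (x \<bullet> b)) \<partial>(lborel :: 'a measure)) = (\<Prod>b\<in>Basis. \<integral>t. g b t \<partial>lborel)"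
proof -
  interpret product_sigma_finite "\<lambda>_::'a. lborel :: real measure" by standard
  have eq: "(\<Prod>b\<in>Basis. g b ((\<Sum>c\<in>Basis. f c *\<^sub>R c) \<bullet> b)) = (\<Prod>b\<in>Basis. g b (f b))" for f :: "'a \<Rightarrow> real"
    by (intro prod.cong refl) (simp add: inner_sum_left inner_Basis if_distrib cong: if_cong)
  have [measurable]: "b \<in> Basis \<Longrightarrow> g b \<in> borel_measurable borel" for b using g by auto
  have mf: "(\<lambda>f. \<Sum>b\<in>Basis. f b *\<^sub>R b) \<in> measurable (\<Pi>\<^sub>M b\<in>Basis. lborel) (borel :: 'a measure)"
    by measurable
  have mg: "(\<lambda>x::'a. \<Prod>b\<in>Basis. g b (x \<bullet> b)) \<in> borel_measurable borel" by measurable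
  show "integrable lborel (\<lambda>x::'a. \<Prod>b\<in>Basis. g b (x \<bullet> b))"
    by (subst lborel_eq) (simp add: integrable_distr_eq[OF mf mg] eq product_integrable_prod g)
  show "(\<integral>x. (\<Prod>b\<in>Basis. g b (x \<bullet> b)) \<partial>(lborel :: 'a measure)) = (\<Prod>b\<in>Basis. \<integral>t. g b t \<partial>lborel)"
    by (subst lborel_eq) (simp add: integral_distr[OF mf mg] eq product_integral_prod g)
qed

lemma prod_Basis_vec: "(\<Prod>b\<in>(Basis::(real^'n) set). h b) = (\<Prod>i\<in>UNIV. h (axis i 1))"
proof -
  have "(Basis::(real^'n) set) = range (\<lambda>i. axis i 1)" by (auto simp: Basis_vec_def)
  then have "prod h (Basis::(real^'n) set) = prod h (range (\<lambda>i::'n. axis i 1))" by simp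
  also have "\<dots> = (\<Prod>i\<in>UNIV. h (axis i 1))"
    by (subst prod.reindex) (auto simp: inj_on_def axis_eq_axis)
  finally show ?thesis .
qed

lemma lborel_integral_prod_vec:
  fixes g :: "'n::finite \<Rightarrow> real \<Rightarrow> real"
  assumes g: "\<And>i. integrable lborel (g i)"
  shows "integrable lborel (\<lambda>x::real^'n. \<Prod>i\<in>UNIV. g i (x $ i))"
    and "(\<integral>x. (\<Prod>i\<in>UNIV. g i (x $ i)) \<partial>(lborel :: (real^'n) measure)) = (\<Prod>i\<in>UNIV. \<integral>t. g i t \<partial>lborel)"
proof -
  \<comment> \<open>Moves the family of factors from indices to basis vectors; distinct indices have
    distinct axes, so the description is unique.\<close>
  define h where "h = (\<lambda>b::real^'n. g (THE i. b = axis i 1))"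
  have h: "h (axis i 1) = g i" for i by (simp add: h_def axis_eq_axis)
  have i: "b \<in> Basis \<Longrightarrow> integrable lborel (h b)" for b using g h by (auto simp: Basis_vec_def)
  show "integrable lborel (\<lambda>x::real^'n. \<Prod>i\<in>UNIV. g i (x $ i))"
    and "(\<integral>x. (\<Prod>i\<in>UNIV. g i (x $ i)) \<partial>(lborel :: (real^'n) measure)) = (\<Prod>i\<in>UNIV. \<integral>t. g i t \<partial>lborel)"
    using lborel_integral_prod_Basis[of h, OF i] by (simp_all add: prod_Basis_vec h cart_eq_inner_axis)
qed

text \<open>The library's change of variables for linear maps on \<^typ>\<open>real^'n\<close> needs a well-ordered index
  type. A finite type is well-ordered through an injection into \<^typ>\<open>nat\<close>, on a copy of the type so
  as not to clash with existing instances.\<close>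

typedef 'a ranked = "UNIV :: 'a set" morphisms unrank mk_ranked by simp

definition rkey :: "'a::finite ranked \<Rightarrow> nat" where
  "rkey x = (SOME h. inj h) (unrank x)"

lemma inj_rkey: "inj (rkey :: 'a::finite ranked \<Rightarrow> nat)"
proof -
  have "\<exists>h :: 'a \<Rightarrow> nat. inj h" using finite_imp_inj_to_nat_seg[of "UNIV :: 'a set"] by auto
  then have h: "inj (SOME h :: 'a \<Rightarrow> nat. inj h)" by (rule someI_ex)
  show ?thesis
  proof (rule injI)
    fix x y :: "'a ranked"
    assume "rkey x = rkey y"
    then have "unrank x = unrank y" unfolding rkey_def by (rule injD[OF h])
    then show "x = y" by (simp add: unrank_inject)
  qed
qed

instantiation ranked :: (finite) "{finite, wellorder}"
begin
definition "x \<le> y \<longleftrightarrow> rkey x \<le> rkey y"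
definition "x < y \<longleftrightarrow> rkey x < rkey y"
instance
proof
  show "finite (UNIV :: 'a ranked set)"
    unfolding type_definition.Abs_image[OF type_definition_ranked, symmetric] by (rule finite_imageI) simp
  fix P :: "'a ranked \<Rightarrow> bool" and a
  assume *: "\<And>x. (\<And>y. y < x \<Longrightarrow> P y) \<Longrightarrow> P x"
  show "P a"
  proof (induction a rule: measure_induct_rule[of rkey])
    case (less x)
    show ?case by (rule *) (rule less, simp add: less_ranked_def)
  qed
next
  fix x y :: "'a ranked"
  assume "x \<le> y" "y \<le> x"
  then have "rkey x = rkey y" by (simp add: less_eq_ranked_def)
  then show "x = y" by (rule injD[OF inj_rkey])
next
  show "x < y \<longleftrightarrow> x \<le> y \<and> \<not> y \<le> x" for x y :: "'a ranked"
    unfolding less_eq_ranked_def less_ranked_def by linarith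
  show "x \<le> x" for x :: "'a ranked"
    unfolding less_eq_ranked_def by (rule le_refl)
  show "x \<le> y \<Longrightarrow> y \<le> z \<Longrightarrow> x \<le> z" for x y z :: "'a ranked"
    unfolding less_eq_ranked_def by (rule le_trans)
  show "x \<le> y \<or> y \<le> x" for x y :: "'a ranked"
    unfolding less_eq_ranked_def by (rule nat_le_linear)
qed
end

lemma bij_unrank: "bij unrank"
  by (intro bijI injI type_definition.Rep_range[OF type_definition_ranked]) (rule iffD1[OF unrank_inject])

text \<open>Conjugation by \<open>f\<close> is a sign-preserving bijection between the permutations
  of the two index types, so the Leibniz sums agree term by term.\<close>

lemma det_reindex:
  fixes A :: "'a::comm_ring_1^'n^'n" and f :: "'m::finite \<Rightarrow> 'n"
  assumes f: "bij f" shows "det (\<chi> i j. A $ f i $ f j) = det A"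
proof -
  have i: "inj f" "bij (inv f)" "inj (inv f)" using f by (auto simp: bij_def inj_imp_surj_inv surj_imp_inj_inv)
  have fi: "f \<circ> inv f = id" "inv f \<circ> f = id" using f by (auto simp: bij_def surj_iff inv_o_cancel)
  have "(\<Sum>q | q permutes UNIV. of_int (sign q) * (\<Prod>i\<in>UNIV. A $ f i $ f (q i)))
      = (\<Sum>p | p permutes UNIV. of_int (sign p) * (\<Prod>k\<in>UNIV. A $ k $ p k))"
  proof (rule sum.reindex_bij_witness[where j = "map_permutation UNIV f" and i = "map_permutation UNIV (inv f)"])
    fix q :: "'m \<Rightarrow> 'm" assume "q \<in> {q. q permutes UNIV}"
    then have q: "q permutes UNIV" by simp
    show "map_permutation UNIV (inv f) (map_permutation UNIV f q) = q"
      using q f i by (intro map_permutation_compose_inv[of f UNIV UNIV]) auto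
    show "map_permutation UNIV f q \<in> {p. p permutes UNIV}"
      using map_permutation_permutes[of f UNIV UNIV q] f q by simp
    have "(\<Prod>k\<in>UNIV. A $ k $ map_permutation UNIV f q k) = (\<Prod>i\<in>UNIV. A $ f i $ map_permutation UNIV f q (f i))"
      using f by (intro prod.reindex_bij_betw[symmetric])
    then show "of_int (sign (map_permutation UNIV f q)) * (\<Prod>k\<in>UNIV. A $ k $ map_permutation UNIV f q k)
        = of_int (sign q) * (\<Prod>i\<in>UNIV. A $ f i $ f (q i))"
      using i q by (simp add: sign_map_permutation map_permutation_apply)
  next
    fix p :: "'n \<Rightarrow> 'n" assume "p \<in> {p. p permutes UNIV}"
    then have p: "p permutes UNIV" by simp
    show "map_permutation UNIV f (map_permutation UNIV (inv f) p) = p"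
      using p f i by (intro map_permutation_compose_inv[of "inv f" UNIV UNIV]) (auto simp: bij_def surj_f_inv_f)
    show "map_permutation UNIV (inv f) p \<in> {p. p permutes UNIV}"
      using map_permutation_permutes[of "inv f" UNIV UNIV p] i p by simp
  qed
  then show ?thesis by (simp add: det_def)
qed

lemma vec_borel_measurable:
  fixes F :: "real^'n \<Rightarrow> real^'m"
  shows "linear F \<Longrightarrow> F \<in> borel_measurable borel"
  by (simp add: borel_measurable_continuous_onI linear_continuous_on linear_conv_bounded_linear)

text \<open>Renaming coordinates pulls a box back to a box with the same side lengths, and boxes
  determine Lebesgue measure.\<close>

lemma lborel_reindex:
  fixes f :: "'m::finite \<Rightarrow> 'n::finite"
  assumes f: "bij f"
  shows "distr lborel borel (\<lambda>x::real^'n. \<chi> i. x $ f i) = lborel"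
proof (rule lborel_eqI[symmetric])
  let ?F = "\<lambda>x::real^'n. \<chi> i. x $ f i"
  have m: "?F \<in> borel_measurable borel"
    by (rule vec_borel_measurable) (auto intro!: linearI simp: vec_eq_iff)
  fix l u :: "real^'m" assume lu: "\<And>b. b \<in> Basis \<Longrightarrow> l \<bullet> b \<le> u \<bullet> b"
  define G where "G = (\<lambda>x::real^'m. \<chi> k. x $ inv f k :: real^'n)"
  have fi: "f (inv f k) = k" "inv f (f i) = i" for k i using f by (auto simp: bij_def surj_f_inv_f)
  have v: "?F -` box l u = box (G l) (G u)"
  proof (intro set_eqI)
    fix x
    have "(\<forall>i. l $ i < x $ f i \<and> x $ f i < u $ i) \<longleftrightarrow> (\<forall>k. l $ inv f k < x $ k \<and> x $ k < u $ inv f k)"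
      using fi by metis
    then show "x \<in> ?F -` box l u \<longleftrightarrow> x \<in> box (G l) (G u)" by (simp add: mem_box_cart G_def)
  qed
  have lu': "l $ i \<le> u $ i" for i using lu[of "axis i 1"] by (simp add: inner_axis)
  have G: "\<And>b. b \<in> Basis \<Longrightarrow> G l \<bullet> b \<le> G u \<bullet> b"
    using lu' by (auto simp: Basis_vec_def inner_axis G_def)
  have "emeasure (distr lborel borel ?F) (box l u) = ennreal (\<Prod>b\<in>Basis. (G u - G l) \<bullet> b)"
    using m G by (simp add: emeasure_distr v)
  also have "(\<Prod>b\<in>Basis. (G u - G l) \<bullet> b) = (\<Prod>k\<in>UNIV. (u - l) $ inv f k)"
    by (simp add: prod_Basis_vec inner_axis G_def)
  also have "\<dots> = (\<Prod>i\<in>UNIV. (u - l) $ i)"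
    using f by (intro prod.reindex_bij_betw bij_imp_bij_inv)
  also have "\<dots> = (\<Prod>b\<in>Basis. (u - l) \<bullet> b)" by (simp add: prod_Basis_vec inner_axis)
  finally show "emeasure (distr lborel borel ?F) (box l u) = (\<Prod>b\<in>Basis. (u - l) \<bullet> b)" .
qed simp

text \<open>The preimage of a box under \<open>L\<close> is its image under the inverse
  \<open>L'\<close>, whose volume carries the factor \<open>\<bar>det L'\<bar>\<close>; the density
  cancels it.\<close>

lemma lborel_linear_image_wellorder:
  fixes L L' :: "real^'n::{finite,wellorder}^'n::_"
  assumes "L' ** L = mat 1"
  shows "lborel = density (distr lborel borel ((*v) L)) (\<lambda>_. ennreal \<bar>det L\<bar>)"
proof (rule lborel_eqI)
  have LL': "L ** L' = mat 1" using assms by (rule iffD1[OF matrix_left_right_inverse])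
  have m: "(*v) L \<in> measurable lborel borel"
    by (simp add: borel_measurable_continuous_onI linear_continuous_on)
  fix l u :: "real^'n::_" assume lu: "\<And>b. b \<in> Basis \<Longrightarrow> l \<bullet> b \<le> u \<bullet> b"
  have v: "(*v) L -` box l u = (*v) L' ` box l u"
  proof (intro set_eqI iffI)
    fix x assume "x \<in> (*v) L -` box l u"
    then show "x \<in> (*v) L' ` box l u"
      by (intro image_eqI[of _ _ "L *v x"]) (simp_all add: matrix_vector_mul_assoc assms)
  qed (auto simp: matrix_vector_mul_assoc LL')
  have i: "(*v) L' ` box l u \<in> lmeasurable" "measure lebesgue ((*v) L' ` box l u) = \<bar>det L'\<bar> * measure lebesgue (box l u)"
    using measurable_linear_image[of "(*v) L'" "box l u"] measure_linear_image[of "(*v) L'" "box l u"]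
    by (simp_all add: matrix_of_matrix_vector_mul)
  have mb: "(*v) L' ` box l u \<in> sets borel"
    using measurable_sets[OF m, of "box l u"] v by simp
  have "emeasure lborel ((*v) L' ` box l u) = emeasure lebesgue ((*v) L' ` box l u)"
    using mb by simp
  also have "\<dots> = ennreal (\<bar>det L'\<bar> * measure lebesgue (box l u))"
    using i by (simp add: emeasure_eq_measure2 fmeasurableD2)
  finally have e: "emeasure lborel ((*v) L -` box l u) = ennreal (\<bar>det L'\<bar> * (\<Prod>b\<in>Basis. (u - l) \<bullet> b))"
    using lu by (simp add: v measure_lborel_box_eq)
  have "det L * det L' = 1" using LL' by (metis det_I det_mul)
  then have d: "\<bar>det L\<bar> * \<bar>det L'\<bar> = 1" by (metis abs_mult abs_one)
  have "emeasure (density (distr lborel borel ((*v) L)) (\<lambda>_. ennreal \<bar>det L\<bar>)) (box l u)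
      = ennreal \<bar>det L\<bar> * emeasure lborel ((*v) L -` box l u)"
    using m by (simp add: emeasure_density_const emeasure_distr)
  also have "\<dots> = ennreal (\<bar>det L\<bar> * (\<bar>det L'\<bar> * (\<Prod>b\<in>Basis. (u - l) \<bullet> b)))"
    unfolding e by (simp add: ennreal_mult')
  also have "\<dots> = (\<Prod>b\<in>Basis. (u - l) \<bullet> b)"
    using d by (simp add: mult.assoc[symmetric])
  finally show "emeasure (density (distr lborel borel ((*v) L)) (\<lambda>_. ennreal \<bar>det L\<bar>)) (box l u)
    = (\<Prod>b\<in>Basis. (u - l) \<bullet> b)" .
qed simp

text \<open>Rename the coordinates by the ranked copy, change variables there and rename back.
  Renaming alters neither Lebesgue measure nor the determinant.\<close>

lemma lborel_linear_image:
  fixes L L' :: "real^'n^'n"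
  assumes L: "L' ** L = mat 1"
  shows "lborel = density (distr lborel borel ((*v) L)) (\<lambda>_. ennreal \<bar>det L\<bar>)"
proof -
  define F where "F = (\<lambda>x::real^'n. \<chi> i. x $ unrank i :: real^'n ranked)"
  define G where "G = (\<lambda>x::real^'n ranked. \<chi> k. x $ inv unrank k :: real^'n)"
  define c where "c = (\<lambda>A::real^'n^'n. \<chi> i j. A $ unrank i $ unrank j :: real^'n ranked^'n ranked)"
  have fi: "unrank (inv unrank k) = k" for k :: 'n
    by (rule surj_f_inv_f[OF bij_is_surj[OF bij_unrank]])
  have re: "(\<Sum>j\<in>UNIV. h (unrank j)) = sum h UNIV" for h :: "'n \<Rightarrow> real"
    by (rule sum.reindex_bij_betw[OF bij_unrank])
  have "(c L' ** c L) $ i $ j = (L' ** L) $ unrank i $ unrank j" for i j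
    using re[of "\<lambda>k. L' $ unrank i $ k * L $ k $ unrank j"]
    by (simp add: c_def matrix_matrix_mult_def)
  then have "c L' ** c L = mat 1"
    by (simp add: L vec_eq_iff mat_def unrank_inject)
  from lborel_linear_image_wellorder[OF this]
  have cL: "lborel = density (distr lborel borel ((*v) (c L))) (\<lambda>_. ennreal \<bar>det L\<bar>)"
    by (simp add: c_def det_reindex[OF bij_unrank])
  have m: "F \<in> borel_measurable borel" "G \<in> borel_measurable borel" "(*v) (c L) \<in> borel_measurable borel"
    unfolding F_def G_def by (rule vec_borel_measurable; auto intro!: linearI simp: vec_eq_iff)+
  have FG: "distr lborel borel F = lborel" "distr lborel borel G = lborel"
    unfolding F_def G_def by (rule lborel_reindex bij_unrank bij_imp_bij_inv)+
  have "(*v) L = G \<circ> ((*v) (c L) \<circ> F)"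
  proof
    fix x
    show "L *v x = (G \<circ> ((*v) (c L) \<circ> F)) x"
      using re[of "\<lambda>j. L $ k $ j * x $ j" for k]
      by (simp add: F_def G_def c_def vec_eq_iff matrix_vector_mult_def fi)
  qed
  then have "distr lborel borel ((*v) L) = distr (distr (distr lborel borel F) borel ((*v) (c L))) borel G"
    using m by (simp add: distr_distr)
  then have "density (distr lborel borel ((*v) L)) (\<lambda>_. ennreal \<bar>det L\<bar>)
      = distr (density (distr lborel borel ((*v) (c L))) (\<lambda>_. ennreal \<bar>det L\<bar>)) borel G"
    using m by (simp add: FG density_distr)
  then show ?thesis using cL FG by simp
qed

section \<open>Gaussian measures and their moments\<close>

definition std_gauss :: "(real^'k) measure" where
  "std_gauss = density lborel (\<lambda>y. ennreal (\<Prod>i\<in>UNIV. std_normal_density (y $ i)))"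

definition gauss :: "real^'k^'k \<Rightarrow> (real^'k) measure" where
  "gauss \<Sigma> = density lborel (\<lambda>u. ennreal (gaussian_density 0 \<Sigma> u))"

text \<open>Each flag switches on one factor \<open>t\<close>. One formula thus covers the degrees
  0, 1 and 2 in which a single coordinate can occur in a product of two coordinates.\<close>

lemma integrable_std_normal_monomial:
  "integrable lborel (\<lambda>t. std_normal_density t * ((if a then t else 1) * (if b then t else 1)))"
  using integrable_std_normal_moment[of 0] integrable_std_normal_moment[of 1] integrable_std_normal_moment[of 2]
  by (cases a; cases b) (simp_all add: power2_eq_square)

lemma std_gauss_moments:
  "prob_space (std_gauss :: (real^'k) measure)"
  "integrable (std_gauss :: (real^'k) measure) outer"
  "(\<integral>y. outer y \<partial>(std_gauss :: (real^'k) measure)) = mat 1"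
  "integrable (std_gauss :: (real^'k) measure) (\<lambda>y. y)"
  "(\<integral>y. y \<partial>(std_gauss :: (real^'k) measure)) = 0"
proof -
  let ?m = "\<lambda>a b t. std_normal_density t * ((if a then t else 1) * (if b then t else 1))"
  have I: "(\<integral>t. ?m False False t \<partial>lborel) = 1" "(\<integral>t. ?m True False t \<partial>lborel) = 0"
    "(\<integral>t. ?m False True t \<partial>lborel) = 0" "(\<integral>t. ?m True True t \<partial>lborel) = 1"
    using integral_std_normal_moment_even[of 0] integral_std_normal_moment_odd[of 0] integral_std_normal_moment_even[of 1]
    by (simp_all add: power2_eq_square)
  have I': "(\<integral>t. ?m a b t \<partial>lborel) = (if a then (if b then 1 else 0) else (if b then 0 else 1))" for a b
    using I by (cases a; cases b) simp_all
  have [measurable]: "(\<lambda>y::real^'k. y $ i) \<in> borel_measurable borel" for i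
    by (simp add: borel_measurable_continuous_onI continuous_on_component continuous_on_id)
  have pm: "(\<lambda>y::real^'k. \<Prod>i\<in>UNIV. std_normal_density (y $ i)) \<in> borel_measurable borel" by measurable
  have nn: "0 \<le> (\<Prod>i\<in>UNIV. std_normal_density (y $ i))" for y :: "real^'k" by (intro prod_nonneg) auto
  \<comment> \<open>The density times the coordinates flagged by \<open>a\<close> and those flagged
    by \<open>b\<close>. Singleton flags give the product of two coordinates, an empty flag drops
    one, and the integral splits over the coordinates.\<close>
  define P where "P = (\<lambda>a b (y::real^'k). \<Prod>k\<in>UNIV. ?m (a k) (b k) (y $ k))"
  have P: "integrable lborel (P a b)" "(\<integral>y. P a b y \<partial>lborel) = (\<Prod>k\<in>UNIV. \<integral>t. ?m (a k) (b k) t \<partial>lborel)" for a b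
    unfolding P_def by (rule lborel_integral_prod_vec integrable_std_normal_monomial)+
  have PF: "P (\<lambda>k. k = i \<and> a) (\<lambda>k. k = j \<and> b) y
      = (\<Prod>i\<in>UNIV. std_normal_density (y $ i)) * ((if a then y $ i else 1) * (if b then y $ j else 1))" for i j a b y
    by (cases a; cases b) (simp_all add: P_def prod.distrib prod.delta)
  have "(\<integral>\<^sup>+y. ennreal (\<Prod>i\<in>UNIV. std_normal_density (y $ i)) \<partial>(lborel::(real^'k) measure)) = 1"
    using P[of "\<lambda>_. False" "\<lambda>_. False"] nn
    by (subst nn_integral_eq_integral) (auto simp: P_def I)
  then show "prob_space (std_gauss :: (real^'k) measure)"
    unfolding std_gauss_def using pm by (intro prob_spaceI) (simp add: emeasure_density)
  have int: "integrable (std_gauss :: (real^'k) measure) f \<longleftrightarrow>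
      integrable lborel (\<lambda>y. (\<Prod>i\<in>UNIV. std_normal_density (y $ i)) * f y)"
    "(\<integral>y. f y \<partial>(std_gauss :: (real^'k) measure)) = (\<integral>y. (\<Prod>i\<in>UNIV. std_normal_density (y $ i)) * f y \<partial>lborel)"
    if "f \<in> borel_measurable borel" for f :: "real^'k \<Rightarrow> real"
    using integrable_density[of f lborel "\<lambda>y. \<Prod>i\<in>UNIV. std_normal_density (y $ i)"]
      integral_density[of f lborel "\<lambda>y. \<Prod>i\<in>UNIV. std_normal_density (y $ i)"] that pm nn
    by (simp_all add: std_gauss_def)
  have Po: "P (\<lambda>k. k = i) (\<lambda>k. k = j) = (\<lambda>y. (\<Prod>i\<in>UNIV. std_normal_density (y $ i)) * (y $ i * y $ j))" for i j
    using PF[of i True j True] by (simp add: fun_eq_iff)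
  have Pf: "P (\<lambda>k. k = i) (\<lambda>k. False) = (\<lambda>y. (\<Prod>i\<in>UNIV. std_normal_density (y $ i)) * y $ i)" for i
    using PF[of i True i False] by (simp add: fun_eq_iff)
  have o: "integrable (std_gauss :: (real^'k) measure) (\<lambda>y. y $ i * y $ j)" for i j
    using P(1)[of "\<lambda>k. k = i" "\<lambda>k. k = j"] by (subst int) (simp_all add: Po)
  have o': "(\<integral>y. y $ i * y $ j \<partial>(std_gauss :: (real^'k) measure)) = (if i = j then 1 else 0)" for i j
  proof -
    have "(\<integral>y. y $ i * y $ j \<partial>(std_gauss :: (real^'k) measure)) = (\<integral>y. P (\<lambda>k. k = i) (\<lambda>k. k = j) y \<partial>lborel)"
      by (subst int) (simp_all add: Po)
    also have "\<dots> = (\<Prod>k\<in>UNIV. if k = i then (if k = j then 1 else 0) else (if k = j then 0 else 1))"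
      unfolding P I' by (intro prod.cong) auto
    also have "\<dots> = (if i = j then 1 else 0)"
      by (auto intro!: prod.neutral prod_zero)
    finally show ?thesis .
  qed
  have f: "integrable (std_gauss :: (real^'k) measure) (\<lambda>y. y $ i)" for i
    using P(1)[of "\<lambda>k. k = i" "\<lambda>k. False"] by (subst int) (simp_all add: Pf)
  have f': "(\<integral>y. y $ i \<partial>(std_gauss :: (real^'k) measure)) = 0" for i
  proof -
    have "(\<integral>y. y $ i \<partial>(std_gauss :: (real^'k) measure)) = (\<integral>y. P (\<lambda>k. k = i) (\<lambda>k. False) y \<partial>lborel)"
      by (subst int) (simp_all add: Pf)
    also have "\<dots> = (\<Prod>k\<in>UNIV. if k = i then 0 else 1)"
      unfolding P I' by simp
    also have "\<dots> = 0" by (auto intro!: prod_zero)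
    finally show ?thesis .
  qed
  show 1: "integrable (std_gauss :: (real^'k) measure) outer"
    by (intro integrable_vecI) (simp add: outer_def o)
  then have "\<And>i. integrable (std_gauss :: (real^'k) measure) (\<lambda>y. outer y $ i)"
    using integrable_bounded_linear[OF bounded_linear_vec_nth] by blast
  then show "(\<integral>y. outer y \<partial>(std_gauss :: (real^'k) measure)) = mat 1"
    by (simp add: vec_eq_iff integral_vec_nth 1) (simp add: outer_def o' mat_def)
  show 2: "integrable (std_gauss :: (real^'k) measure) (\<lambda>y. y)"
    by (intro integrable_vecI f)
  show "(\<integral>y. y \<partial>(std_gauss :: (real^'k) measure)) = 0"
    by (simp add: vec_eq_iff integral_vec_nth 2 f')
qed

lemma std_normal_density_prod:
  "(\<Prod>i\<in>UNIV. std_normal_density (y $ i)) = exp (- (y \<bullet> y) / 2) / sqrt ((2 * pi) ^ CARD('k))"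
  for y :: "real^'k"
proof -
  have "(\<Prod>i\<in>UNIV. std_normal_density (y $ i)) = (\<Prod>i\<in>UNIV. exp (- (y $ i)\<^sup>2 / 2) / sqrt (2 * pi))"
    by (simp add: std_normal_density_def)
  also have "\<dots> = exp (\<Sum>i\<in>UNIV. - (y $ i)\<^sup>2 / 2) / sqrt (2 * pi) ^ CARD('k)"
    by (simp add: prod_dividef exp_sum)
  also have "(\<Sum>i\<in>UNIV. - (y $ i)\<^sup>2 / 2) = - (y \<bullet> y) / 2"
    by (simp add: inner_vec_def power2_eq_square sum_divide_distrib sum_negf)
  finally show ?thesis by (simp only: real_sqrt_power)
qed

lemma pd_det_pos:
  fixes \<Sigma> :: "real^'k^'k"
  assumes S: "\<Sigma> \<in> sym_pd" shows "0 < det \<Sigma>"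
proof -
  obtain L :: "real^'k^'k" where L: "\<Sigma> = L ** transpose L" using pd_factorization[OF S] .
  have "det \<Sigma> * det (matrix_inv \<Sigma>) = 1" using pd_inverse(1)[OF S] by (metis det_I det_mul)
  then have "det \<Sigma> \<noteq> 0" by auto
  moreover have "det \<Sigma> = (det L)\<^sup>2" by (simp add: L det_mul power2_eq_square)
  ultimately show ?thesis by simp
qed

lemma gaussian_density_pos: "\<Sigma> \<in> sym_pd \<Longrightarrow> 0 < gaussian_density m \<Sigma> u"
  by (simp add: gaussian_density_def pd_det_pos)

lemma ln_gaussian_density:
  fixes \<Sigma> :: "real^'k^'k"
  assumes "\<Sigma> \<in> sym_pd"
  shows "ln (gaussian_density m \<Sigma> u)
    = - ((u - m) \<bullet> (matrix_inv \<Sigma> *v (u - m))) / 2 - ln ((2 * pi) ^ CARD('k) * det \<Sigma>) / 2"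
proof -
  have "0 < (2 * pi) ^ CARD('k) * det \<Sigma>" using pd_det_pos[OF assms] by simp
  then show ?thesis using pd_det_pos[OF assms] by (simp add: gaussian_density_def ln_div ln_sqrt)
qed

lemma gaussian_density_measurable [measurable]:
  "gaussian_density m \<Sigma> \<in> borel_measurable borel"
proof -
  have "continuous_on UNIV (\<lambda>u. exp (- ((u - m) \<bullet> (matrix_inv \<Sigma> *v (u - m))) / 2) / sqrt ((2 * pi) ^ CARD('a) * det \<Sigma>))"
    unfolding divide_inverse
    by (intro continuous_intros linear_continuous_on_compose[OF _ matrix_vector_mul_linear])
  then show ?thesis unfolding gaussian_density_def[abs_def] by (rule borel_measurable_continuous_onI)
qed

text \<open>Factoring the precision matrix by \<open>L^T \<Sigma>^{-1} L = I\<close> gives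
  \<open>\<Sigma> = L L^T\<close> and makes the exponent standard in \<open>y\<close> when
  \<open>u = L y\<close>; the Jacobian \<open>\<bar>det L\<bar>\<close> absorbs the square root of
  \<open>det \<Sigma>\<close>.\<close>

lemma gauss_eq_distr:
  fixes \<Sigma> :: "real^'k^'k"
  assumes S: "\<Sigma> \<in> sym_pd"
  obtains L :: "real^'k^'k" where "\<Sigma> = L ** transpose L" "gauss \<Sigma> = distr std_gauss borel ((*v) L)"
proof -
  note S' = pd_inverse[OF S]
  obtain L :: "real^'k^'k" where L: "transpose L ** matrix_inv \<Sigma> ** L = mat 1"
    "matrix_inv (matrix_inv \<Sigma>) = L ** transpose L"
    using pd_inverse_factor[OF S'(3)] .
  have SL: "\<Sigma> = L ** transpose L" using L(2) S'(4) by simp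
  have m: "(*v) L \<in> borel_measurable borel" by (simp add: vec_borel_measurable)
  have d: "det \<Sigma> = (det L)\<^sup>2" by (simp add: SL det_mul power2_eq_square)
  then have d0: "det L \<noteq> 0" using pd_det_pos[OF S] by auto
  have "gaussian_density 0 \<Sigma> (L *v y) * \<bar>det L\<bar> = (\<Prod>i\<in>UNIV. std_normal_density (y $ i))" for y
  proof -
    have "(L *v y) \<bullet> (matrix_inv \<Sigma> *v (L *v y)) = y \<bullet> ((transpose L ** matrix_inv \<Sigma> ** L) *v y)"
      by (simp add: mv_simps del: transpose_matrix_vector)
    then have "(L *v y) \<bullet> (matrix_inv \<Sigma> *v (L *v y)) = y \<bullet> y" by (simp add: L)
    then show ?thesis using d0
      by (simp add: gaussian_density_def std_normal_density_prod d real_sqrt_mult)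
  qed
  then have g: "ennreal \<bar>det L\<bar> * ennreal (gaussian_density 0 \<Sigma> (L *v y))
      = ennreal (\<Prod>i\<in>UNIV. std_normal_density (y $ i))" for y
    by (simp add: ennreal_mult'[symmetric] mult.commute)
  have "lborel = density (distr lborel borel ((*v) L)) (\<lambda>_. ennreal \<bar>det L\<bar>)"
    by (rule lborel_linear_image[OF L(1)])
  then have "gauss \<Sigma> = density (density (distr lborel borel ((*v) L)) (\<lambda>_. ennreal \<bar>det L\<bar>))
      (\<lambda>u. ennreal (gaussian_density 0 \<Sigma> u))"
    by (simp add: gauss_def)
  also have "\<dots> = density (distr lborel borel ((*v) L)) (\<lambda>u. ennreal \<bar>det L\<bar> * ennreal (gaussian_density 0 \<Sigma> u))"
    by (subst density_density_eq) auto
  also have "\<dots> = distr (density lborel (\<lambda>y. ennreal \<bar>det L\<bar> * ennreal (gaussian_density 0 \<Sigma> (L *v y)))) borel ((*v) L)"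
    using m by (subst density_distr) auto
  also have "\<dots> = distr std_gauss borel ((*v) L)"
    by (simp add: g std_gauss_def)
  finally show thesis using that SL by blast
qed

lemma outer_linear_image: "outer (L *v x) = L ** outer x ** transpose L"
  by (simp add: outer_def matrix_matrix_mult_def matrix_vector_mult_def transpose_def vec_eq_iff
      sum_distrib_left sum_distrib_right mult_ac)

lemma bounded_linear_congruence: "bounded_linear (\<lambda>X::real^'n^'n. L ** X ** transpose L)"
  for L :: "real^'n^'m"
  unfolding linear_conv_bounded_linear[symmetric]
  by (rule linearI) (simp_all add: matrix_add_ldistrib matrix_matrix_mult_add_rdistrib matrix_scalar_ac scalar_matrix_assoc)

lemma outer_measurable [measurable]: "outer \<in> borel_measurable borel"
  unfolding outer_def[abs_def]
  by (intro borel_measurable_continuous_onI continuous_on_vec_lambda continuous_intros)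

lemma gauss_moments:
  fixes \<Sigma> :: "real^'k^'k"
  assumes S: "\<Sigma> \<in> sym_pd"
  shows "prob_space (gauss \<Sigma>)" "integrable (gauss \<Sigma>) outer" "(\<integral>y. outer y \<partial>gauss \<Sigma>) = \<Sigma>"
    "integrable (gauss \<Sigma>) (\<lambda>y. y)" "(\<integral>y. y \<partial>gauss \<Sigma>) = 0"
proof -
  obtain L :: "real^'k^'k" where L: "\<Sigma> = L ** transpose L" "gauss \<Sigma> = distr std_gauss borel ((*v) L)"
    using gauss_eq_distr[OF S] .
  have m: "(*v) L \<in> measurable std_gauss borel"
    using vec_borel_measurable[of "(*v) L"] by (simp add: std_gauss_def)
  show "prob_space (gauss \<Sigma>)"
    unfolding L(2) by (rule prob_space.prob_space_distr[OF std_gauss_moments(1) m])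
  show "integrable (gauss \<Sigma>) outer"
    unfolding L(2) using m
    by (simp add: integrable_distr_eq outer_linear_image
        integrable_bounded_linear[OF bounded_linear_congruence std_gauss_moments(2)])
  have "(\<integral>y. outer y \<partial>gauss \<Sigma>) = L ** mat 1 ** transpose L"
    unfolding L(2) using m
    by (simp add: integral_distr outer_linear_image
        integral_bounded_linear[OF bounded_linear_congruence std_gauss_moments(2)] std_gauss_moments(3))
  then show "(\<integral>y. outer y \<partial>gauss \<Sigma>) = \<Sigma>" by (simp add: L(1))
  show "integrable (gauss \<Sigma>) (\<lambda>y. y)"
    unfolding L(2) using m
    by (simp add: integrable_distr_eq
        integrable_bounded_linear[OF matrix_vector_mul_bounded_linear std_gauss_moments(4)])
  show "(\<integral>y. y \<partial>gauss \<Sigma>) = 0"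
    unfolding L(2) using m
    by (simp add: integral_distr
        integral_bounded_linear[OF matrix_vector_mul_bounded_linear std_gauss_moments(4)] std_gauss_moments(5))
qed

lemma trace_mul_outer: "trace (H ** outer x) = x \<bullet> (H *v x)"
  by (simp add: trace_def outer_def matrix_matrix_mult_def matrix_vector_mult_def inner_vec_def
      sum_distrib_left mult_ac)

lemma integrable_quadratic:
  "integrable M (\<lambda>z. outer (f z)) \<Longrightarrow> integrable M (\<lambda>z. f z \<bullet> (H *v f z))"
  using integrable_bounded_linear[OF bounded_linear_trace_mul_right] by (simp add: trace_mul_outer[symmetric])

lemma integral_quadratic:
  "integrable M (\<lambda>z. outer (f z)) \<Longrightarrow> (\<integral>z. f z \<bullet> (H *v f z) \<partial>M) = trace (H ** (\<integral>z. outer (f z) \<partial>M))"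
  using integral_bounded_linear[OF bounded_linear_trace_mul_right] by (simp add: trace_mul_outer[symmetric])

text \<open>Integrate \<open>p (ln q - ln p) \<le> q - p\<close> for the two densities.\<close>

lemma gaussian_gibbs:
  fixes \<Sigma> T :: "real^'k^'k"
  assumes S: "\<Sigma> \<in> sym_pd" and T: "T \<in> sym_pd"
  shows "ln (det \<Sigma>) + real CARD('k) \<le> trace (matrix_inv T ** \<Sigma>) + ln (det T)"
proof -
  let ?p = "gaussian_density 0 \<Sigma>" and ?q = "gaussian_density 0 T"
  have e: "integrable lborel (gaussian_density 0 U)" "(\<integral>u. gaussian_density 0 U u \<partial>lborel) = 1"
    if "U \<in> sym_pd" for U :: "real^'k^'k"
  proof -
    have nn: "0 \<le> gaussian_density 0 U u" for u using gaussian_density_pos[OF that] by (rule less_imp_le)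
    have "emeasure (gauss U) (space (gauss U)) = 1"
      using gauss_moments(1)[OF that] by (rule prob_space.emeasure_space_1)
    then have i: "(\<integral>\<^sup>+u. ennreal (gaussian_density 0 U u) \<partial>lborel) = ennreal 1"
      by (simp add: gauss_def emeasure_density)
    show "integrable lborel (gaussian_density 0 U)"
      using nn i by (intro integrableI_nonneg) auto
    show "(\<integral>u. gaussian_density 0 U u \<partial>lborel) = 1"
      using nn i by (intro integral_eq_nn_integral[THEN trans]) auto
  qed
  define c where "c = (\<lambda>U::real^'k^'k. ln ((2 * pi) ^ CARD('k) * det U) / 2)"
  \<comment> \<open>The log-ratio of the densities is a quadratic polynomial, so its mean under
    \<open>gauss \<Sigma>\<close> needs only the second moment.\<close>
  define f where "f = (\<lambda>u::real^'k. u \<bullet> (matrix_inv \<Sigma> *v u) / 2 - u \<bullet> (matrix_inv T *v u) / 2 + (c \<Sigma> - c T))"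
  have f: "ln (?q u) - ln (?p u) = f u" for u
    by (simp add: f_def c_def ln_gaussian_density S T)
  interpret g: prob_space "gauss \<Sigma>" by (rule gauss_moments(1)[OF S])
  note q = integrable_quadratic[OF gauss_moments(2)[OF S]]
  have fi: "integrable (gauss \<Sigma>) f" unfolding f_def using q by auto
  have "(\<integral>u. f u \<partial>gauss \<Sigma>) = trace (matrix_inv \<Sigma> ** \<Sigma>) / 2 - trace (matrix_inv T ** \<Sigma>) / 2 + (c \<Sigma> - c T)"
    unfolding f_def using q
    by (simp add: integral_quadratic[OF gauss_moments(2)[OF S]] gauss_moments(3)[OF S] g.prob_space)
  then have If: "(\<integral>u. f u \<partial>gauss \<Sigma>) = real CARD('k) / 2 - trace (matrix_inv T ** \<Sigma>) / 2 + (c \<Sigma> - c T)"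
    by (simp add: pd_inverse(2)[OF S] trace_I)
  have pn: "0 \<le> ?p u" for u using gaussian_density_pos[OF S, of 0 u] by simp
  have fm: "f \<in> borel_measurable borel" using borel_measurable_integrable[OF fi] by (simp add: gauss_def)
  have "(\<integral>u. f u \<partial>gauss \<Sigma>) = (\<integral>u. ?p u * f u \<partial>lborel)"
    unfolding gauss_def using pn fm by (subst integral_density) auto
  also have "\<dots> \<le> (\<integral>u. ?q u - ?p u \<partial>lborel)"
  proof (rule integral_mono)
    show "integrable lborel (\<lambda>u. ?p u * f u)"
      using fi fm pn unfolding gauss_def by (subst (asm) integrable_density) auto
    show "integrable lborel (\<lambda>u. ?q u - ?p u)" using e S T by auto
    fix u
    have pq: "0 < ?p u" "0 < ?q u" using gaussian_density_pos S T by blast+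
    have "f u = ln (?q u / ?p u)" using pq by (simp add: f[symmetric] ln_div)
    also have "\<dots> \<le> ?q u / ?p u - 1" using pq by (intro ln_le_minus_one) simp
    finally have "?p u * f u \<le> ?p u * (?q u / ?p u - 1)" using pq by (intro mult_left_mono) auto
    then show "?p u * f u \<le> ?q u - ?p u" using pq by (simp add: right_diff_distrib)
  qed
  also have "\<dots> = 0" using e S T by simp
  finally have "(\<integral>u. f u \<partial>gauss \<Sigma>) \<le> 0" .
  moreover have "2 * c U = real CARD('k) * ln (2 * pi) + ln (det U)" if "U \<in> sym_pd" for U
    using pd_det_pos[OF that] by (simp add: c_def ln_mult ln_realpow algebra_simps)
  ultimately show ?thesis using If S T by (simp add: field_simps)
qed

section \<open>The law of the trajectory\<close>

text \<open>An initial segment is its own hull under \<open>up_to\<close>, so nothing is projected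
  away.\<close>

lemma (in Ionescu_Tulcea) CI_upto: "CI {0..<n} = C 0 n (\<lambda>_. undefined)"
proof -
  have "up_to {0..<n} = n"
  proof (rule antisym)
    show "up_to {0..<n} \<le> n" by (simp add: up_to_iff)
    show "n \<le> up_to {0..<n}" using up_to[of "{0..<n}"] by (cases "n = 0") auto
  qed
  then show ?thesis using distr_C[of n n "\<lambda>_. undefined" 0] by (simp add: CI_def)
qed

lemma (in Ionescu_Tulcea) nn_integral_lim_upto:
  assumes f: "f \<in> borel_measurable (PiM {0..<n} M)"
  shows "(\<integral>\<^sup>+z. f (restrict z {0..<n}) \<partial>PF.lim) = (\<integral>\<^sup>+x. f x \<partial>C 0 n (\<lambda>_. undefined))"
proof -
  have m: "(\<lambda>z. restrict z {0..<n}) \<in> measurable PF.lim (PiM {0..<n} M)"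
    unfolding measurable_cong_sets[OF PF.sets_lim refl] by (rule measurable_restrict_subset) simp
  have "(\<integral>\<^sup>+x. f x \<partial>distr PF.lim (PiM {0..<n} M) (\<lambda>z. restrict z {0..<n}))
      = (\<integral>\<^sup>+z. f (restrict z {0..<n}) \<partial>PF.lim)"
    using f by (intro nn_integral_distr[OF m]) simp
  then show ?thesis by (simp add: distr_lim CI_upto)
qed

text \<open>Given the past, coordinate \<open>n\<close> has law \<open>P n\<close>. The
  finite-horizon kernel product peels off its last factor, and the remaining past is read off the
  limit measure again.\<close>

lemma (in Ionescu_Tulcea) nn_integral_lim_component:
  assumes f [measurable]: "f \<in> borel_measurable (M n)"
  shows "(\<integral>\<^sup>+z. f (z n) \<partial>PF.lim) = (\<integral>\<^sup>+z. (\<integral>\<^sup>+y. f y \<partial>P n (restrict z {0..<n})) \<partial>PF.lim)"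
proof -
  have "(\<integral>\<^sup>+z. f (z n) \<partial>PF.lim) = (\<integral>\<^sup>+z. f (restrict z {0..<Suc n} n) \<partial>PF.lim)" by simp
  also have "\<dots> = (\<integral>\<^sup>+x. f (x n) \<partial>C 0 (Suc n) (\<lambda>_. undefined))"
    by (rule nn_integral_lim_upto) simp
  also have "\<dots> = (\<integral>\<^sup>+x. (\<integral>\<^sup>+y. f (y n) \<partial>eP n x) \<partial>C 0 n (\<lambda>_. undefined))"
  proof -
    have "sets (C 0 n (\<lambda>_. undefined)) = sets (PiM {0..<n} M)"
      using sets_C[of "\<lambda>_. undefined" 0 n] by simp
    then have "eP n \<in> measurable (C 0 n (\<lambda>_. undefined)) (subprob_algebra (PiM {0..<Suc n} M))"
      by (subst measurable_cong_sets[OF _ refl]) (assumption, rule measurable_eP)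
    then show ?thesis by (simp, subst nn_integral_bind[where B="PiM {0..<Suc n} M"]) auto
  qed
  also have "\<dots> = (\<integral>\<^sup>+x. (\<integral>\<^sup>+y. f y \<partial>P n x) \<partial>C 0 n (\<lambda>_. undefined))"
  proof (rule nn_integral_cong)
    fix x assume "x \<in> space (C 0 n (\<lambda>_. undefined))"
    then have x: "x \<in> space (PiM {0..<n} M)" by (simp add: space_C)
    then show "(\<integral>\<^sup>+y. f (y n) \<partial>eP n x) = (\<integral>\<^sup>+y. f y \<partial>P n x)"
      by (subst nn_integral_eP) auto
  qed
  also have "\<dots> = (\<integral>\<^sup>+z. (\<integral>\<^sup>+y. f y \<partial>P n (restrict z {0..<n})) \<partial>PF.lim)"
    by (rule nn_integral_lim_upto[symmetric])
      (rule nn_integral_measurable_subprob_algebra2[OF _ P], simp)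
  finally show ?thesis .
qed

text \<open>Restriction preserves total mass, so one finite marginal determines it.\<close>

lemma (in projective_family) prob_space_limI:
  assumes "finite J" "J \<subseteq> I" and "distr lim (PiM J M) (\<lambda>x. restrict x J) = P J"
  shows "prob_space lim"
proof -
  have m: "(\<lambda>z. restrict z J) \<in> measurable lim (PiM J M)"
    unfolding measurable_cong_sets[OF sets_lim refl] by (rule measurable_restrict_subset) fact
  show ?thesis by (rule prob_space_distrD[OF m]) (simp add: assms prob_space_P)
qed

lemma matrix_vector_mult_measurable [measurable]:
  fixes A :: "real^'n^'m"
  shows "f \<in> borel_measurable M \<Longrightarrow> (\<lambda>x. A *v f x) \<in> borel_measurable M"
  using measurable_compose[OF _ vec_borel_measurable[of "(*v) A"]] by simp

section \<open>Trajectories under a Gaussian policy\<close>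

text \<open>The initial law is a parameter because two are used: the distribution \<open>D\<close>,
  and a point mass for the value at a fixed state.\<close>

locale gauss_traj =
  fixes A :: "real^'n^'n" and B :: "real^'k^'n" and \<nu> :: "(real^'n) measure"
    and K :: "real^'n^'k" and \<Sigma> :: "real^'k^'k" and init :: "(real^'n) measure"
  assumes nu: "prob_space \<nu>" "sets \<nu> = sets borel" "integrable \<nu> outer" "(LINT w|\<nu>. w) = 0"
    and S: "\<Sigma> \<in> sym_pd"
    and init: "prob_space init" "sets init = sets borel" "integrable init outer"
begin

abbreviation pol where "pol \<equiv> gaussian_policy K \<Sigma> :: ('n, 'k) policy"
abbreviation T where "T \<equiv> trajectory A B \<nu> pol init"

lemma gauss_prob: "prob_space (gauss \<Sigma>)" and gauss_sets [measurable_cong, simp]: "sets (gauss \<Sigma>) = sets borel"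
  using gauss_moments(1)[OF S] by (simp_all add: gauss_def)

declare nu(2) [measurable_cong, simp] init(2) [measurable_cong, simp]

text \<open>The action is \<open>e - K *v x\<close> with a centred Gaussian \<open>e\<close> whose
  law does not depend on the state. This turns the dynamics into sums of independent terms.\<close>

lemma draw_action_eq: "draw_action pol x = distr (gauss \<Sigma>) borel (\<lambda>e. (x, e - K *v x))"
proof -
  let ?m = "- (K *v x)"
  have e: "gaussian_density ?m \<Sigma> (e - K *v x) = gaussian_density 0 \<Sigma> e" for e
    by (simp add: gaussian_density_def)
  have "density lborel (\<lambda>u. ennreal (pol x u)) = density (distr lborel borel ((+) ?m)) (\<lambda>u. ennreal (gaussian_density ?m \<Sigma> u))"
    by (simp add: lborel_distr_plus gaussian_policy_def)
  also have "\<dots> = distr (gauss \<Sigma>) borel ((+) ?m)"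
    by (subst density_distr) (auto simp: e gauss_def)
  finally have "draw_action pol x = distr (distr (gauss \<Sigma>) borel ((+) ?m)) borel (\<lambda>u. (x, u))"
    by (simp add: draw_action_def)
  also have "\<dots> = distr (gauss \<Sigma>) borel (\<lambda>e. (x, e - K *v x))"
    by (subst distr_distr) (auto simp: comp_def)
  finally show ?thesis by simp
qed

lemma draw_action_measurable [measurable]: "draw_action pol \<in> measurable borel (subprob_algebra borel)"
proof -
  have "gauss \<Sigma> \<in> space (subprob_algebra borel)"
    using gauss_prob by (simp add: space_subprob_algebra prob_space_imp_subprob_space)
  then have "(\<lambda>x. distr (gauss \<Sigma>) borel (\<lambda>e. (x, e - K *v x))) \<in> measurable borel (subprob_algebra borel)"
    by (intro measurable_distr2[where M = borel] measurable_const) (simp_all add: borel_prod[symmetric])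
  then show ?thesis by (simp add: draw_action_eq[abs_def])
qed

lemma prob_draw_action: "prob_space (draw_action pol x)"
  unfolding draw_action_eq by (rule prob_space.prob_space_distr[OF gauss_prob]) simp

lemma prob_bind_draw: "prob_space M \<Longrightarrow> sets M = sets borel \<Longrightarrow> prob_space (M \<bind> draw_action pol)"
  by (rule prob_space.prob_space_bind[where S = borel])
    (auto simp: prob_draw_action cong: measurable_cong_sets)

lemma noise_measurable:
  "(\<lambda>y. distr \<nu> borel (\<lambda>w. y + w)) \<in> measurable borel (subprob_algebra borel)"
proof -
  have "\<nu> \<in> space (subprob_algebra borel)"
    using nu by (simp add: space_subprob_algebra prob_space_imp_subprob_space)
  then show ?thesis
    by (intro measurable_distr2[where M = borel] measurable_const) simp_all
qed

sublocale IT: Ionescu_Tulcea "step_kernel A B \<nu> pol init" "\<lambda>_. borel"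
proof (rule Ionescu_Tulcea.intro, goal_cases)
  case (1 i)
  show "step_kernel A B \<nu> pol init i \<in> measurable (PiM {0..<i} (\<lambda>_. borel)) (subprob_algebra borel)"
  proof (cases i)
    case 0
    have "init \<bind> draw_action pol \<in> space (subprob_algebra borel)"
      using prob_bind_draw[OF init(1,2)] prob_space.not_empty[OF init(1)]
      by (simp add: space_subprob_algebra prob_space_imp_subprob_space draw_action_eq)
    then show ?thesis by (simp add: 0 fun_eq_iff[symmetric] step_kernel.simps(1)[abs_def])
  next
    case (Suc t)
    have "(\<lambda>h. h t) \<in> measurable (PiM {0..<i} (\<lambda>_. borel)) (borel :: ((real^'n) \<times> (real^'k)) measure)"
      by (rule measurable_component_singleton) (simp add: Suc)
    then have "(\<lambda>h. A *v fst (h t) + B *v snd (h t)) \<in> measurable (PiM {0..<i} (\<lambda>_. borel)) borel"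
      by (simp add: borel_prod[symmetric])
    from measurable_compose[OF this noise_measurable]
    have "(\<lambda>h. distr \<nu> borel (\<lambda>w. A *v fst (h t) + B *v snd (h t) + w) \<bind> draw_action pol)
        \<in> measurable (PiM {0..<i} (\<lambda>_. borel)) (subprob_algebra borel)"
      by (rule measurable_bind2) simp
    then show ?thesis by (simp add: Suc step_kernel.simps(2)[abs_def])
  qed
next
  case (2 i x)
  show ?case
  proof (cases i)
    case 0
    then show ?thesis using prob_bind_draw[OF init(1,2)] by simp
  next
    case (Suc t)
    have "(\<lambda>w. A *v fst (x t) + B *v snd (x t) + w) \<in> measurable \<nu> borel" by simp
    from prob_bind_draw[OF prob_space.prob_space_distr[OF nu(1) this]]
    show ?thesis by (simp add: Suc)
  qed
qed

lemma T_eq: "T = IT.PF.lim" by (simp add: trajectory_def)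

lemma T_prob: "prob_space T"
  unfolding T_eq by (rule IT.PF.prob_space_limI[of "{}"]) (simp_all add: IT.distr_lim)

lemma sets_T [measurable_cong, simp]: "sets T = sets (PiM UNIV (\<lambda>_. borel))"
  by (simp add: T_eq)

lemma nn_integral_bind_draw:
  assumes "sets M = sets borel" and f: "f \<in> borel_measurable borel"
  shows "(\<integral>\<^sup>+p. f p \<partial>(M \<bind> draw_action pol)) = (\<integral>\<^sup>+x. (\<integral>\<^sup>+e. f (x, e - K *v x) \<partial>gauss \<Sigma>) \<partial>M)"
proof -
  have "(\<integral>\<^sup>+p. f p \<partial>(M \<bind> draw_action pol)) = (\<integral>\<^sup>+x. (\<integral>\<^sup>+p. f p \<partial>draw_action pol x) \<partial>M)"
    using assms by (intro nn_integral_bind[where B = borel]) (simp_all cong: measurable_cong_sets)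
  then show ?thesis by (simp add: draw_action_eq nn_integral_distr f)
qed

lemma nn_integral_T_0:
  assumes f: "f \<in> borel_measurable borel"
  shows "(\<integral>\<^sup>+z. f (z 0) \<partial>T) = (\<integral>\<^sup>+x. (\<integral>\<^sup>+e. f (x, e - K *v x) \<partial>gauss \<Sigma>) \<partial>init)"
proof -
  interpret T: prob_space T by (rule T_prob)
  show ?thesis
    using IT.nn_integral_lim_component[of f 0] f T.emeasure_space_1
    by (simp add: T_eq[symmetric] nn_integral_bind_draw[OF init(2) f])
qed

lemma nn_integral_T_Suc:
  assumes f: "f \<in> borel_measurable borel"
  shows "(\<integral>\<^sup>+z. f (z (Suc t)) \<partial>T) = (\<integral>\<^sup>+z. (\<integral>\<^sup>+w. (\<integral>\<^sup>+e. f (A *v fst (z t) + B *v snd (z t) + w,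
      e - K *v (A *v fst (z t) + B *v snd (z t) + w)) \<partial>gauss \<Sigma>) \<partial>\<nu>) \<partial>T)"
proof -
  have [measurable]: "(\<lambda>x. \<integral>\<^sup>+e. f (x, e - K *v x) \<partial>gauss \<Sigma>) \<in> borel_measurable borel"
  proof -
    interpret prob_space "gauss \<Sigma>" by (rule gauss_prob)
    show ?thesis
      using f by (intro borel_measurable_nn_integral) (simp add: borel_prod[symmetric] split_beta')
  qed
  have "(\<integral>\<^sup>+x. g x \<partial>distr \<nu> borel (\<lambda>w. y + w)) = (\<integral>\<^sup>+w. g (y + w) \<partial>\<nu>)"
    if "g \<in> borel_measurable borel" for g y
    using that by (subst nn_integral_distr) auto
  then show ?thesis
    using IT.nn_integral_lim_component[of f "Suc t"] f
    by (simp add: T_eq[symmetric] nn_integral_bind_draw)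
qed

definition state_law :: "nat \<Rightarrow> (real^'n) measure" where
  "state_law t = distr T borel (\<lambda>z. fst (z t))"

lemma component_measurable [measurable]: "(\<lambda>z. z t) \<in> measurable T borel"
  unfolding measurable_cong_sets[OF sets_T refl] by (rule measurable_component_singleton) simp

lemma fst_measurable [measurable]: "(\<lambda>z. fst (z t)) \<in> borel_measurable T"
  and snd_measurable [measurable]: "(\<lambda>z. snd (z t)) \<in> borel_measurable T"
  using measurable_compose[OF component_measurable, of fst borel t] measurable_compose[OF component_measurable, of snd borel t]
  by (simp_all add: borel_prod[symmetric])

lemma state_law_prob: "prob_space (state_law t)"
  and state_law_sets [measurable_cong, simp]: "sets (state_law t) = sets borel"
  unfolding state_law_def by (auto intro!: prob_space.prob_space_distr T_prob)

lemma draw_avg_measurable [measurable]: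
  assumes "f \<in> borel_measurable borel"
  shows "(\<lambda>x. \<integral>\<^sup>+e. f (x, e - K *v x) \<partial>gauss \<Sigma>) \<in> borel_measurable borel"
proof -
  interpret prob_space "gauss \<Sigma>" by (rule gauss_prob)
  show ?thesis
    using assms by (intro borel_measurable_nn_integral) (simp add: borel_prod[symmetric] split_beta')
qed

text \<open>The one-step formulas are applied to \<open>f\<close> and to its average
  \<open>g\<close> over the action noise. As \<open>g\<close> sees only the state, both yield the
  same integral, however the state was reached.\<close>

lemma nn_integral_T_state:
  fixes f :: "(real^'n) \<times> (real^'k) \<Rightarrow> ennreal"
  assumes f: "f \<in> borel_measurable borel"
  shows "(\<integral>\<^sup>+z. f (z t) \<partial>T) = (\<integral>\<^sup>+x. (\<integral>\<^sup>+e. f (x, e - K *v x) \<partial>gauss \<Sigma>) \<partial>state_law t)"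
proof -
  define g where "g = (\<lambda>x. \<integral>\<^sup>+e. f (x, e - K *v x) \<partial>gauss \<Sigma>)"
  have g: "g \<in> borel_measurable borel" unfolding g_def using f by (rule draw_avg_measurable)
  interpret G: prob_space "gauss \<Sigma>" by (rule gauss_prob)
  have gf: "(\<lambda>p::(real^'n) \<times> (real^'k). g (fst p)) \<in> borel_measurable borel"
    using g by (simp add: borel_prod[symmetric])
  have c: "(\<integral>\<^sup>+e. g x \<partial>gauss \<Sigma>) = g x" for x using G.emeasure_space_1 by simp
  have "(\<integral>\<^sup>+z. f (z t) \<partial>T) = (\<integral>\<^sup>+z. g (fst (z t)) \<partial>T)"
  proof (cases t)
    case 0
    show ?thesis using nn_integral_T_0[OF f] nn_integral_T_0[OF gf]
      by (simp only: 0 c fst_conv) (simp only: g_def)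
  next
    case (Suc s)
    show ?thesis using nn_integral_T_Suc[OF f, of s] nn_integral_T_Suc[OF gf, of s]
      by (simp only: Suc c fst_conv) (simp only: g_def)
  qed
  also have "\<dots> = (\<integral>\<^sup>+x. g x \<partial>state_law t)"
    unfolding state_law_def using g by (simp add: nn_integral_distr)
  finally show ?thesis by (simp add: g_def)
qed

lemma law_state_action:
  "distr T borel (\<lambda>z. z t) = distr (state_law t \<Otimes>\<^sub>M gauss \<Sigma>) borel (\<lambda>(x, e). (x, e - K *v x))"
proof (rule measure_eqI)
  interpret G: prob_space "gauss \<Sigma>" by (rule gauss_prob)
  have m: "(\<lambda>(x, e). (x, e - K *v x)) \<in> measurable (state_law t \<Otimes>\<^sub>M gauss \<Sigma>) borel"
    by (simp add: borel_prod[symmetric] split_beta')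
  fix X assume "X \<in> sets (distr T borel (\<lambda>z. z t))"
  then have X: "X \<in> sets borel" by simp
  have "emeasure (distr T borel (\<lambda>z. z t)) X = (\<integral>\<^sup>+z. indicator X (z t) \<partial>T)"
    using X by (simp add: nn_integral_indicator[symmetric] nn_integral_distr del: nn_integral_indicator)
  also have "\<dots> = (\<integral>\<^sup>+x. (\<integral>\<^sup>+e. indicator X (x, e - K *v x) \<partial>gauss \<Sigma>) \<partial>state_law t)"
    using X by (intro nn_integral_T_state) simp
  also have "\<dots> = (\<integral>\<^sup>+p. indicator X ((\<lambda>(x, e). (x, e - K *v x)) p) \<partial>(state_law t \<Otimes>\<^sub>M gauss \<Sigma>))"
    using X m by (subst G.nn_integral_fst[symmetric]) auto
  also have "\<dots> = emeasure (distr (state_law t \<Otimes>\<^sub>M gauss \<Sigma>) borel (\<lambda>(x, e). (x, e - K *v x))) X"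
    using X m by (simp add: nn_integral_indicator[symmetric] nn_integral_distr del: nn_integral_indicator)
  finally show "emeasure (distr T borel (\<lambda>z. z t)) X
    = emeasure (distr (state_law t \<Otimes>\<^sub>M gauss \<Sigma>) borel (\<lambda>(x, e). (x, e - K *v x))) X" .
qed simp

lemma state_law_0: "state_law 0 = init"
proof (rule measure_eqI)
  interpret G: prob_space "gauss \<Sigma>" by (rule gauss_prob)
  fix X assume "X \<in> sets (state_law 0)"
  then have X: "X \<in> sets borel" by simp
  then have Xm: "(\<lambda>p::(real^'n) \<times> (real^'k). indicator X (fst p) :: ennreal) \<in> borel_measurable borel"
    by (simp add: borel_prod[symmetric])
  have "emeasure (state_law 0) X = (\<integral>\<^sup>+z. indicator X (fst (z 0)) \<partial>T)"
    using X unfolding state_law_def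
    by (simp add: nn_integral_indicator[symmetric] nn_integral_distr del: nn_integral_indicator)
  then show "emeasure (state_law 0) X = emeasure init X"
    using nn_integral_T_0[OF Xm] X G.emeasure_space_1 by simp
qed simp

text \<open>The closed-loop recursion \<open>x' = (A - B K) x + B e + w\<close> with independent
  \<open>x\<close>, \<open>e\<close> and \<open>w\<close>.\<close>

lemma state_law_Suc:
  "state_law (Suc t) = distr ((state_law t \<Otimes>\<^sub>M gauss \<Sigma>) \<Otimes>\<^sub>M \<nu>) borel
     (\<lambda>(p, w). ((A - B ** K) *v fst p + B *v snd p) + w)"
proof (rule measure_eqI)
  interpret G: prob_space "gauss \<Sigma>" by (rule gauss_prob)
  interpret N: prob_space \<nu> by (rule nu(1))
  let ?F = "\<lambda>(p, w). ((A - B ** K) *v fst p + B *v snd p) + w"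
  have m: "?F \<in> measurable ((state_law t \<Otimes>\<^sub>M gauss \<Sigma>) \<Otimes>\<^sub>M \<nu>) borel"
    by (simp add: split_beta')
  fix X assume "X \<in> sets (state_law (Suc t))"
  then have X: "X \<in> sets borel" by simp
  then have Xm: "(\<lambda>p::(real^'n) \<times> (real^'k). indicator X (fst p) :: ennreal) \<in> borel_measurable borel"
    by (simp add: borel_prod[symmetric])
  define g where "g = (\<lambda>y. \<integral>\<^sup>+w. indicator X (y + w) \<partial>\<nu>)"
  have g: "g \<in> borel_measurable borel"
    unfolding g_def using X by (intro N.borel_measurable_nn_integral) simp
  have gm: "(\<lambda>p. g (A *v fst p + B *v snd p)) \<in> borel_measurable borel"
    using g by (simp add: borel_prod[symmetric])
  have "emeasure (state_law (Suc t)) X = (\<integral>\<^sup>+z. indicator X (fst (z (Suc t))) \<partial>T)"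
    using X unfolding state_law_def
    by (simp add: nn_integral_indicator[symmetric] nn_integral_distr del: nn_integral_indicator)
  also have "\<dots> = (\<integral>\<^sup>+z. g (A *v fst (z t) + B *v snd (z t)) \<partial>T)"
    using nn_integral_T_Suc[OF Xm, of t] G.emeasure_space_1 by (simp add: g_def)
  also have "\<dots> = (\<integral>\<^sup>+x. (\<integral>\<^sup>+e. g (A *v x + B *v (e - K *v x)) \<partial>gauss \<Sigma>) \<partial>state_law t)"
    using nn_integral_T_state[OF gm, of t] by simp
  also have "\<dots> = (\<integral>\<^sup>+p. g (A *v fst p + B *v (snd p - K *v fst p)) \<partial>(state_law t \<Otimes>\<^sub>M gauss \<Sigma>))"
    using g by (subst G.nn_integral_fst[symmetric]) auto
  \<comment> \<open>Here \<open>A x + B (e - K x)\<close> is regrouped as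
    \<open>(A - B K) x + B e\<close>.\<close>
  also have "\<dots> = (\<integral>\<^sup>+p. (\<integral>\<^sup>+w. indicator X (?F (p, w)) \<partial>\<nu>) \<partial>(state_law t \<Otimes>\<^sub>M gauss \<Sigma>))"
    by (simp add: g_def mv_simps algebra_simps)
  also have "\<dots> = (\<integral>\<^sup>+q. indicator X (?F q) \<partial>((state_law t \<Otimes>\<^sub>M gauss \<Sigma>) \<Otimes>\<^sub>M \<nu>))"
    using X m by (subst N.nn_integral_fst[symmetric]) auto
  also have "\<dots> = emeasure (distr ((state_law t \<Otimes>\<^sub>M gauss \<Sigma>) \<Otimes>\<^sub>M \<nu>) borel ?F) X"
    using X m by (simp add: nn_integral_indicator[symmetric] nn_integral_distr del: nn_integral_indicator)
  finally show "emeasure (state_law (Suc t)) X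
    = emeasure (distr ((state_law t \<Otimes>\<^sub>M gauss \<Sigma>) \<Otimes>\<^sub>M \<nu>) borel ?F) X" .
qed simp

end

section \<open>Second moments along the trajectory\<close>

lemma integrable_component_of_outer:
  assumes "prob_space M" "f \<in> borel_measurable M" "integrable M (\<lambda>x. outer (f x))"
  shows "integrable M (\<lambda>x. f x $ i)"
proof -
  interpret prob_space M by fact
  have "integrable M (\<lambda>x. outer (f x) $ i $ i)"
    by (intro integrable_bounded_linear[OF bounded_linear_vec_nth] assms(3))
  then have "integrable M (\<lambda>x. (f x $ i)\<^sup>2)" by (simp add: outer_def power2_eq_square)
  moreover have "(\<lambda>x. f x $ i) \<in> borel_measurable M"
    using measurable_compose[OF assms(2) borel_measurable_continuous_onI[OF continuous_on_component[OF continuous_on_id]]]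
    by simp
  ultimately show ?thesis by (rule square_integrable_imp_integrable[rotated])
qed

lemma integrable_mult_pair:
  fixes f :: "'a \<Rightarrow> real" and g :: "'b \<Rightarrow> real"
  assumes "prob_space M" "prob_space N" "integrable M f" "integrable N g"
  shows "integrable (M \<Otimes>\<^sub>M N) (\<lambda>p. f (fst p) * g (snd p))"
    "(\<integral>p. f (fst p) * g (snd p) \<partial>(M \<Otimes>\<^sub>M N)) = (\<integral>x. f x \<partial>M) * (\<integral>y. g y \<partial>N)"
proof -
  interpret M: prob_space M by fact
  interpret N: prob_space N by fact
  interpret MN: pair_prob_space M N ..
  have [measurable]: "f \<in> borel_measurable M" "g \<in> borel_measurable N" using assms by auto
  show i: "integrable (M \<Otimes>\<^sub>M N) (\<lambda>p. f (fst p) * g (snd p))"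
    by (rule MN.Fubini_integrable) (use assms in \<open>auto simp: abs_mult\<close>)
  show "(\<integral>p. f (fst p) * g (snd p) \<partial>(M \<Otimes>\<^sub>M N)) = (\<integral>x. f x \<partial>M) * (\<integral>y. g y \<partial>N)"
    using MN.integral_fst'[OF i] by simp
qed

lemma integrable_fst_snd:
  fixes f :: "'a \<Rightarrow> 'c::euclidean_space" and g :: "'b \<Rightarrow> 'c"
  assumes "prob_space M" "prob_space N"
  shows "integrable M f \<Longrightarrow> integrable (M \<Otimes>\<^sub>M N) (\<lambda>p. f (fst p))"
    "integrable M f \<Longrightarrow> (\<integral>p. f (fst p) \<partial>(M \<Otimes>\<^sub>M N)) = (\<integral>x. f x \<partial>M)"
    "integrable N g \<Longrightarrow> integrable (M \<Otimes>\<^sub>M N) (\<lambda>p. g (snd p))"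
    "integrable N g \<Longrightarrow> (\<integral>p. g (snd p) \<partial>(M \<Otimes>\<^sub>M N)) = (\<integral>y. g y \<partial>N)"
proof -
  interpret M: prob_space M by fact
  interpret N: prob_space N by fact
  interpret MN: pair_prob_space M N ..
  { assume f: "integrable M f"
    then have [measurable]: "f \<in> borel_measurable M" by auto
    show i: "integrable (M \<Otimes>\<^sub>M N) (\<lambda>p. f (fst p))"
      by (rule MN.Fubini_integrable) (use f in \<open>auto simp: N.prob_space\<close>)
    show "(\<integral>p. f (fst p) \<partial>(M \<Otimes>\<^sub>M N)) = (\<integral>x. f x \<partial>M)"
      using MN.integral_fst'[OF i] by (simp add: N.prob_space) }
  { assume g: "integrable N g"
    then have [measurable]: "g \<in> borel_measurable N" by auto
    show i: "integrable (M \<Otimes>\<^sub>M N) (\<lambda>p. g (snd p))"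
      by (rule MN.Fubini_integrable) (use g in \<open>auto simp: M.prob_space\<close>)
    show "(\<integral>p. g (snd p) \<partial>(M \<Otimes>\<^sub>M N)) = (\<integral>y. g y \<partial>N)"
      using MN.integral_fst'[OF i] by (simp add: M.prob_space) }
qed

text \<open>The cross terms are products of independent integrable factors, and their means vanish
  because \<open>g\<close> is centred; \<open>f\<close> may have any mean.\<close>

lemma outer_independent_sum:
  fixes f :: "'a \<Rightarrow> real^'n" and g :: "'b \<Rightarrow> real^'n"
  assumes M: "prob_space M" and N: "prob_space N"
    and f: "f \<in> borel_measurable M" "integrable M (\<lambda>x. outer (f x))"
    and g: "g \<in> borel_measurable N" "integrable N (\<lambda>y. outer (g y))" "(\<integral>y. g y \<partial>N) = 0"
  shows "integrable (M \<Otimes>\<^sub>M N) (\<lambda>p. outer (f (fst p) + g (snd p)))"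
    "(\<integral>p. outer (f (fst p) + g (snd p)) \<partial>(M \<Otimes>\<^sub>M N)) = (\<integral>x. outer (f x) \<partial>M) + (\<integral>y. outer (g y) \<partial>N)"
proof -
  let ?P = "M \<Otimes>\<^sub>M N"
  let ?c = "\<lambda>i j p. f (fst p) $ i * g (snd p) $ j"
  have fi: "integrable M (\<lambda>x. f x $ i)" and gi: "integrable N (\<lambda>y. g y $ i)" for i
    using integrable_component_of_outer M N f g by blast+
  have "(\<integral>y. g y $ i \<partial>N) = 0" for i
    using integral_vec_nth[OF integrable_vecI[of N g, OF gi], of i] g(3) by simp
  then have c: "integrable ?P (?c i j)" "(\<integral>p. ?c i j p \<partial>?P) = 0" for i j
    using integrable_mult_pair[OF M N fi gi] by simp_all
  note o = integrable_fst_snd(1,2)[OF M N f(2)] integrable_fst_snd(3,4)[OF M N g(2)]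
  have on: "integrable ?P (\<lambda>p. outer (f (fst p)) $ i $ j)" "integrable ?P (\<lambda>p. outer (g (snd p)) $ i $ j)" for i j
    by (intro integrable_bounded_linear[OF bounded_linear_vec_nth] o)+
  have oe: "outer (f (fst p) + g (snd p)) $ i $ j
      = outer (f (fst p)) $ i $ j + outer (g (snd p)) $ i $ j + ?c i j p + ?c j i p" for p i j
    by (simp add: outer_def algebra_simps)
  show I: "integrable ?P (\<lambda>p. outer (f (fst p) + g (snd p)))"
    unfolding oe by (intro integrable_vecI) (simp add: oe on c)
  have n2: "(\<integral>p. h p \<partial>?P) $ i $ j = (\<integral>p. h p $ i $ j \<partial>?P)" if "integrable ?P h" for h :: "'a \<times> 'b \<Rightarrow> real^'n^'n" and i j
    using that integrable_bounded_linear[OF bounded_linear_vec_nth that] by (simp add: integral_vec_nth)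
  show "(\<integral>p. outer (f (fst p) + g (snd p)) \<partial>?P) = (\<integral>x. outer (f x) \<partial>M) + (\<integral>y. outer (g y) \<partial>N)"
    by (simp add: vec_eq_iff o(2,4)[symmetric] n2[OF I] n2[OF o(1)] n2[OF o(3)] oe on c)
qed

context gauss_traj
begin

definition Xmom :: "nat \<Rightarrow> real^'n^'n" where "Xmom t = (\<integral>x. outer x \<partial>state_law t)"

definition noise_cov :: "real^'n^'n" where
  "noise_cov = B ** \<Sigma> ** transpose B + (\<integral>w. outer w \<partial>\<nu>)"

lemma action_noise_moments:
  "integrable (gauss \<Sigma>) (\<lambda>e. outer (F *v e))" "(\<integral>e. outer (F *v e) \<partial>gauss \<Sigma>) = F ** \<Sigma> ** transpose F"
  "(\<integral>e. F *v e \<partial>gauss \<Sigma>) = 0" for F :: "real^'k^'m"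
  using gauss_moments[OF S]
  by (simp_all add: outer_linear_image integrable_bounded_linear[OF bounded_linear_congruence]
      integral_bounded_linear[OF bounded_linear_congruence] integral_bounded_linear[OF matrix_vector_mul_bounded_linear])

lemma state_moments:
  "integrable (state_law t) outer"
  "Xmom (Suc t) = (A - B ** K) ** Xmom t ** transpose (A - B ** K) + noise_cov"
proof -
  let ?C = "A - B ** K"
  let ?F = "\<lambda>(p, w). (?C *v fst p + B *v snd p) + w"
  have step: "integrable ((state_law t \<Otimes>\<^sub>M gauss \<Sigma>) \<Otimes>\<^sub>M \<nu>) (\<lambda>q. outer (?F q))"
    "(\<integral>q. outer (?F q) \<partial>((state_law t \<Otimes>\<^sub>M gauss \<Sigma>) \<Otimes>\<^sub>M \<nu>)) = ?C ** Xmom t ** transpose ?C + noise_cov"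
    if i: "integrable (state_law t) outer" for t
  proof -
    have f: "integrable (state_law t) (\<lambda>x. outer (?C *v x))" "(\<integral>x. outer (?C *v x) \<partial>state_law t) = ?C ** Xmom t ** transpose ?C"
      using i by (simp_all add: outer_linear_image Xmom_def integrable_bounded_linear[OF bounded_linear_congruence]
        integral_bounded_linear[OF bounded_linear_congruence])
    have m1: "(\<lambda>x. ?C *v x) \<in> borel_measurable (state_law t)" "(\<lambda>e. B *v e) \<in> borel_measurable (gauss \<Sigma>)"
      "(\<lambda>w. w) \<in> borel_measurable \<nu>"
      "(\<lambda>p. ?C *v fst p + B *v snd p) \<in> borel_measurable (state_law t \<Otimes>\<^sub>M gauss \<Sigma>)" by simp_all
    \<comment> \<open>Two independent sums in succession: the exploration noise \<open>B e\<close>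
      is added to \<open>(A - B K) x\<close>, and then \<open>w\<close> to the result.\<close>
    note 1 = outer_independent_sum[where f = "\<lambda>x. ?C *v x" and g = "\<lambda>e. B *v e",
        OF state_law_prob gauss_prob m1(1) f(1) m1(2) action_noise_moments(1,3)]
    have p: "prob_space (state_law t \<Otimes>\<^sub>M gauss \<Sigma>)"
    proof -
      interpret X: prob_space "state_law t" by (rule state_law_prob)
      interpret G: prob_space "gauss \<Sigma>" by (rule gauss_prob)
      interpret XG: pair_prob_space "state_law t" "gauss \<Sigma>" ..
      show ?thesis by (rule XG.prob_space_axioms)
    qed
    note 2 = outer_independent_sum[where f = "\<lambda>p. ?C *v fst p + B *v snd p" and g = "\<lambda>w. w",
        OF p nu(1) m1(4) 1(1) m1(3) nu(3,4)]
    show "integrable ((state_law t \<Otimes>\<^sub>M gauss \<Sigma>) \<Otimes>\<^sub>M \<nu>) (\<lambda>q. outer (?F q))"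
      using 2(1) by (simp add: split_beta')
    show "(\<integral>q. outer (?F q) \<partial>((state_law t \<Otimes>\<^sub>M gauss \<Sigma>) \<Otimes>\<^sub>M \<nu>)) = ?C ** Xmom t ** transpose ?C + noise_cov"
      using 2(2) 1(2) by (simp add: split_beta' f(2) action_noise_moments(2) noise_cov_def)
  qed
  have m: "?F \<in> measurable ((state_law t \<Otimes>\<^sub>M gauss \<Sigma>) \<Otimes>\<^sub>M \<nu>) borel" for t by (simp add: split_beta')
  have i: "integrable (state_law t) outer" for t
  proof (induction t)
    case 0 then show ?case by (simp add: state_law_0 init)
  next
    case (Suc t)
    show ?case using step(1)[OF Suc] m[of t] by (simp add: state_law_Suc integrable_distr_eq)
  qed
  show "integrable (state_law t) outer" by (rule i)
  show "Xmom (Suc t) = ?C ** Xmom t ** transpose ?C + noise_cov"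
    using step(2)[OF i, of t] m[of t] by (simp add: Xmom_def state_law_Suc integral_distr)
qed

lemma Xmom_0: "Xmom 0 = (\<integral>x. outer x \<partial>init)"
  by (simp add: Xmom_def state_law_0)

text \<open>The combination \<open>snd (z t) + K *v fst (z t)\<close> recovers the exploration
  noise, which is the argument of the quadratic in the log-density.\<close>

lemma T_moments:
  "integrable T (\<lambda>z. outer (fst (z t)))" "(\<integral>z. outer (fst (z t)) \<partial>T) = Xmom t"
  "integrable T (\<lambda>z. outer (snd (z t)))" "(\<integral>z. outer (snd (z t)) \<partial>T) = K ** Xmom t ** transpose K + \<Sigma>"
  "integrable T (\<lambda>z. outer (snd (z t) + K *v fst (z t)))" "(\<integral>z. outer (snd (z t) + K *v fst (z t)) \<partial>T) = \<Sigma>"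
proof -
  show "integrable T (\<lambda>z. outer (fst (z t)))" "(\<integral>z. outer (fst (z t)) \<partial>T) = Xmom t"
    using state_moments(1)[of t] unfolding Xmom_def state_law_def
    by (simp_all add: integrable_distr_eq integral_distr)
  let ?G = "\<lambda>(x, e). (x, e - K *v x)"
  let ?P = "state_law t \<Otimes>\<^sub>M gauss \<Sigma>"
  have m: "?G \<in> measurable ?P borel" by (simp add: borel_prod[symmetric] split_beta')
  have tr: "integrable T (\<lambda>z. outer (h (z t))) \<longleftrightarrow> integrable ?P (\<lambda>p. outer (h (?G p)))"
    "(\<integral>z. outer (h (z t)) \<partial>T) = (\<integral>p. outer (h (?G p)) \<partial>?P)"
    if [measurable]: "h \<in> borel_measurable borel" for h :: "(real^'n) \<times> (real^'k) \<Rightarrow> real^'m"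
  proof -
    have "integrable (distr T borel (\<lambda>z. z t)) (\<lambda>p. outer (h p)) \<longleftrightarrow> integrable (distr ?P borel ?G) (\<lambda>p. outer (h p))"
      by (simp only: law_state_action)
    then show "integrable T (\<lambda>z. outer (h (z t))) \<longleftrightarrow> integrable ?P (\<lambda>p. outer (h (?G p)))"
      using m by (simp add: integrable_distr_eq)
    have "(\<integral>p. outer (h p) \<partial>distr T borel (\<lambda>z. z t)) = (\<integral>p. outer (h p) \<partial>distr ?P borel ?G)"
      by (simp only: law_state_action)
    then show "(\<integral>z. outer (h (z t)) \<partial>T) = (\<integral>p. outer (h (?G p)) \<partial>?P)"
      using m by (simp add: integral_distr)
  qed
  have h: "(\<lambda>p::(real^'n) \<times> (real^'k). snd p) \<in> borel_measurable borel"
    "(\<lambda>p::(real^'n) \<times> (real^'k). snd p + K *v fst p) \<in> borel_measurable borel"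
    by (simp_all add: borel_prod[symmetric])
  have f: "integrable (state_law t) (\<lambda>x. outer ((- K) *v x))" "(\<integral>x. outer ((- K) *v x) \<partial>state_law t) = (- K) ** Xmom t ** transpose (- K)"
    using state_moments(1)[of t] by (simp_all only: outer_linear_image Xmom_def integrable_bounded_linear[OF bounded_linear_congruence]
      integral_bounded_linear[OF bounded_linear_congruence])
  have neg: "(- K) *v x = - (K *v x)" for x by (simp add: matrix_vector_mult_def vec_eq_iff sum_negf)
  have "(- K) ** Xmom t ** transpose (- K) = K ** Xmom t ** transpose K"
    by (simp add: matrix_matrix_mult_def transpose_def vec_eq_iff sum_negf)
  then have f2: "(\<integral>x. outer ((- K) *v x) \<partial>state_law t) = K ** Xmom t ** transpose K" using f(2) by simp
  have m1: "(\<lambda>x. (- K) *v x) \<in> borel_measurable (state_law t)" "(\<lambda>e. e) \<in> borel_measurable (gauss \<Sigma>)"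
    by simp_all
  note 1 = outer_independent_sum[where f = "\<lambda>x. (- K) *v x" and g = "\<lambda>e. e",
      OF state_law_prob gauss_prob m1(1) f(1) m1(2) gauss_moments(2)[OF S] gauss_moments(5)[OF S]]
  show "integrable T (\<lambda>z. outer (snd (z t)))" "(\<integral>z. outer (snd (z t)) \<partial>T) = K ** Xmom t ** transpose K + \<Sigma>"
    using tr[OF h(1)] 1 f2 by (simp_all add: split_beta' neg gauss_moments(3)[OF S])
  note 2 = integrable_fst_snd(3,4)[OF state_law_prob gauss_prob gauss_moments(2)[OF S], of t]
  show "integrable T (\<lambda>z. outer (snd (z t) + K *v fst (z t)))" "(\<integral>z. outer (snd (z t) + K *v fst (z t)) \<partial>T) = \<Sigma>"
    using tr[OF h(2)] 2 by (simp_all add: split_beta' gauss_moments(3)[OF S])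
qed

end

section \<open>Expected discounted cost\<close>

lemma sums_ereal_ennreal:
  assumes "\<And>t. 0 \<le> a t"
  shows "(\<lambda>t. ereal (a t)) sums enn2ereal (\<Sum>t. ennreal (a t))"
proof (cases "summable a")
  case True
  then have "(\<Sum>t. ennreal (a t)) = ennreal (suminf a)" using assms by (intro suminf_ennreal2)
  moreover have "0 \<le> suminf a" using assms True by (intro suminf_nonneg) auto
  ultimately show ?thesis using True by (simp add: sums_ereal summable_sums)
next
  case False
  then have "(\<Sum>t. ennreal (a t)) = top" using assms summable_suminf_not_top[of a] by blast
  moreover have "(\<Sum>t. ereal (a t)) = \<infinity>" using summable_ereal[of a] assms False by blast
  moreover have "(\<lambda>t. ereal (a t)) sums (\<Sum>t. ereal (a t))"
    using assms by (intro summable_sums summable_ereal_pos) simp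
  ultimately show ?thesis by simp
qed

text \<open>Only the subtracted series has to converge: a possibly infinite nonnegative sum minus a
  finite number is unambiguous.\<close>

lemma suminf_ereal_diff:
  assumes "\<And>t. 0 \<le> a t" "b sums s"
  shows "(\<Sum>t. ereal (a t - b t)) = enn2ereal (\<Sum>t. ennreal (a t)) - ereal s"
proof (rule sums_unique[symmetric])
  have "(\<lambda>n. (\<Sum>t<n. ereal (a t)) + ereal (- (\<Sum>t<n. b t))) \<longlonglongrightarrow> enn2ereal (\<Sum>t. ennreal (a t)) + ereal (- s)"
  proof (rule tendsto_add_ereal_nonneg)
    show "enn2ereal (\<Sum>t. ennreal (a t)) \<noteq> - \<infinity>"
      by (rule not_MInfty_nonneg[OF enn2ereal_nonneg])
    show "(\<lambda>n. \<Sum>t<n. ereal (a t)) \<longlonglongrightarrow> enn2ereal (\<Sum>t. ennreal (a t))"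
      using sums_ereal_ennreal[OF assms(1)] by (simp add: sums_def)
    show "(\<lambda>n. ereal (- (\<Sum>t<n. b t))) \<longlonglongrightarrow> ereal (- s)"
      using assms(2) by (intro tendsto_ereal tendsto_minus) (simp add: sums_def)
  qed simp
  then show "(\<lambda>t. ereal (a t - b t)) sums (enn2ereal (\<Sum>t. ennreal (a t)) - ereal s)"
    by (simp add: sums_def sum_subtractf minus_ereal_def)
qed

text \<open>The negative part of \<open>f\<close> is at most \<open>\<bar>h\<bar>\<close>, hence
  integrable, so the convention for \<open>\<infinity> - \<infinity>\<close> is never met and the
  expectation splits even when \<open>G\<close> has infinite integral.\<close>

lemma ereal_expectation_diff:
  assumes G: "G \<in> borel_measurable M" and h: "integrable M h"
    and f: "AE z in M. f z = enn2ereal (G z) - ereal (h z)"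
  shows "ereal_expectation M f = enn2ereal (\<integral>\<^sup>+z. G z \<partial>M) - ereal (\<integral>z. h z \<partial>M)"
proof -
  let ?f = "\<lambda>z. enn2ereal (G z) - ereal (h z)"
  have hm: "h \<in> borel_measurable M" using h by auto
  have E: "ereal_expectation M f
      = enn2ereal (\<integral>\<^sup>+z. e2ennreal (?f z) \<partial>M) - enn2ereal (\<integral>\<^sup>+z. e2ennreal (- ?f z) \<partial>M)"
    unfolding ereal_expectation_def
    using f by (intro arg_cong2[where f = minus] arg_cong[where f = enn2ereal] nn_integral_cong_AE) auto
  have habs: "(\<integral>\<^sup>+z. ennreal \<bar>h z\<bar> \<partial>M) < \<infinity>" using h by (simp add: integrable_iff_bounded)
  show ?thesis
  proof (cases "(\<integral>\<^sup>+z. G z \<partial>M) = top")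
    case True
    \<comment> \<open>An infinite integral of \<open>G\<close> must come from the positive part of
      \<open>f\<close>, the remainder being integrable.\<close>
    have le: "G z \<le> e2ennreal (?f z) + ennreal \<bar>h z\<bar>" for z
    proof (cases "G z")
      case (real r)
      have "ennreal r \<le> ennreal (max 0 (r - h z) + \<bar>h z\<bar>)" by (rule ennreal_leI) linarith
      also have "\<dots> = ennreal (max 0 (r - h z)) + ennreal \<bar>h z\<bar>" by (rule ennreal_plus) simp_all
      finally have "ennreal r \<le> ennreal (max 0 (r - h z)) + ennreal \<bar>h z\<bar>" .
      moreover have "ennreal (max 0 (r - h z)) = ennreal (r - h z)"
        by (auto simp: max_def ennreal_neg)
      ultimately show ?thesis using real by simp
    qed simp
    have "top = (\<integral>\<^sup>+z. G z \<partial>M)" using True by simp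
    also have "\<dots> \<le> (\<integral>\<^sup>+z. e2ennreal (?f z) + ennreal \<bar>h z\<bar> \<partial>M)" by (intro nn_integral_mono le)
    also have "\<dots> = (\<integral>\<^sup>+z. e2ennreal (?f z) \<partial>M) + (\<integral>\<^sup>+z. ennreal \<bar>h z\<bar> \<partial>M)"
      using G hm by (intro nn_integral_add) auto
    finally have p: "(\<integral>\<^sup>+z. e2ennreal (?f z) \<partial>M) = top" using habs by (auto simp: top_unique)
    have le: "e2ennreal (- ?f z) \<le> ennreal \<bar>h z\<bar>" for z
    proof (cases "G z")
      case (real r) then show ?thesis by (auto intro!: ennreal_leI)
    qed (simp add: e2ennreal_neg)
    have "(\<integral>\<^sup>+z. e2ennreal (- ?f z) \<partial>M) \<le> (\<integral>\<^sup>+z. ennreal \<bar>h z\<bar> \<partial>M)" by (intro nn_integral_mono le)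
    then have "(\<integral>\<^sup>+z. e2ennreal (- ?f z) \<partial>M) < top" using habs by (auto intro: le_less_trans)
    then obtain r where "0 \<le> r" "(\<integral>\<^sup>+z. e2ennreal (- ?f z) \<partial>M) = ennreal r"
      by (cases "\<integral>\<^sup>+z. e2ennreal (- ?f z) \<partial>M") auto
    then show ?thesis using E p True by simp
  next
    case False
    have fin: "AE z in M. G z \<noteq> \<infinity>" using nn_integral_noteq_infinite[OF G] False by simp
    define g where "g = (\<lambda>z. enn2real (G z))"
    have gm: "g \<in> borel_measurable M" using G by (simp add: g_def)
    have gG: "AE z in M. G z = ennreal (g z)"
      using fin by eventually_elim (simp add: g_def less_top)
    then have Ig: "(\<integral>\<^sup>+z. G z \<partial>M) = (\<integral>\<^sup>+z. ennreal (g z) \<partial>M)" by (rule nn_integral_cong_AE)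
    have g0: "0 \<le> g z" for z by (simp add: g_def)
    have gi: "integrable M g"
      using gm g0 Ig False by (intro integrableI_nonneg) (auto simp: less_top)
    have "(\<integral>\<^sup>+z. e2ennreal (?f z) \<partial>M) = (\<integral>\<^sup>+z. ennreal (g z - h z) \<partial>M)"
      "(\<integral>\<^sup>+z. e2ennreal (- ?f z) \<partial>M) = (\<integral>\<^sup>+z. ennreal (- (g z - h z)) \<partial>M)"
      using gG g0 by (auto intro!: nn_integral_cong_AE elim!: eventually_mono)
    then have "ereal_expectation M f = enn2ereal (\<integral>\<^sup>+z. ennreal (g z - h z) \<partial>M) - enn2ereal (\<integral>\<^sup>+z. ennreal (- (g z - h z)) \<partial>M)"
      using E by simp
    also have "\<dots> = ereal (\<integral>z. g z - h z \<partial>M)"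
    proof -
      have "integrable M (\<lambda>z. g z - h z)" using gi h by auto
      then obtain r q where "0 \<le> r" "0 \<le> q" "(\<integral>\<^sup>+z. ennreal (g z - h z) \<partial>M) = ennreal r"
        "(\<integral>\<^sup>+z. ennreal (- (g z - h z)) \<partial>M) = ennreal q" "(\<integral>z. g z - h z \<partial>M) = r - q"
        by (rule integrableE)
      then show ?thesis by simp
    qed
    also have "\<dots> = ereal (\<integral>z. g z \<partial>M) - ereal (\<integral>z. h z \<partial>M)" using gi h by simp
    also have "ereal (\<integral>z. g z \<partial>M) = enn2ereal (\<integral>\<^sup>+z. G z \<partial>M)"
      using nn_integral_eq_integral[OF gi] g0 Ig by (simp add: integral_nonneg_AE)
    finally show ?thesis .
  qed
qed

lemma AE_summable_norm:
  fixes f :: "nat \<Rightarrow> 'a \<Rightarrow> 'b::{banach, second_countable_topology}"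
  assumes i: "\<And>t. integrable M (f t)" and s: "summable (\<lambda>t. \<integral>z. norm (f t z) \<partial>M)"
  shows "AE z in M. summable (\<lambda>t. norm (f t z))"
proof -
  have "(\<integral>\<^sup>+z. (\<Sum>t. ennreal (norm (f t z))) \<partial>M) = (\<Sum>t. \<integral>\<^sup>+z. ennreal (norm (f t z)) \<partial>M)"
    using i by (intro nn_integral_suminf) auto
  also have "\<dots> = (\<Sum>t. ennreal (\<integral>z. norm (f t z) \<partial>M))"
    using i by (intro suminf_cong nn_integral_eq_integral) auto
  also have "\<dots> = ennreal (\<Sum>t. \<integral>z. norm (f t z) \<partial>M)"
    using s by (intro suminf_ennreal2) auto
  finally have "(\<integral>\<^sup>+z. (\<Sum>t. ennreal (norm (f t z))) \<partial>M) \<noteq> \<infinity>" by simp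
  moreover have "(\<lambda>z. \<Sum>t. ennreal (norm (f t z))) \<in> borel_measurable M" using i by auto
  ultimately have "AE z in M. (\<Sum>t. ennreal (norm (f t z))) \<noteq> \<infinity>"
    by (rule nn_integral_noteq_infinite[rotated])
  then show ?thesis
    by eventually_elim (auto intro!: summable_suminf_not_top)
qed

text \<open>A Cauchy product with the geometric series. The strict bound \<open>i < t\<close> delays
  each contribution by one step, whence the factor \<open>\<gamma>\<close> in front.\<close>

lemma geometric_tail_convolution_sums:
  fixes w :: "nat \<Rightarrow> real"
  assumes g: "0 \<le> \<gamma>" "\<gamma> < 1" and w: "\<And>i. 0 \<le> \<gamma> ^ i * w i" "(\<lambda>i. \<gamma> ^ i * w i) sums s"
  shows "(\<lambda>t. \<gamma> ^ t * (\<Sum>i<t. w i)) sums (\<gamma> / (1 - \<gamma>) * s)"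
proof -
  have "(\<lambda>k. \<Sum>i\<le>k. (\<gamma> ^ i * w i) * \<gamma> ^ (k - i)) sums ((\<Sum>i. \<gamma> ^ i * w i) * (\<Sum>k. \<gamma> ^ k))"
    using g w by (intro Cauchy_product_sums) (auto simp: sums_summable)
  also have "(\<Sum>i. \<gamma> ^ i * w i) * (\<Sum>k. \<gamma> ^ k) = s / (1 - \<gamma>)"
    using g w(2) by (simp add: suminf_geometric sums_unique[symmetric])
  also have "(\<lambda>k. \<Sum>i\<le>k. (\<gamma> ^ i * w i) * \<gamma> ^ (k - i)) = (\<lambda>k. \<gamma> ^ k * (\<Sum>i<Suc k. w i))"
  proof
    fix k
    have "(\<gamma> ^ i * w i) * \<gamma> ^ (k - i) = \<gamma> ^ k * w i" if "i \<le> k" for i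
    proof -
      have "\<gamma> ^ k = \<gamma> ^ i * \<gamma> ^ (k - i)" using that by (simp add: power_add[symmetric])
      then show ?thesis by simp
    qed
    then show "(\<Sum>i\<le>k. (\<gamma> ^ i * w i) * \<gamma> ^ (k - i)) = \<gamma> ^ k * (\<Sum>i<Suc k. w i)"
      unfolding lessThan_Suc_atMost sum_distrib_left by (intro sum.cong) auto
  qed
  \<comment> \<open>The extra \<open>\<gamma>\<close> raises the power to \<open>Suc k\<close>, the
    number of summands; the missing term at 0 is an empty sum.\<close>
  finally have "(\<lambda>k. \<gamma> * (\<gamma> ^ k * (\<Sum>i<Suc k. w i))) sums (\<gamma> * (s / (1 - \<gamma>)))"
    by (rule sums_mult)
  then have "(\<lambda>k. \<gamma> ^ Suc k * (\<Sum>i<Suc k. w i)) sums (\<gamma> / (1 - \<gamma>) * s)"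
    by (simp add: mult_ac)
  from sums_Suc[OF this] show ?thesis by simp
qed

lemma integral_outer_psd: "integrable M (\<lambda>z. outer (f z)) \<Longrightarrow> (\<integral>z. outer (f z) \<partial>M) \<in> sym_psd"
proof -
  assume i: "integrable M (\<lambda>z. outer (f z))"
  have "transpose (\<integral>z. outer (f z) \<partial>M) = (\<integral>z. transpose (outer (f z)) \<partial>M)"
    by (rule integral_bounded_linear[OF bounded_linear_transpose i, symmetric])
  also have "\<dots> = (\<integral>z. outer (f z) \<partial>M)"
    by (simp add: outer_def transpose_def vec_eq_iff mult.commute)
  finally have t: "transpose (\<integral>z. outer (f z) \<partial>M) = (\<integral>z. outer (f z) \<partial>M)" .
  have o: "x \<bullet> (outer y *v x) = (x \<bullet> y)\<^sup>2" for x y :: "real^'b"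
    by (simp add: outer_def matrix_vector_mult_def inner_vec_def power2_eq_square sum_product
        sum_distrib_left mult_ac)
  have "x \<bullet> ((\<integral>z. outer (f z) \<partial>M) *v x) = (\<integral>z. (x \<bullet> f z)\<^sup>2 \<partial>M)" for x
    using integral_bounded_linear[OF bounded_linear_quadratic i, of x x] by (simp add: o)
  then show ?thesis by (simp add: sym_psd_def t)
qed

section \<open>Expected discounted cost as a series of second moments\<close>

context gauss_traj
begin

abbreviation C where "C \<equiv> A - B ** K"

lemma noise_cov_psd: "noise_cov \<in> sym_psd"
  unfolding noise_cov_def using integral_outer_psd[of \<nu> "\<lambda>w. w"] nu(3)
    integral_outer_psd[OF action_noise_moments(1)[of B]]
  by (intro psd_add) (simp_all add: action_noise_moments(2))

lemma Xmom_psd: "Xmom t \<in> sym_psd"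
  unfolding Xmom_def using integral_outer_psd[of "state_law t" "\<lambda>x. x"] state_moments(1) by simp

text \<open>The covariance recursion is unrolled from the last step backwards and moved onto the
  cost side by duality; in the noise sum, \<open>i\<close> is the age of the noise at time
  \<open>t\<close>. The induction varies \<open>H\<close> because each step replaces it by
  \<open>congr C H\<close>.\<close>

lemma trace_Xmom:
  "trace (H ** Xmom t) = trace ((congr C ^^ t) H ** Xmom 0) + (\<Sum>i<t. trace ((congr C ^^ i) H ** noise_cov))"
proof (induction t arbitrary: H)
  case (Suc t)
  have "trace (H ** Xmom (Suc t)) = trace (congr C H ** Xmom t) + trace (H ** noise_cov)"
    by (simp add: state_moments(2) matrix_add_ldistrib trace_add trace_congr_mul)
  then show ?case
    unfolding Suc sum.lessThan_Suc_shift by (simp add: funpow_swap1)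
qed simp

text \<open>The noise entering at each time from 1 on starts a cost-to-go of its own, worth
  \<open>trace (P ** noise_cov)\<close>; discounting these entries gives
  \<open>\<gamma> + \<gamma>^2 + ... = \<gamma> / (1 - \<gamma>)\<close>.\<close>

lemma trace_Xmom_sums:
  assumes H: "H \<in> sym_psd" and g: "0 < \<gamma>" "\<gamma> < 1" and P: "disc_series \<gamma> C H sums P"
  shows "(\<lambda>t. \<gamma> ^ t * trace (H ** Xmom t)) sums (trace (P ** Xmom 0) + \<gamma> / (1 - \<gamma>) * trace (P ** noise_cov))"
proof -
  have s: "(\<lambda>t. \<gamma> ^ t * trace ((congr C ^^ t) H ** Y)) sums trace (P ** Y)" for Y
    using bounded_linear.sums[OF bounded_linear_trace_mul P, of Y]
    by (simp add: disc_series_def scalar_matrix_assoc[symmetric] trace_scaleR)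
  have "(\<lambda>t. \<gamma> ^ t * (\<Sum>i<t. trace ((congr C ^^ i) H ** noise_cov))) sums (\<gamma> / (1 - \<gamma>) * trace (P ** noise_cov))"
    using g by (intro geometric_tail_convolution_sums s)
      (auto intro!: mult_nonneg_nonneg trace_mul_psd_nonneg congr_pow_psd H noise_cov_psd)
  from sums_add[OF s[of "Xmom 0"] this] show ?thesis
    by (subst trace_Xmom) (simp add: distrib_left)
qed

lemma trace_Xmom_ge: "H \<in> sym_psd \<Longrightarrow> trace ((congr C ^^ t) H ** Xmom 0) \<le> trace (H ** Xmom t)"
  by (subst trace_Xmom) (auto intro!: sum_nonneg trace_mul_psd_nonneg congr_pow_psd noise_cov_psd)

text \<open>Mean of the quadratic stage cost at time \<open>t\<close>: the action
  \<open>e - K x\<close> contributes \<open>K^T R K\<close> to the state weight and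
  \<open>trace (R ** \<Sigma>)\<close> from the noise.\<close>

definition run_moment :: "real^'n^'n \<Rightarrow> real^'k^'k \<Rightarrow> nat \<Rightarrow> real" where
  "run_moment Q R t = trace ((Q + transpose K ** R ** K) ** Xmom t) + trace (R ** \<Sigma>)"

text \<open>\<open>\<tau>\<close> times the differential entropy of a Gaussian with covariance
  \<open>\<Sigma>\<close>, which is the same at every state, summed over the geometric
  series.\<close>

definition entropy_term :: "real \<Rightarrow> real \<Rightarrow> real" where
  "entropy_term \<gamma> \<tau> = \<tau> / 2 * (real CARD('k) + ln ((2 * pi) ^ CARD('k) * det \<Sigma>)) / (1 - \<gamma>)"

lemma run_moment_nonneg:
  assumes "Q \<in> sym_psd" "R \<in> sym_psd" shows "0 \<le> run_moment Q R t"
  unfolding run_moment_def using assms sym_pd_psd[OF S]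
  by (intro add_nonneg_nonneg trace_mul_psd_nonneg psd_add psd_congruence Xmom_psd)

lemma stage_moment:
  assumes "Q \<in> sym_psd" "R \<in> sym_psd"
  shows "(\<integral>\<^sup>+z. ennreal (fst (z t) \<bullet> (Q *v fst (z t)) + snd (z t) \<bullet> (R *v snd (z t))) \<partial>T) = ennreal (run_moment Q R t)"
proof -
  note q = integrable_quadratic[OF T_moments(1)[of t], of Q] integrable_quadratic[OF T_moments(3)[of t], of R]
  have "(\<integral>\<^sup>+z. ennreal (fst (z t) \<bullet> (Q *v fst (z t)) + snd (z t) \<bullet> (R *v snd (z t))) \<partial>T)
      = ennreal (\<integral>z. fst (z t) \<bullet> (Q *v fst (z t)) + snd (z t) \<bullet> (R *v snd (z t)) \<partial>T)"
    using q assms by (intro nn_integral_eq_integral) (auto simp: sym_psd_def)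
  also have "(\<integral>z. fst (z t) \<bullet> (Q *v fst (z t)) + snd (z t) \<bullet> (R *v snd (z t)) \<partial>T)
      = trace (Q ** Xmom t) + trace (R ** (K ** Xmom t ** transpose K + \<Sigma>))"
    using q by (simp add: integral_quadratic[OF T_moments(1)] integral_quadratic[OF T_moments(3)] T_moments(2,4))
  also have "trace (R ** (K ** Xmom t ** transpose K + \<Sigma>)) = trace (transpose K ** R ** K ** Xmom t) + trace (R ** \<Sigma>)"
    using trace_mul_sym[of "transpose K" "R ** K ** Xmom t"]
    by (simp add: matrix_add_ldistrib trace_add matrix_mul_assoc)
  finally show ?thesis
    by (simp add: run_moment_def matrix_matrix_mult_add_rdistrib trace_add add.assoc)
qed

text \<open>The quadratic cost \<open>a\<close> is nonnegative and may have infinite sum. The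
  log-density part has the same mean at every time up to the discount, so its series is integrable
  and is almost surely finite.\<close>

lemma expected_discounted_cost:
  assumes Q: "Q \<in> sym_psd" and R: "R \<in> sym_psd" and g: "0 < \<gamma>" "\<gamma> < 1" and tau: "0 < \<tau>"
  shows "ereal_expectation T (\<lambda>z. \<Sum>t. ereal (\<gamma> ^ t * stage_cost \<tau> Q R pol (fst (z t)) (snd (z t))))
    = enn2ereal (\<Sum>t. ennreal (\<gamma> ^ t * run_moment Q R t)) - ereal (entropy_term \<gamma> \<tau>)"
proof -
  define a where "a = (\<lambda>t (z :: nat \<Rightarrow> (real^'n) \<times> (real^'k)).
    \<gamma> ^ t * (fst (z t) \<bullet> (Q *v fst (z t)) + snd (z t) \<bullet> (R *v snd (z t))))"
  define e where "e = (\<lambda>t (z :: nat \<Rightarrow> (real^'n) \<times> (real^'k)). snd (z t) + K *v fst (z t))"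
  \<comment> \<open>Minus \<open>\<tau>\<close> times the log-density is a nonnegative form in the
    exploration noise, giving \<open>q\<close>, plus the normalization constant, which becomes
    \<open>c\<close> below.\<close>
  define q where "q = (\<lambda>t z. \<gamma> ^ t * (\<tau> / 2 * (e t z \<bullet> (matrix_inv \<Sigma> *v e t z))))"
  define c where "c = \<tau> / 2 * ln ((2 * pi) ^ CARD('k) * det \<Sigma>)"
  have a0: "0 \<le> a t z" for t z using Q R g by (auto simp: a_def sym_psd_def)
  have q0: "0 \<le> q t z" for t z
    using sym_psdD(2)[OF sym_pd_psd[OF pd_inverse(3)[OF S]]] g tau by (simp add: q_def)
  have cost: "\<gamma> ^ t * stage_cost \<tau> Q R pol (fst (z t)) (snd (z t)) = a t z - (q t z + \<gamma> ^ t * c)" for t z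
  proof -
    define v where "v = e t z \<bullet> (matrix_inv \<Sigma> *v e t z)"
    have "ln (pol (fst (z t)) (snd (z t))) = - v / 2 - ln ((2 * pi) ^ CARD('k) * det \<Sigma>) / 2"
      by (simp add: gaussian_policy_def ln_gaussian_density[OF S] e_def v_def)
    then show ?thesis
      by (simp add: stage_cost_def a_def q_def c_def v_def[symmetric]) (simp add: field_simps)
  qed
  have qi: "integrable T (q t)" for t
    unfolding q_def e_def by (intro integrable_mult_right integrable_quadratic T_moments)
  have qI: "(\<integral>z. q t z \<partial>T) = \<gamma> ^ t * (\<tau> / 2 * real CARD('k))" for t
    unfolding q_def e_def
    by (simp add: integral_quadratic T_moments pd_inverse(2)[OF S] trace_I)
  have qs: "(\<lambda>t. \<integral>z. q t z \<partial>T) sums (1 / (1 - \<gamma>) * (\<tau> / 2 * real CARD('k)))"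
    unfolding qI using g by (intro sums_mult2 geometric_sums) simp
  have qn: "norm (q t z) = q t z" for t z using q0 by simp
  have s2: "summable (\<lambda>t. \<integral>z. norm (q t z) \<partial>T)" unfolding qn using qs by (rule sums_summable)
  have ae: "AE z in T. summable (\<lambda>t. norm (q t z))" by (rule AE_summable_norm[OF qi s2])
  have Si: "integrable T (\<lambda>z. \<Sum>t. q t z)" by (rule integrable_suminf[OF qi ae s2])
  have SI: "(\<integral>z. (\<Sum>t. q t z) \<partial>T) = 1 / (1 - \<gamma>) * (\<tau> / 2 * real CARD('k))"
    using integral_suminf[OF qi ae s2] sums_unique[OF qs] by simp
  interpret T: prob_space T by (rule T_prob)
  let ?h = "\<lambda>z. (\<Sum>t. q t z) + c / (1 - \<gamma>)"
  have [measurable]: "a t \<in> borel_measurable T" for t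
    unfolding a_def
    using borel_measurable_integrable[OF integrable_quadratic[OF T_moments(1)[of t], of Q]]
      borel_measurable_integrable[OF integrable_quadratic[OF T_moments(3)[of t], of R]] by simp
  have "ereal_expectation T (\<lambda>z. \<Sum>t. ereal (\<gamma> ^ t * stage_cost \<tau> Q R pol (fst (z t)) (snd (z t))))
    = enn2ereal (\<integral>\<^sup>+z. (\<Sum>t. ennreal (a t z)) \<partial>T) - ereal (\<integral>z. ?h z \<partial>T)"
  proof (rule ereal_expectation_diff)
    show "integrable T ?h" using Si by simp
    show "AE z in T. (\<Sum>t. ereal (\<gamma> ^ t * stage_cost \<tau> Q R pol (fst (z t)) (snd (z t))))
        = enn2ereal (\<Sum>t. ennreal (a t z)) - ereal (?h z)"
      using ae
    proof eventually_elim
      case (elim z)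
      then have "(\<lambda>t. q t z) sums (\<Sum>t. q t z)" unfolding qn by (rule summable_sums)
      moreover have "(\<lambda>t. \<gamma> ^ t * c) sums (1 / (1 - \<gamma>) * c)"
        using g by (intro sums_mult2 geometric_sums) simp
      ultimately have "(\<lambda>t. q t z + \<gamma> ^ t * c) sums (?h z)" using sums_add by fastforce
      then show ?case unfolding cost by (rule suminf_ereal_diff[OF a0])
    qed
  qed simp
  also have "(\<integral>\<^sup>+z. (\<Sum>t. ennreal (a t z)) \<partial>T) = (\<Sum>t. \<integral>\<^sup>+z. ennreal (a t z) \<partial>T)"
    by (rule nn_integral_suminf) simp
  also have "(\<lambda>t. \<integral>\<^sup>+z. ennreal (a t z) \<partial>T) = (\<lambda>t. ennreal (\<gamma> ^ t * run_moment Q R t))"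
  proof
    fix t
    have m: "(\<lambda>z. ennreal (fst (z t) \<bullet> (Q *v fst (z t)) + snd (z t) \<bullet> (R *v snd (z t)))) \<in> borel_measurable T"
      using borel_measurable_integrable[OF integrable_quadratic[OF T_moments(1)[of t], of Q]]
        borel_measurable_integrable[OF integrable_quadratic[OF T_moments(3)[of t], of R]] by simp
    have "(\<integral>\<^sup>+z. ennreal (a t z) \<partial>T) = ennreal (\<gamma> ^ t) * ennreal (run_moment Q R t)"
      unfolding a_def using g by (simp add: ennreal_mult' nn_integral_cmult[OF m] stage_moment[OF Q R])
    then show "(\<integral>\<^sup>+z. ennreal (a t z) \<partial>T) = ennreal (\<gamma> ^ t * run_moment Q R t)"
      using g by (simp add: ennreal_mult')
  qed
  also have "(\<integral>z. ?h z \<partial>T) = entropy_term \<gamma> \<tau>"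
    using Si by (simp add: SI T.prob_space entropy_term_def c_def add_divide_distrib[symmetric] algebra_simps)
  finally show ?thesis .
qed

end

section \<open>Extreme singular values as bounds for quadratic forms\<close>

lemma quadratic_ge_imp_psd: "(\<And>x. c * (x \<bullet> x) \<le> x \<bullet> (Y *v x)) \<Longrightarrow> transpose Y = Y \<Longrightarrow> Y - c *\<^sub>R mat 1 \<in> sym_psd"
  by (simp add: sym_psd_def transpose_diff transpose_scalar mv_simps)

text \<open>\<open>sigma_min\<close> is a \<open>Min\<close>, which is meaningful on finite sets
  only. Eigenvectors of \<open>Y^T Y\<close> for distinct eigenvalues are orthogonal, hence
  independent, so there are finitely many.\<close>

lemma finite_singular_values: "finite (singular_values Y)" for Y :: "real^'n^'n"
proof -
  let ?M = "transpose Y ** Y"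
  define E where "E = {l. \<exists>v. v \<noteq> 0 \<and> ?M *v v = l *\<^sub>R v}"
  define ev where "ev = (\<lambda>l. SOME v. v \<noteq> 0 \<and> ?M *v v = l *\<^sub>R v)"
  have ev: "ev l \<noteq> 0" "?M *v ev l = l *\<^sub>R ev l" if "l \<in> E" for l
    using someI_ex[of "\<lambda>v. v \<noteq> 0 \<and> ?M *v v = l *\<^sub>R v"] that by (auto simp: E_def ev_def)
  have sM: "transpose ?M = ?M" by (simp add: matrix_transpose_mul)
  have orth: "ev l \<bullet> ev m = 0" if "l \<in> E" "m \<in> E" "l \<noteq> m" for l m
  proof -
    have "m * (ev l \<bullet> ev m) = ev l \<bullet> (?M *v ev m)" using ev(2)[OF that(2)] by simp
    also have "\<dots> = ev m \<bullet> (?M *v ev l)" by (rule sym_inner[OF sM])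
    also have "\<dots> = l * (ev l \<bullet> ev m)" using ev(2)[OF that(1)] by (simp add: inner_commute)
    finally show ?thesis using that(3) by simp
  qed
  have inj: "inj_on ev E"
  proof (rule inj_onI, rule ccontr)
    fix l m assume "l \<in> E" "m \<in> E" "ev l = ev m" "l \<noteq> m"
    then show False using orth[of l m] ev(1)[of m] by simp
  qed
  have "pairwise orthogonal (ev ` E)"
    using orth by (auto simp: pairwise_def orthogonal_def)
  moreover have "0 \<notin> ev ` E" using ev(1) by force
  ultimately have "independent (ev ` E)" by (rule pairwise_orthogonal_independent)
  then have "finite (ev ` E)" by (rule independent_imp_finite)
  then have "finite E" using inj by (rule finite_imageD)
  moreover have "singular_values Y = sqrt ` E" by (auto simp: singular_values_def E_def)
  ultimately show ?thesis by simp
qed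

text \<open>Let \<open>v\<close> minimize the form on the unit sphere, with value \<open>l\<close>.
  Then \<open>Y - l I\<close> is psd and its form vanishes at \<open>v\<close>, so \<open>v\<close>
  lies in its kernel. Thus \<open>l\<close> is an eigenvalue, hence a singular value, and bounds
  \<open>sigma_min Y\<close> from above.\<close>

lemma sigma_min_le:
  fixes Y :: "real^'n^'n"
  assumes Y: "Y \<in> sym_psd"
  shows "sigma_min Y * (x \<bullet> x) \<le> x \<bullet> (Y *v x)"
proof -
  have ne: "sphere (0 :: real^'n) 1 \<noteq> {}" by simp
  have "continuous_on (sphere 0 1) (\<lambda>x. x \<bullet> (Y *v x))"
    by (intro continuous_intros linear_continuous_on_compose[OF _ matrix_vector_mul_linear])
  then obtain v where v: "v \<in> sphere 0 1" "\<And>y. y \<in> sphere 0 1 \<Longrightarrow> v \<bullet> (Y *v v) \<le> y \<bullet> (Y *v y)"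
    using continuous_attains_inf[OF compact_sphere ne] by metis
  define l where "l = v \<bullet> (Y *v v)"
  have l0: "0 \<le> l" using sym_psdD(2)[OF Y] by (simp add: l_def)
  have vv: "v \<bullet> v = 1" using v(1) by (simp add: dot_square_norm)
  have le: "l * (y \<bullet> y) \<le> y \<bullet> (Y *v y)" for y
  proof (cases "y = 0")
    case False
    then have "l \<le> ((1 / norm y) *\<^sub>R y) \<bullet> (Y *v ((1 / norm y) *\<^sub>R y))"
      unfolding l_def by (intro v(2)) simp
    also have "\<dots> = (y \<bullet> (Y *v y)) / (norm y)\<^sup>2" by (simp add: mv_simps power2_eq_square)
    finally show ?thesis using False by (simp add: field_simps power2_norm_eq_inner)
  qed simp
  then have Z: "Y - l *\<^sub>R mat 1 \<in> sym_psd" by (intro quadratic_ge_imp_psd sym_psdD(1)[OF Y])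
  have "v \<bullet> ((Y - l *\<^sub>R mat 1) *v v) = 0" by (simp add: mv_simps vv l_def[symmetric])
  from psd_kernel[OF Z this] have "Y *v v = l *\<^sub>R v" by (simp add: mv_simps)
  then have "(transpose Y ** Y) *v v = (l * l) *\<^sub>R v"
    by (simp add: sym_psdD(1)[OF Y] mv_simps)
  moreover have "v \<noteq> 0" using vv by auto
  ultimately have "sqrt (l * l) \<in> singular_values Y" unfolding singular_values_def by blast
  then have "l \<in> singular_values Y" using l0 by simp
  then have "sigma_min Y \<le> l" unfolding sigma_min_def by (intro Min_le finite_singular_values)
  then have "sigma_min Y * (x \<bullet> x) \<le> l * (x \<bullet> x)" by (intro mult_right_mono) auto
  then show ?thesis using le[of x] by simp
qed

lemma spectral_norm_ge:
  fixes Y :: "real^'n^'n" shows "x \<bullet> (Y *v x) \<le> spectral_norm Y * (x \<bullet> x)"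
proof -
  have "x \<bullet> (Y *v x) \<le> norm x * norm (Y *v x)" by (rule norm_cauchy_schwarz)
  also have "\<dots> \<le> norm x * (spectral_norm Y * norm x)"
    unfolding spectral_norm_def by (intro mult_left_mono onorm matrix_vector_mul_bounded_linear norm_ge_zero)
  also have "\<dots> = spectral_norm Y * (x \<bullet> x)" by (simp add: dot_square_norm power2_eq_square)
  finally show ?thesis .
qed

lemma integrable_outer_return: "integrable (return borel x) outer" "(\<integral>y. outer y \<partial>return borel x) = outer (x :: real^'n)"
proof -
  show "(\<integral>y. outer y \<partial>return borel x) = outer x" by (rule integral_return) auto
  have "(\<integral>\<^sup>+y. ennreal (norm (outer y)) \<partial>return borel x) = ennreal (norm (outer x))"
    by (rule nn_integral_return) auto
  then show "integrable (return borel x) outer" by (simp add: integrable_iff_bounded)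
qed

section \<open>Value, cost and discounted state covariance of a Gaussian policy\<close>

context gauss_traj
begin

lemma run_moment_eq:
  fixes Q :: "real^'n^'n" and R :: "real^'k^'k"
  defines "M \<equiv> Q + transpose K ** R ** K"
  shows "run_moment Q R t = trace ((congr C ^^ t) M ** (\<integral>x. outer x \<partial>init))
    + ((\<Sum>i<t. trace ((congr C ^^ i) M ** noise_cov)) + trace (R ** \<Sigma>))"
  unfolding run_moment_def M_def trace_Xmom[of _ t] Xmom_0 by simp

lemma J_value_eq:
  assumes Q: "Q \<in> sym_psd" and R: "R \<in> sym_psd" and g: "0 < \<gamma>" "\<gamma> < 1" and tau: "0 < \<tau>"
  defines "M \<equiv> Q + transpose K ** R ** K"
  shows "J_value \<gamma> \<tau> A B Q R \<nu> pol x = enn2ereal (\<Sum>t. ennreal (\<gamma> ^ t * (x \<bullet> ((congr C ^^ t) M *v x)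
    + ((\<Sum>i<t. trace ((congr C ^^ i) M ** noise_cov)) + trace (R ** \<Sigma>))))) - ereal (entropy_term \<gamma> \<tau>)"
proof -
  interpret X: gauss_traj A B \<nu> K \<Sigma> "return borel x"
    by (rule gauss_traj.intro) (simp_all add: nu S prob_space_return integrable_outer_return)
  show ?thesis
    unfolding J_value_def X.expected_discounted_cost[OF assms(1-5)] X.run_moment_eq integrable_outer_return
      trace_mul_outer M_def ..
qed

text \<open>The cost averages the values of deterministic starts over the initial law. Each term is
  affine in \<open>outer x\<close>, so Tonelli turns the average into the series for the trajectory
  started from that law.\<close>

lemma C_cost_eq:
  assumes Q: "Q \<in> sym_psd" and R: "R \<in> sym_psd" and g: "0 < \<gamma>" "\<gamma> < 1" and tau: "0 < \<tau>"
  shows "C_cost \<gamma> \<tau> A B Q R \<nu> init K \<Sigma>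
    = enn2ereal (\<Sum>t. ennreal (\<gamma> ^ t * run_moment Q R t)) - ereal (entropy_term \<gamma> \<tau>)"
proof -
  define M where "M = Q + transpose K ** R ** K"
  define k where "k = (\<lambda>t. (\<Sum>i<t. trace ((congr C ^^ i) M ** noise_cov)) + trace (R ** \<Sigma>))"
  define G where "G = (\<lambda>t x. \<gamma> ^ t * (x \<bullet> ((congr C ^^ t) M *v x) + k t))"
  interpret D: prob_space init by (rule init(1))
  have M: "M \<in> sym_psd" unfolding M_def by (intro psd_add Q psd_congruence R)
  have k: "0 \<le> k t" for t
    unfolding k_def by (intro add_nonneg_nonneg sum_nonneg trace_mul_psd_nonneg congr_pow_psd M noise_cov_psd
      R sym_pd_psd[OF S])
  have G0: "0 \<le> G t x" for t x
    unfolding G_def using g k sym_psdD(2)[OF congr_pow_psd[OF M]] by simp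
  have qi: "integrable init (\<lambda>x. x \<bullet> ((congr C ^^ t) M *v x))" for t
    using integrable_quadratic[of init "\<lambda>x. x"] init(3) by simp
  have Gi: "integrable init (G t)" for t unfolding G_def using qi by simp
  have GI: "(\<integral>x. G t x \<partial>init) = \<gamma> ^ t * run_moment Q R t" for t
    unfolding G_def using qi integral_quadratic[of init "\<lambda>x. x"] init(3)
    by (simp add: D.prob_space run_moment_eq k_def M_def)
  have "C_cost \<gamma> \<tau> A B Q R \<nu> init K \<Sigma> = ereal_expectation init (J_value \<gamma> \<tau> A B Q R \<nu> pol)"
    by (simp add: C_cost_def S)
  also have "\<dots> = enn2ereal (\<integral>\<^sup>+x. (\<Sum>t. ennreal (G t x)) \<partial>init) - ereal (\<integral>x. entropy_term \<gamma> \<tau> \<partial>init)"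
  proof (rule ereal_expectation_diff)
    show "AE x in init. J_value \<gamma> \<tau> A B Q R \<nu> pol x = enn2ereal (\<Sum>t. ennreal (G t x)) - ereal (entropy_term \<gamma> \<tau>)"
      by (simp add: J_value_eq[OF assms] G_def k_def M_def)
  qed (use Gi in auto)
  also have "(\<integral>\<^sup>+x. (\<Sum>t. ennreal (G t x)) \<partial>init) = (\<Sum>t. \<integral>\<^sup>+x. ennreal (G t x) \<partial>init)"
    using Gi by (intro nn_integral_suminf) auto
  also have "\<dots> = (\<Sum>t. ennreal (\<gamma> ^ t * run_moment Q R t))"
    by (intro suminf_cong) (simp add: nn_integral_eq_integral[OF Gi] G0 GI)
  finally show ?thesis by (simp add: D.prob_space)
qed

text \<open>Sum and integral are exchanged by absolute convergence, the norm of
  \<open>outer x\<close> being bounded by a multiple of its trace.\<close>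

lemma integral_discounted_outer:
  assumes g: "0 < \<gamma>" and s: "summable (\<lambda>t. \<gamma> ^ t * trace (Xmom t))"
  shows "(\<lambda>t. \<gamma> ^ t *\<^sub>R Xmom t) sums S_mat \<gamma> A B \<nu> init K \<Sigma>"
proof -
  let ?c = "real CARD('n) * real CARD('n)"
  let ?f = "\<lambda>t (z :: nat \<Rightarrow> (real^'n) \<times> (real^'k)). \<gamma> ^ t *\<^sub>R outer (fst (z t))"
  have fi: "integrable T (?f t)" for t using T_moments(1)[of t] by simp
  have "summable (\<lambda>t. \<integral>z. norm (?f t z) \<partial>T)"
  proof (rule summable_comparison_test)
    show "summable (\<lambda>t. ?c * (\<gamma> ^ t * trace (Xmom t)))" using s by (rule summable_mult)
    have "norm (\<integral>z. norm (?f t z) \<partial>T) \<le> ?c * (\<gamma> ^ t * trace (Xmom t))" for t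
    proof -
      have n: "norm (outer x) \<le> ?c * (x \<bullet> x)" for x :: "real^'n"
      proof -
        have "outer x \<in> sym_psd" using integral_outer_psd[OF integrable_outer_return(1)] by (simp add: integrable_outer_return)
        moreover have "trace (outer x) = x \<bullet> x" using trace_mul_outer[of "mat 1" x] by simp
        ultimately show ?thesis using psd_norm_le_trace by (metis mult.assoc)
      qed
      have "(\<integral>z. norm (?f t z) \<partial>T) \<le> (\<integral>z. ?c * (\<gamma> ^ t * (fst (z t) \<bullet> (mat 1 *v fst (z t)))) \<partial>T)"
      proof (rule integral_mono)
        show "integrable T (\<lambda>z. ?c * (\<gamma> ^ t * (fst (z t) \<bullet> (mat 1 *v fst (z t)))))"
          by (intro integrable_mult_right integrable_quadratic T_moments(1))
        show "norm (?f t z) \<le> ?c * (\<gamma> ^ t * (fst (z t) \<bullet> (mat 1 *v fst (z t))))" for z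
          using mult_left_mono[OF n[of "fst (z t)"], of "\<gamma> ^ t"] g by (simp add: mult_ac)
        show "integrable T (\<lambda>z. norm (?f t z))" by (rule integrable_norm[OF fi])
      qed
      also have "\<dots> = ?c * (\<gamma> ^ t * trace (Xmom t))"
        using integral_quadratic[OF T_moments(1)[of t], of "mat 1"] by (simp add: T_moments(2))
      finally show ?thesis by simp
    qed
    then show "\<exists>N. \<forall>t\<ge>N. norm (\<integral>z. norm (?f t z) \<partial>T) \<le> ?c * (\<gamma> ^ t * trace (Xmom t))" by blast
  qed
  from sums_integral[OF fi AE_summable_norm[OF fi this] this]
  show ?thesis by (simp add: S_mat_def T_moments(2))
qed

end

section \<open>Convergence of policy optimization\<close>

locale lqr_entropy = lqr_opt \<gamma> A Q B R Kstar P \<rho>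
  for \<gamma> :: real and A Q :: "real^'n^'n" and B :: "real^'k^'n" and R :: "real^'k^'k"
    and Kstar :: "real^'n^'k" and P :: "real^'n^'n" and \<rho> :: real +
  fixes \<tau> :: real and \<nu> D :: "(real^'n) measure"
  assumes tau: "0 < \<tau>"
    and noise: "prob_space \<nu>" "sets \<nu> = sets borel" "integrable \<nu> outer" "(LINT w|\<nu>. w) = 0"
    and init: "prob_space D" "sets D = sets borel" "integrable D outer"
      "sigma_min (LINT x|D. outer x) > 0"
begin

definition X0 :: "real^'n^'n" where "X0 = (LINT x|D. outer x)"
definition W :: "real^'n^'n" where "W = (LINT w|\<nu>. outer w)"
abbreviation \<mu> :: real where "\<mu> \<equiv> sigma_min X0"

text \<open>The initial covariance plus the discounted total of the noise injected at times 1, 2,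
  and so on. Paired with the Lyapunov solution it gives the expected quadratic state cost.\<close>

definition drive :: "real^'k^'k \<Rightarrow> real^'n^'n" where
  "drive \<Sigma> = X0 + (\<gamma> / (1 - \<gamma>)) *\<^sub>R (B ** \<Sigma> ** transpose B + W)"

definition soft_gain :: "real^'n^'n \<Rightarrow> real^'k^'k" where
  "soft_gain H = (\<tau> / 2) *\<^sub>R matrix_inv (curv H)"

definition free_energy :: "real^'n^'n \<Rightarrow> real^'k^'k \<Rightarrow> real" where
  "free_energy H \<Sigma> = trace (curv H ** \<Sigma>) - \<tau> / 2 * ln (det \<Sigma>)"

text \<open>Takes a Lyapunov solution in place of the gain, so that the dependence on it is affine
  and the covariance can be varied separately.\<close>

definition cost_value :: "real^'n^'n \<Rightarrow> real^'k^'k \<Rightarrow> real" where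
  "cost_value H \<Sigma> = trace (H ** drive \<Sigma>)
    + (trace (R ** \<Sigma>) - \<tau> / 2 * (real CARD('k) + ln ((2 * pi) ^ CARD('k) * det \<Sigma>))) / (1 - \<gamma>)"

abbreviation cost where "cost \<equiv> C_cost \<gamma> \<tau> A B Q R \<nu> D"

lemma gauss_trajI: "\<Sigma> \<in> sym_pd \<Longrightarrow> gauss_traj \<nu> \<Sigma> D"
  by (simp add: gauss_traj.intro noise init)

lemma X0_psd: "X0 \<in> sym_psd" unfolding X0_def using integral_outer_psd[of D "\<lambda>x. x"] init(3) by simp
lemma W_psd: "W \<in> sym_psd" unfolding W_def using integral_outer_psd[of \<nu> "\<lambda>x. x"] noise(3) by simp
lemma mu_pos: "0 < \<mu>" using init(4) by (simp add: X0_def)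

lemma exploration_psd: "\<Sigma> \<in> sym_psd \<Longrightarrow> B ** \<Sigma> ** transpose B \<in> sym_psd"
  using psd_congruence[of \<Sigma> "transpose B"] by simp

lemma drive_ge: "\<Sigma> \<in> sym_psd \<Longrightarrow> drive \<Sigma> - X0 \<in> sym_psd"
  unfolding drive_def using gamma by (auto intro!: psd_add psd_scaleR exploration_psd W_psd)

lemma X0_ge: "X0 - \<mu> *\<^sub>R mat 1 \<in> sym_psd"
  by (intro quadratic_ge_imp_psd sigma_min_le X0_psd sym_psdD(1))

lemma trace_X0_ge:
  assumes "G \<in> sym_psd" shows "\<mu> * trace G \<le> trace (G ** X0)"
  using trace_mono_psd[OF X0_ge assms]
  by (simp add: trace_mul_sym[of G] scalar_matrix_assoc[symmetric] trace_scaleR)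

lemma soft_gain_pd: "H \<in> sym_psd \<Longrightarrow> soft_gain H \<in> sym_pd"
  unfolding soft_gain_def using tau by (intro pd_scaleR pd_inverse(3) curv_pd) auto

lemma cost_finite:
  assumes S: "\<Sigma> \<in> sym_pd" and K: "lyap K Pk"
  shows "cost K \<Sigma> = ereal (cost_value Pk \<Sigma>)"
proof -
  interpret G: gauss_traj A B \<nu> K \<Sigma> D by (rule gauss_trajI[OF S])
  note R' = sym_pd_psd[OF R]
  have "disc_series \<gamma> (A - B ** K) (run_cost K) sums Pk"
    using lyap_disc_series[OF K] by (simp add: cl_def)
  from G.trace_Xmom_sums[OF run_cost_psd gamma this]
  have "(\<lambda>t. \<gamma> ^ t * trace (run_cost K ** G.Xmom t)) sums trace (Pk ** drive \<Sigma>)"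
    by (simp add: G.Xmom_0 G.noise_cov_def X0_def W_def drive_def matrix_add_ldistrib trace_add
        matrix_scalar_ac scalar_matrix_assoc[symmetric] trace_scaleR distrib_left add_divide_distrib)
  moreover have "(\<lambda>t. \<gamma> ^ t * trace (R ** \<Sigma>)) sums (1 / (1 - \<gamma>) * trace (R ** \<Sigma>))"
    using gamma by (intro sums_mult2 geometric_sums) simp
  ultimately have s: "(\<lambda>t. \<gamma> ^ t * G.run_moment Q R t) sums (trace (Pk ** drive \<Sigma>) + 1 / (1 - \<gamma>) * trace (R ** \<Sigma>))"
    using sums_add by (fastforce simp: G.run_moment_def run_cost_def distrib_left)
  have nn: "0 \<le> \<gamma> ^ t * G.run_moment Q R t" for t
    using G.run_moment_nonneg[OF Q R'] gamma by simp
  have "(\<Sum>t. ennreal (\<gamma> ^ t * G.run_moment Q R t)) = ennreal (\<Sum>t. \<gamma> ^ t * G.run_moment Q R t)"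
    using nn s by (intro suminf_ennreal2) (auto simp: sums_summable)
  moreover have "0 \<le> (\<Sum>t. \<gamma> ^ t * G.run_moment Q R t)"
    using nn s by (intro suminf_nonneg) (auto simp: sums_summable)
  ultimately have "cost K \<Sigma> = ereal (trace (Pk ** drive \<Sigma>) + 1 / (1 - \<gamma>) * trace (R ** \<Sigma>) - G.entropy_term \<gamma> \<tau>)"
    by (simp add: G.C_cost_eq[OF Q R' gamma tau] sums_unique[OF s, symmetric])
  also have "trace (Pk ** drive \<Sigma>) + 1 / (1 - \<gamma>) * trace (R ** \<Sigma>) - G.entropy_term \<gamma> \<tau> = cost_value Pk \<Sigma>"
    by (simp add: cost_value_def G.entropy_term_def diff_divide_distrib)
  finally show ?thesis .
qed

text \<open>The initial covariance excites every direction: \<open>\<mu>\<close> times the trace of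
  each Lyapunov term is at most the expected stage cost at that time, to which noise only adds.
  Summable costs therefore force the Lyapunov series to converge.\<close>

lemma finite_cost_lyap:
  assumes "cost K \<Sigma> \<noteq> \<infinity>"
  obtains Pk where "\<Sigma> \<in> sym_pd" "lyap K Pk"
proof -
  have S: "\<Sigma> \<in> sym_pd" using assms by (auto simp: C_cost_def split: if_splits)
  interpret G: gauss_traj A B \<nu> K \<Sigma> D by (rule gauss_trajI[OF S])
  note R' = sym_pd_psd[OF R]
  let ?C = "cl K" and ?M = "run_cost K"
  have nn: "0 \<le> \<gamma> ^ t * G.run_moment Q R t" for t
    using G.run_moment_nonneg[OF Q R'] gamma by simp
  have "(\<Sum>t. ennreal (\<gamma> ^ t * G.run_moment Q R t)) \<noteq> top"
    using assms by (auto simp: G.C_cost_eq[OF Q R' gamma tau])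
  then have s: "summable (\<lambda>t. 1 / \<mu> * (\<gamma> ^ t * G.run_moment Q R t))"
    using nn by (intro summable_mult summable_suminf_not_top) auto
  have ds: "disc_series \<gamma> ?C ?M t \<in> sym_psd" for t
    using gamma by (intro disc_series_psd run_cost_psd) auto
  have "summable (\<lambda>t. trace (disc_series \<gamma> ?C ?M t))"
  proof (rule summable_comparison_test[OF _ s], intro exI allI impI)
    fix t
    have "\<mu> * trace (disc_series \<gamma> ?C ?M t) \<le> trace (disc_series \<gamma> ?C ?M t ** X0)"
      by (rule trace_X0_ge[OF ds])
    also have "\<dots> = \<gamma> ^ t * trace ((congr (A - B ** K) ^^ t) ?M ** G.Xmom 0)"
      by (simp add: disc_series_def scalar_matrix_assoc[symmetric] trace_scaleR cl_def X0_def G.Xmom_0)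
    also have "\<dots> \<le> \<gamma> ^ t * trace (?M ** G.Xmom t)"
      using gamma by (intro mult_left_mono G.trace_Xmom_ge run_cost_psd) auto
    also have "\<dots> \<le> \<gamma> ^ t * G.run_moment Q R t"
      using gamma trace_mul_psd_nonneg[OF R' sym_pd_psd[OF S]]
      by (intro mult_left_mono) (auto simp: G.run_moment_def run_cost_def)
    finally show "norm (trace (disc_series \<gamma> ?C ?M t)) \<le> 1 / \<mu> * (\<gamma> ^ t * G.run_moment Q R t)"
      using mu_pos trace_psd_nonneg[OF ds[of t]] by (simp add: field_simps)
  qed
  then have d: "disc_series \<gamma> ?C ?M sums (\<Sum>t. disc_series \<gamma> ?C ?M t)"
    using gamma by (intro summable_sums summable_disc_series run_cost_psd) auto
  have "lyap K (\<Sum>t. disc_series \<gamma> ?C ?M t)"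
    using psd_sums[OF ds d] disc_series_lyapunov[OF d] by (simp add: lyap_iff)
  then show thesis using that S by blast
qed

definition Sstar :: "real^'n^'n" where
  "Sstar = S_mat \<gamma> A B \<nu> D Kstar (soft_gain P)"

text \<open>The dual Lyapunov equation arises by summing the second-moment recursion with discount.
  The stability of \<open>Kstar\<close> gives the summability that identifies the integral
  \<open>Sstar\<close> with this sum.\<close>

lemma Sstar_lyapunov:
  "Sstar \<in> sym_psd" "Sstar = drive (soft_gain P) + \<gamma> *\<^sub>R (cl Kstar ** Sstar ** transpose (cl Kstar))"
proof -
  note S = soft_gain_pd[OF lyap_psd[OF lyap_star]]
  interpret G: gauss_traj A B \<nu> Kstar "soft_gain P" D by (rule gauss_trajI[OF S])
  let ?C = "cl Kstar"
  \<comment> \<open>The solution of \<open>c = 1 + \<gamma> \<rho>^2 c\<close>; by the norm bound on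
    the optimal loop, \<open>c I\<close> is a supersolution for the stage cost
    \<open>I\<close>.\<close>
  define c where "c = 1 / (1 - \<gamma> * \<rho>\<^sup>2)"
  have c: "0 < c" "c = 1 + \<gamma> * \<rho>\<^sup>2 * c" using rho_sq by (simp_all add: c_def field_simps)
  have "c *\<^sub>R mat 1 - (mat 1 + \<gamma> *\<^sub>R congr ?C (c *\<^sub>R mat 1)) \<in> sym_psd"
  proof -
    have "0 \<le> x \<bullet> ((c *\<^sub>R mat 1 - (mat 1 + \<gamma> *\<^sub>R congr ?C (c *\<^sub>R mat 1))) *v x)" for x
    proof -
      have "(norm (?C *v x))\<^sup>2 \<le> (\<rho> * norm x)\<^sup>2" by (intro power_mono norm_cl_star) simp
      then have "\<gamma> * c * ((?C *v x) \<bullet> (?C *v x)) \<le> \<gamma> * c * (\<rho>\<^sup>2 * (x \<bullet> x))"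
        using gamma c(1) by (intro mult_left_mono) (simp_all add: power_mult_distrib dot_square_norm)
      moreover have "c * (x \<bullet> x) = x \<bullet> x + \<gamma> * c * (\<rho>\<^sup>2 * (x \<bullet> x))"
        by (subst c(2)) (simp add: algebra_simps)
      ultimately show ?thesis by (simp add: mv_simps congr_quadratic)
    qed
    then show ?thesis
      by (simp add: sym_psd_def transpose_diff transpose_add transpose_scalar transpose_congr)
  qed
  then obtain P1 where "disc_series \<gamma> ?C (mat 1) sums P1"
    using supersolution_disc_series[OF sym_pd_psd[OF mat_1_pd] less_imp_le[OF gamma(1)]
        psd_scaleR[OF sym_pd_psd[OF mat_1_pd] less_imp_le[OF c(1)]]] by metis
  from G.trace_Xmom_sums[OF sym_pd_psd[OF mat_1_pd] gamma this[unfolded cl_def]]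
  have "summable (\<lambda>t. \<gamma> ^ t * trace (G.Xmom t))" by (simp add: sums_summable)
  from G.integral_discounted_outer[OF gamma(1) this]
  have s: "(\<lambda>t. \<gamma> ^ t *\<^sub>R G.Xmom t) sums Sstar" by (simp add: Sstar_def)
  show "Sstar \<in> sym_psd"
    by (rule psd_sums[OF _ s]) (use gamma in \<open>auto intro!: psd_scaleR G.Xmom_psd\<close>)
  have "(\<lambda>t. \<gamma> *\<^sub>R (?C ** (\<gamma> ^ t *\<^sub>R G.Xmom t) ** transpose ?C)) sums (\<gamma> *\<^sub>R (?C ** Sstar ** transpose ?C))"
    by (intro sums_scaleR_right bounded_linear.sums[OF bounded_linear_congruence s])
  moreover have "(\<lambda>t. (\<gamma> * \<gamma> ^ t) *\<^sub>R G.noise_cov) sums ((\<gamma> * (1 / (1 - \<gamma>))) *\<^sub>R G.noise_cov)"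
    using gamma by (intro sums_scaleR_left sums_mult geometric_sums) simp
  ultimately have "(\<lambda>t. \<gamma> *\<^sub>R (?C ** (\<gamma> ^ t *\<^sub>R G.Xmom t) ** transpose ?C) + (\<gamma> * \<gamma> ^ t) *\<^sub>R G.noise_cov)
      sums (\<gamma> *\<^sub>R (?C ** Sstar ** transpose ?C) + (\<gamma> * (1 / (1 - \<gamma>))) *\<^sub>R G.noise_cov)"
    by (rule sums_add)
  moreover have "\<gamma> *\<^sub>R (?C ** (\<gamma> ^ t *\<^sub>R G.Xmom t) ** transpose ?C) + (\<gamma> * \<gamma> ^ t) *\<^sub>R G.noise_cov
      = \<gamma> ^ Suc t *\<^sub>R G.Xmom (Suc t)" for t
    unfolding G.state_moments(2)
    by (simp add: scaleR_add_right cl_def matrix_scalar_ac scalar_matrix_assoc[symmetric])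
  ultimately have "(\<lambda>t. \<gamma> ^ Suc t *\<^sub>R G.Xmom (Suc t))
      sums (\<gamma> *\<^sub>R (?C ** Sstar ** transpose ?C) + (\<gamma> * (1 / (1 - \<gamma>))) *\<^sub>R G.noise_cov)"
    by simp
  from sums_unique2[OF s sums_Suc[OF this]]
  show "Sstar = drive (soft_gain P) + \<gamma> *\<^sub>R (?C ** Sstar ** transpose ?C)"
    by (simp add: drive_def G.noise_cov_def G.Xmom_0 X0_def W_def add_ac)
qed

abbreviation s where "s \<equiv> spectral_norm Sstar"

text \<open>In the psd order \<open>\<mu> I \<le> X0 \<le> drive \<le> Sstar\<close>. This keeps the
  contraction factor nonnegative, as iterating it requires.\<close>

lemma mu_le_s: "\<mu> \<le> s"
proof -
  note S = sym_pd_psd[OF soft_gain_pd[OF lyap_psd[OF lyap_star]]]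
  obtain x :: "real^'n" where x: "norm x = 1" using vector_choose_size[of 1] by auto
  have "cl Kstar ** Sstar ** transpose (cl Kstar) \<in> sym_psd"
    using psd_congruence[OF Sstar_lyapunov(1), of "transpose (cl Kstar)"] by simp
  then have "\<gamma> *\<^sub>R (cl Kstar ** Sstar ** transpose (cl Kstar)) + (drive (soft_gain P) - X0) \<in> sym_psd"
    using gamma by (intro psd_add psd_scaleR drive_ge S) auto
  then have "Sstar - X0 \<in> sym_psd" by (subst Sstar_lyapunov(2)) (simp add: algebra_simps)
  then have "x \<bullet> (X0 *v x) \<le> x \<bullet> (Sstar *v x)" using sym_psdD(2)[of "Sstar - X0" x] by (simp add: mv_simps)
  then have "\<mu> * (x \<bullet> x) \<le> s * (x \<bullet> x)"
    using sigma_min_le[OF X0_psd, of x] spectral_norm_ge[of x Sstar] by linarith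
  then show ?thesis using x by (simp add: dot_square_norm)
qed

text \<open>The exploration noise enters through \<open>R\<close> now and through
  \<open>\<gamma> B^T P' B\<close> from the next step on; both carry
  \<open>1 / (1 - \<gamma>)\<close> and combine to \<open>curv P'\<close>. All dependence on
  \<open>\<Sigma>\<close> is thus in the free energy.\<close>

lemma cost_value_eq:
  assumes "\<Sigma> \<in> sym_pd"
  shows "cost_value P' \<Sigma> = trace (P' ** (X0 + (\<gamma> / (1 - \<gamma>)) *\<^sub>R W)) + free_energy P' \<Sigma> / (1 - \<gamma>)
    - \<tau> / 2 * (real CARD('k) + ln ((2 * pi) ^ CARD('k))) / (1 - \<gamma>)"
proof -
  have "trace (transpose B ** P' ** B ** \<Sigma>) = trace (P' ** (B ** \<Sigma> ** transpose B))"
    using trace_mul_sym[of "transpose B" "P' ** B ** \<Sigma>"] by (simp add: matrix_mul_assoc)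
  then have "free_energy P' \<Sigma> = trace (R ** \<Sigma>) + \<gamma> * trace (P' ** (B ** \<Sigma> ** transpose B)) - \<tau> / 2 * ln (det \<Sigma>)"
    by (simp add: free_energy_def curv_def matrix_matrix_mult_add_rdistrib trace_add scalar_matrix_assoc[symmetric] trace_scaleR)
  moreover have "ln ((2 * pi) ^ CARD('k) * det \<Sigma>) = ln ((2 * pi) ^ CARD('k)) + ln (det \<Sigma>)"
    using pd_det_pos[OF assms] by (intro ln_mult_pos) auto
  moreover have "trace (P' ** drive \<Sigma>) = trace (P' ** (X0 + (\<gamma> / (1 - \<gamma>)) *\<^sub>R W))
      + \<gamma> * trace (P' ** (B ** \<Sigma> ** transpose B)) / (1 - \<gamma>)"
    by (simp add: drive_def matrix_add_ldistrib trace_add matrix_scalar_ac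
      scalar_matrix_assoc[symmetric] trace_scaleR distrib_left add_divide_distrib)
  ultimately show ?thesis
    unfolding cost_value_def by (simp only: add_divide_distrib diff_divide_distrib distrib_left)
qed

text \<open>The minimizer has precision matrix \<open>(2 / \<tau>) curv P'\<close>, so Gibbs'
  inequality with it as reference Gaussian, multiplied by \<open>\<tau> / 2\<close>, is the
  claim.\<close>

lemma free_energy_min:
  assumes P': "P' \<in> sym_psd" and S: "\<Sigma> \<in> sym_pd"
  shows "free_energy P' (soft_gain P') \<le> free_energy P' \<Sigma>"
proof -
  note c = curv_pd[OF P']
  have i: "matrix_inv (soft_gain P') = (2 / \<tau>) *\<^sub>R curv P'"
    unfolding soft_gain_def using tau
    by (intro matrix_inv_eqI) (simp add: matrix_scalar_ac scalar_matrix_assoc[symmetric] pd_inverse(2)[OF c])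
  have t: "trace (curv P' ** soft_gain P') = \<tau> / 2 * real CARD('k)"
    by (simp add: soft_gain_def matrix_scalar_ac scalar_matrix_assoc[symmetric] pd_inverse(1)[OF c] trace_scaleR trace_I)
  have "ln (det \<Sigma>) + real CARD('k) \<le> 2 / \<tau> * trace (curv P' ** \<Sigma>) + ln (det (soft_gain P'))"
    using gaussian_gibbs[OF S soft_gain_pd[OF P']]
    by (simp add: i scalar_matrix_assoc[symmetric] trace_scaleR)
  then have "\<tau> / 2 * (ln (det \<Sigma>) + real CARD('k)) \<le> \<tau> / 2 * (2 / \<tau> * trace (curv P' ** \<Sigma>) + ln (det (soft_gain P')))"
    using tau by (intro mult_left_mono) auto
  then show ?thesis using tau by (simp add: free_energy_def t distrib_left)
qed

section \<open>Contraction of the suboptimality along the iteration\<close>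

lemma cost_value_diff_left:
  "cost_value P1 \<Sigma> - cost_value P2 \<Sigma> = trace ((P1 - P2) ** drive \<Sigma>)"
  by (simp add: cost_value_def linear_diff[OF bounded_linear.linear[OF bounded_linear_trace_mul]])

lemma cost_value_diff_right:
  "\<Sigma>1 \<in> sym_pd \<Longrightarrow> \<Sigma>2 \<in> sym_pd \<Longrightarrow>
    cost_value P' \<Sigma>1 - cost_value P' \<Sigma>2 = (free_energy P' \<Sigma>1 - free_energy P' \<Sigma>2) / (1 - \<gamma>)"
  by (simp add: cost_value_eq diff_divide_distrib)

abbreviation Vstar where "Vstar \<equiv> cost_value P (soft_gain P)"

lemma contraction:
  assumes K: "lyap K Pk" and S: "\<Sigma> \<in> sym_pd"
    and P': "P' \<in> sym_psd" "Pk - gap K Pk - P' \<in> sym_psd"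
  shows "cost_value P' (soft_gain Pk) - Vstar \<le> (1 - \<mu> / s) * (cost_value Pk \<Sigma> - Vstar)"
proof -
  note Pk = lyap_psd[OF K] and Ps = lyap_psd[OF lyap_star]
  let ?G = "gap K Pk" and ?S = "soft_gain Pk" and ?Ss = "soft_gain P" and ?D = "Pk - P"
  note G = gap_psd[OF Pk, of K] and Sn = soft_gain_pd[OF Pk] and Ss = soft_gain_pd[OF Ps]
  define \<delta> where "\<delta> = (free_energy Pk \<Sigma> - free_energy Pk ?S) / (1 - \<gamma>)"
  have d0: "0 \<le> \<delta>" using free_energy_min[OF Pk S] gamma by (simp add: \<delta>_def)
  have d: "cost_value Pk \<Sigma> = cost_value Pk ?S + \<delta>"
    using cost_value_diff_right[OF S Sn, of Pk] by (simp add: \<delta>_def)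
  have g0: "0 \<le> trace ?G" by (rule trace_psd_nonneg[OF G])
  have upper: "cost_value Pk \<Sigma> - Vstar \<le> \<delta> + s * trace ?G"
  proof -
    \<comment> \<open>Moving \<open>\<Sigma>\<close> to its optimum for \<open>Pk\<close> accounts
      for \<open>\<delta>\<close>. Replacing that optimum by the covariance optimal for
      \<open>P\<close> can only raise the value, and leaves a comparison at equal covariance, which
      is a trace against \<open>drive\<close>.\<close>
    have "0 \<le> (free_energy Pk ?Ss - free_energy Pk ?S) / (1 - \<gamma>)"
      using free_energy_min[OF Pk Ss] gamma by simp
    then have "cost_value Pk ?S \<le> cost_value Pk ?Ss"
      using cost_value_diff_right[OF Ss Sn, of Pk] by linarith
    moreover have "cost_value Pk ?Ss - Vstar = trace (?D ** drive ?Ss)" by (rule cost_value_diff_left)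
    moreover have "trace (?D ** drive ?Ss) \<le> trace (?G ** Sstar)"
    proof -
      \<comment> \<open>Testing the one-step inequality against \<open>Sstar\<close>: by the dual
        equation the terms with \<open>\<gamma>\<close> cancel, and the trace against
        \<open>drive\<close> remains.\<close>
      have "0 \<le> trace ((?G + \<gamma> *\<^sub>R congr (cl Kstar) ?D - ?D) ** Sstar)"
        by (rule trace_mul_psd_nonneg[OF lyap_diff_star[OF K] Sstar_lyapunov(1)])
      also have "\<dots> = trace (?G ** Sstar) + \<gamma> * trace (?D ** (cl Kstar ** Sstar ** transpose (cl Kstar))) - trace (?D ** Sstar)"
        by (simp add: linear_diff[OF bounded_linear.linear[OF bounded_linear_trace_mul]]
            linear_add[OF bounded_linear.linear[OF bounded_linear_trace_mul]]
            linear_cmul[OF bounded_linear.linear[OF bounded_linear_trace_mul]] trace_congr_mul)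
      also have "trace (?D ** Sstar) = trace (?D ** drive ?Ss) + \<gamma> * trace (?D ** (cl Kstar ** Sstar ** transpose (cl Kstar)))"
        by (subst (1) Sstar_lyapunov(2)) (simp add: linear_add[OF bounded_linear.linear[OF bounded_linear_trace_mul_right]]
            linear_cmul[OF bounded_linear.linear[OF bounded_linear_trace_mul_right]])
      finally show ?thesis by simp
    qed
    moreover have "trace (?G ** Sstar) \<le> s * trace ?G"
    proof -
      have "s *\<^sub>R mat 1 - Sstar \<in> sym_psd"
        using spectral_norm_ge[of _ Sstar] sym_psdD(1)[OF Sstar_lyapunov(1)]
        by (simp add: sym_psd_def transpose_diff transpose_scalar mv_simps)
      from trace_mono_psd[OF this G] show ?thesis
        by (simp add: trace_mul_sym[of _ ?G] matrix_scalar_ac scalar_matrix_assoc[symmetric] trace_scaleR)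
    qed
    ultimately show ?thesis using d by linarith
  qed
  have lower: "\<delta> + \<mu> * trace ?G \<le> cost_value Pk \<Sigma> - cost_value P' ?S"
  proof -
    have PP: "Pk - P' \<in> sym_psd" using psd_add[OF P'(2) G] by simp
    \<comment> \<open>Of \<open>drive\<close> only the initial covariance is kept, since it is the
      part bounded below by \<open>\<mu> I\<close>.\<close>
    have "\<mu> * trace ?G \<le> trace (?G ** X0)" by (rule trace_X0_ge[OF G])
    also have "\<dots> \<le> trace ((Pk - P') ** X0)" using P'(2) by (intro trace_mono_psd X0_psd) (simp add: algebra_simps)
    also have "\<dots> \<le> trace ((Pk - P') ** drive ?S)"
      using trace_mono_psd[OF drive_ge[OF sym_pd_psd[OF Sn]] PP] by (simp add: trace_mul_sym[of "Pk - P'"])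
    finally show ?thesis using cost_value_diff_left[of Pk ?S P'] d by linarith
  qed
  have spos: "0 < s" using mu_pos mu_le_s by linarith
  have "\<mu> / s * (cost_value Pk \<Sigma> - Vstar) \<le> \<mu> / s * (\<delta> + s * trace ?G)"
    using upper mu_pos spos by (intro mult_left_mono) auto
  also have "\<dots> = \<mu> / s * \<delta> + \<mu> * trace ?G" using spos by (simp add: field_simps)
  \<comment> \<open>The gap terms match exactly after scaling the upper bound by
    \<open>\<mu> / s\<close>; the term in \<open>\<delta>\<close> only needs this ratio to be at
    most one.\<close>
  also have "\<dots> \<le> \<delta> + \<mu> * trace ?G"
    using mu_le_s mu_pos spos d0 by (intro add_right_mono mult_left_le_one_le) auto
  finally have "\<mu> / s * (cost_value Pk \<Sigma> - Vstar) \<le> \<delta> + \<mu> * trace ?G" .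
  with lower show ?thesis by (simp add: algebra_simps)
qed

text \<open>The induction carries a Lyapunov solution along, since only its existence identifies
  \<open>P_mat\<close> and makes the next iterate meaningful.\<close>

lemma ipo_convergence:
  fixes K :: "nat \<Rightarrow> real^'n^'k" and \<Sigma> :: "nat \<Rightarrow> real^'k^'k"
  assumes K0: "lyap (K 0) P0" and S0: "\<Sigma> 0 \<in> sym_pd"
    and K: "\<And>t. K (Suc t) = improve (K t) (P_mat \<gamma> A B Q R (K t))"
    and S: "\<And>t. \<Sigma> (Suc t) = soft_gain (P_mat \<gamma> A B Q R (K t))"
  shows "\<exists>Pt. lyap (K t) Pt \<and> \<Sigma> t \<in> sym_pd \<and>
    cost_value Pt (\<Sigma> t) - Vstar \<le> (1 - \<mu> / s) ^ t * (cost_value P0 (\<Sigma> 0) - Vstar)"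
proof (induction t)
  case 0 then show ?case using K0 S0 by auto
next
  case (Suc t)
  then obtain Pt where Pt: "lyap (K t) Pt" "\<Sigma> t \<in> sym_pd"
    "cost_value Pt (\<Sigma> t) - Vstar \<le> (1 - \<mu> / s) ^ t * (cost_value P0 (\<Sigma> 0) - Vstar)" by blast
  have eq: "K (Suc t) = improve (K t) Pt" "\<Sigma> (Suc t) = soft_gain Pt"
    using P_mat_eq[OF Pt(1)] K S by simp_all
  obtain P' where P': "lyap (improve (K t) Pt) P'" "Pt - gap (K t) Pt - P' \<in> sym_psd"
    using lyap_improve[OF Pt(1)] .
  have "0 \<le> 1 - \<mu> / s" using mu_le_s mu_pos by (simp add: field_simps)
  then have "(1 - \<mu> / s) * (cost_value Pt (\<Sigma> t) - Vstar) \<le> (1 - \<mu> / s) * ((1 - \<mu> / s) ^ t * (cost_value P0 (\<Sigma> 0) - Vstar))"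
    using Pt(3) by (rule mult_left_mono[rotated])
  with contraction[OF Pt(1,2) lyap_psd[OF P'(1)] P'(2)]
  have "cost_value P' (soft_gain Pt) - Vstar \<le> (1 - \<mu> / s) ^ Suc t * (cost_value P0 (\<Sigma> 0) - Vstar)"
    by simp
  then show ?case using P'(1) soft_gain_pd[OF lyap_psd[OF Pt(1)]] by (auto simp: eq)
qed

end

text \<open>From \<open>1 - x \<le> exp (- x)\<close>. For \<open>a \<le> 0\<close> no logarithmic
  bound on \<open>N\<close> is assumed, and the left side is already nonpositive.\<close>

lemma geometric_decay_below:
  fixes m s a \<epsilon> :: real
  assumes "0 < m" "m \<le> s" "0 < \<epsilon>" and N: "0 < a \<Longrightarrow> s / m * ln (a / \<epsilon>) \<le> real N"
  shows "(1 - m / s) ^ N * a \<le> \<epsilon>"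
proof (cases "0 < a")
  case True
  have s: "0 < s" using assms by linarith
  have "(1 - m / s) ^ N \<le> exp (- (m / s)) ^ N"
    using assms s exp_ge_add_one_self[of "- (m / s)"] by (intro power_mono) auto
  also have "\<dots> = exp (- (m / s * real N))" by (simp add: exp_of_nat_mult[symmetric] mult.commute)
  also have "\<dots> \<le> exp (- ln (a / \<epsilon>))"
    using N[OF True] assms s by (simp add: field_simps)
  also have "\<dots> = \<epsilon> / a" using True assms by (simp add: exp_minus)
  finally show ?thesis using True by (simp add: field_simps)
next
  case False
  have "0 \<le> (1 - m / s) ^ N" using assms by (intro zero_le_power) (simp add: field_simps)
  then have "(1 - m / s) ^ N * a \<le> 0" using False by (simp add: mult_nonneg_nonpos)
  then show ?thesis using assms by linarith
qed

theorem theorem5p1: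
  fixes \<gamma> \<tau> \<rho> \<epsilon> :: real
    and A Q P :: "real^'n^'n" and B :: "real^'k^'n" and R \<Sigma>star :: "real^'k^'k"
    and Kstar :: "real^'n^'k"
    and D \<nu> :: "(real^'n) measure"
    and K :: "nat \<Rightarrow> real^'n^'k" and \<Sigma> :: "nat \<Rightarrow> real^'k^'k"
    and N :: nat
  assumes gamma: "0 < \<gamma>" "\<gamma> < 1" and tau: "0 < \<tau>"
    and Q: "Q \<in> sym_psd" and R: "R \<in> sym_pd"
    and noise: "prob_space \<nu>" "sets \<nu> = sets borel"
      "integrable \<nu> outer" "(LINT w|\<nu>. w) = 0"
    and init: "prob_space D" "sets D = sets borel"
      "integrable D outer" "sigma_min (LINT x|D. outer x) > 0"
    and optimal: "lyapunov_solution \<gamma> A B Q R Kstar P"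
      "Kstar = \<gamma> *\<^sub>R (gain_inv \<gamma> B R P ** transpose B ** P ** A)"
      "\<Sigma>star = (\<tau> / 2) *\<^sub>R gain_inv \<gamma> B R P"
    and rho: "0 < \<rho>" "\<rho> < 1 / sqrt \<gamma>" "spectral_norm (A - B ** Kstar) \<le> \<rho>"
    and ipo_init: "(K 0, \<Sigma> 0) \<in> omega"
    and ipo_K: "\<And>t. K (Suc t) =
      K t - gain_inv \<gamma> B R (P_mat \<gamma> A B Q R (K t)) ** E_mat \<gamma> A B Q R (K t)"
    and ipo_Sigma: "\<And>t. \<Sigma> (Suc t) =
      (\<tau> / 2) *\<^sub>R gain_inv \<gamma> B R (P_mat \<gamma> A B Q R (K t))"
    and eps: "0 < \<epsilon>"
    and N: "ereal (real N) \<ge>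
      ereal (spectral_norm (S_mat \<gamma> A B \<nu> D Kstar \<Sigma>star) / sigma_min (LINT x|D. outer x)) *
      ereal_log ((C_cost \<gamma> \<tau> A B Q R \<nu> D (K 0) (\<Sigma> 0) - C_cost \<gamma> \<tau> A B Q R \<nu> D Kstar \<Sigma>star)
        / ereal \<epsilon>)"
  shows "C_cost \<gamma> \<tau> A B Q R \<nu> D (K N) (\<Sigma> N) - C_cost \<gamma> \<tau> A B Q R \<nu> D Kstar \<Sigma>star \<le> ereal \<epsilon>"
proof -
  interpret lqr_entropy \<gamma> A Q B R Kstar P \<rho> \<tau> \<nu> D
    by (intro lqr_entropy.intro lqr_opt.intro lqr.intro lqr_opt_axioms.intro lqr_entropy_axioms.intro;
        fact)
  have Sst: "\<Sigma>star = soft_gain P"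
    by (simp add: optimal(3) soft_gain_def gain_inv_def curv_def)
  have Sm: "S_mat \<gamma> A B \<nu> D Kstar \<Sigma>star = Sstar" by (simp add: Sstar_def Sst)
  have pos: "s \<noteq> 0" "\<mu> \<noteq> 0" "0 < ereal (s / \<mu>)" using mu_pos mu_le_s by auto
  have cstar: "cost Kstar \<Sigma>star = ereal Vstar"
    unfolding Sst by (rule cost_finite[OF soft_gain_pd[OF lyap_psd[OF optimal(1)]] optimal(1)])
  have "cost (K 0) (\<Sigma> 0) \<noteq> \<infinity>"
  proof
    assume "cost (K 0) (\<Sigma> 0) = \<infinity>"
    then show False using N eps pos by (simp add: cstar Sm X0_def[symmetric] ereal_log_def split: if_splits)
  qed
  then obtain P0 where P0: "\<Sigma> 0 \<in> sym_pd" "lyap (K 0) P0" by (rule finite_cost_lyap)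
  define a where "a = cost_value P0 (\<Sigma> 0) - Vstar"
  have c0: "cost (K 0) (\<Sigma> 0) = ereal (cost_value P0 (\<Sigma> 0))" by (rule cost_finite[OF P0])
  \<comment> \<open>For \<open>a \<le> 0\<close> the logarithm in the hypothesis is
    \<open>-\<infinity>\<close> and puts no constraint on \<open>N\<close>.\<close>
  have N': "s / \<mu> * ln (a / \<epsilon>) \<le> real N" if "0 < a"
  proof -
    have "\<not> a / \<epsilon> \<le> 0" using that eps by (simp add: divide_le_0_iff)
    then show ?thesis
      using N eps by (simp add: cstar c0 Sm X0_def[symmetric] ereal_log_def a_def[symmetric])
  qed
  have K_Suc: "K (Suc t) = improve (K t) (P_mat \<gamma> A B Q R (K t))" for t
    by (simp add: ipo_K improve_def grad_def E_mat_def gain_inv_def curv_def cl_def)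
  have S_Suc: "\<Sigma> (Suc t) = soft_gain (P_mat \<gamma> A B Q R (K t))" for t
    by (simp add: ipo_Sigma soft_gain_def gain_inv_def curv_def)
  obtain PN where PN: "lyap (K N) PN" "\<Sigma> N \<in> sym_pd"
    "cost_value PN (\<Sigma> N) - Vstar \<le> (1 - \<mu> / s) ^ N * a"
    using ipo_convergence[of K P0 \<Sigma>, OF P0(2,1) K_Suc S_Suc] unfolding a_def by blast
  have "(1 - \<mu> / s) ^ N * a \<le> \<epsilon>"
    by (rule geometric_decay_below[OF mu_pos mu_le_s eps N'])
  then show ?thesis using PN(3) by (simp add: cost_finite[OF PN(2,1)] cstar)
qed

end
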